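(* Let $d\ge1$, let $\alpha\in(0,1)$ be such that $1/\alpha\notin\mathbb{N}$, and let $\Omega\subset\mathbb{R}^d$ be an open set of finite Lebesgue measure and finite perimeter. Let $(p_t)_{t\ge0}$ be the $\alpha$-stable semigroup on $\mathbb{R}^d$. Then $$\lim_{t\to0^+}t^{-1/\alpha}\left(H(t)-\sum_{n=1}^{[1/\alpha]}\frac{(-1)^{n-1}}{n!}t^n\,\mathrm{Per}_{\nu^{(n\alpha)}}(\Omega)\right)=\frac{\pi^{\frac{d-1}{2}}}{\Gamma\left(\frac{d+1}{2}\right)}\mathrm{Per}(\Omega)\left(\int_0^1r^dp_1(re_d)\,dr-\sum_{n=1}^{\infty}\frac{a_n}{1-n\alpha}\right).$$
   Context: The $\alpha$-stable semigroup $(p_t)_{t\ge0}$ on $\mathbb{R}^d$ is the convolution semigroup of probability measures with $\int_{\mathbb{R}^d}e^{i\langle\xi,x\rangle}p_t(dx)=e^{-t|\xi|^\alpha}$; for $t>0$, $p_t$ also denotes its (radial) density. $e_d=(0,\dots,0,1)\in\mathbb{R}^d$, and $[x]$ is the integer part of $x$. $H(t)=\int_\Omega\int_{\Omega^c-x}p_t(dy)\,dx$ (so the heat content $H_\Omega(t)=\int_\Omega\int_{\Omega-x}p_t(dy)\,dx$ equals $|\Omega|-H(t)$). For $s\in(0,1)$, $\nu^{(s)}(dz)=\mathcal{A}_{d,-s}|z|^{-d-s}\,dz$ with $\mathcal{A}_{d,-s}=\frac{2^s\,\Gamma((d+s)/2)}{\pi^{d/2}\,|\Gamma(-s/2)|}$,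 and $\mathrm{Per}_{\nu^{(s)}}(\Omega)=\int_\Omega\int_{\Omega^c-x}\nu^{(s)}(dy)\,dx=\mathcal{A}_{d,-s}\int_\Omega\int_{\Omega^c}\frac{dy\,dx}{|x-y|^{d+s}}$. $\mathrm{Per}(\Omega)=\sup\{\int_\Omega\mathrm{div}\,\phi(x)\,dx:\phi\in C_c^1(\mathbb{R}^d,\mathbb{R}^d),\ \|\phi\|_\infty\le1\}$ is the classical perimeter. For $n\ge1$, $$a_n=\frac{1}{\pi^{1+d/2}}\frac{(-1)^{n-1}}{n!}\,2^{n\alpha}\,\Gamma\left(\frac{n\alpha}{2}+1\right)\Gamma\left(\frac{n\alpha+d}{2}\right)\sin\left(\frac{\pi n\alpha}{2}\right).$$ *)

theory Defs
  imports "HOL-Probability.Probability"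
begin

definition stable_semigroup :: "real \<Rightarrow> (real \<Rightarrow> (real ^ 'n) measure) \<Rightarrow> bool" where
  "stable_semigroup \<alpha> p \<longleftrightarrow>
     (\<forall>t\<ge>0. prob_space (p t) \<and> sets (p t) = sets borel) \<and>
     (\<forall>s\<ge>0. \<forall>t\<ge>0. p (s + t) = convolution (p s) (p t)) \<and>
     (\<forall>t\<ge>0. \<forall>\<xi>. (LINT x|p t. exp (\<i> * complex_of_real (\<xi> \<bullet> x)))
                  = complex_of_real (exp (- t * norm \<xi> powr \<alpha>)))"

text \<open>Densities are determined only almost everywhere; pointwise values refer to the
  continuous version, which is unique.\<close>

definition continuous_density :: "(real ^ 'n) measure \<Rightarrow> (real ^ 'n \<Rightarrow> real) \<Rightarrow> bool" where
  "continuous_density M f \<longleftrightarrow>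
     continuous_on UNIV f \<and> (\<forall>x. 0 \<le> f x) \<and> M = density lborel (\<lambda>x. ennreal (f x))"

text \<open>The functional
  \<open>\<integral>\<^sub>\<Omega> \<integral>\<^bsub>\<Omega>\<^sup>c - x\<^esub> \<mu>(dy) dx\<close> for an arbitrary Borel measure \<open>\<mu>\<close>. It gives the function
  \<open>H\<close> for \<open>\<mu> = p\<^sub>t\<close> and the nonlocal perimeter for \<open>\<mu> = \<nu>\<^bsup>(s)\<^esup>\<close>.\<close>

definition nonlocal_perimeter :: "(real ^ 'n) measure \<Rightarrow> (real ^ 'n) set \<Rightarrow> ennreal" where
  "nonlocal_perimeter \<mu> \<Omega> =
     (\<integral>\<^sup>+x\<in>\<Omega>. emeasure \<mu> ((\<lambda>z. z - x) ` (- \<Omega>)) \<partial>lborel)"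

definition heat_loss :: "(real \<Rightarrow> (real ^ 'n) measure) \<Rightarrow> (real ^ 'n) set \<Rightarrow> real \<Rightarrow> real" where
  "heat_loss p \<Omega> t = enn2real (nonlocal_perimeter (p t) \<Omega>)"

definition stable_constant :: "nat \<Rightarrow> real \<Rightarrow> real" where
  "stable_constant d s =
     2 powr s * Gamma ((real d + s) / 2) / (pi powr (real d / 2) * \<bar>Gamma (- s / 2)\<bar>)"

definition stable_levy_measure :: "real \<Rightarrow> (real ^ 'n) measure" where
  "stable_levy_measure s = density lborel
     (\<lambda>z. ennreal (stable_constant CARD('n) s * norm z powr (- real CARD('n) - s)))"

definition divergence :: "(real ^ 'n \<Rightarrow> real ^ 'n) \<Rightarrow> real ^ 'n \<Rightarrow> real" where
  "divergence \<phi> x = (\<Sum>i\<in>UNIV. frechet_derivative \<phi> (at x) (axis i 1) $ i)"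

definition C1_compact_support :: "(real ^ 'n \<Rightarrow> real ^ 'n) \<Rightarrow> bool" where
  "C1_compact_support \<phi> \<longleftrightarrow>
     (\<exists>D :: real ^ 'n \<Rightarrow> (real ^ 'n) \<Rightarrow>\<^sub>L (real ^ 'n).
        continuous_on UNIV D \<and> (\<forall>x. (\<phi> has_derivative blinfun_apply (D x)) (at x))) \<and>
     compact (closure {x. \<phi> x \<noteq> 0})"

definition perimeter :: "(real ^ 'n) set \<Rightarrow> ereal" where
  "perimeter \<Omega> =
     (SUP \<phi> \<in> {\<phi>. C1_compact_support \<phi> \<and> (\<forall>x. norm (\<phi> x) \<le> 1)}.
        ereal (LINT x:\<Omega>|lborel. divergence \<phi> x))"

definition a_coeff :: "nat \<Rightarrow> real \<Rightarrow> nat \<Rightarrow> real" where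
  "a_coeff d \<alpha> n =
     1 / pi powr (1 + real d / 2) * ((-1) ^ (n - 1) / fact n) * 2 powr (real n * \<alpha>)
       * Gamma (real n * \<alpha> / 2 + 1) * Gamma ((real n * \<alpha> + real d) / 2)
       * sin (pi * real n * \<alpha> / 2)"

end

theory Submission
  imports Defs "HOL-Complex_Analysis.Complex_Analysis"
begin

text \<open>Write \<open>g y\<close> for the measure of the set of all \<open>x \<in> \<Omega>\<close> with \<open>x + y \<notin> \<Omega>\<close>
  (\<open>covariogram_defect\<close>). By Fubini, both the heat loss and the nonlocal perimeters are integrals of
  the single function \<open>g\<close>, against \<open>p t\<close> and against the Levy measures
  (\<open>nonlocal_perimeter_eq\<close>).

  The measure \<open>p t\<close> is the image of \<open>p 1\<close> under the dilation by \<open>u = t powr (1/\<alpha>)\<close>, so the heat loss is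
  the integral of \<open>g (u z) q(|z|)\<close>, where \<open>q\<close> is the radial profile of the density of \<open>p 1\<close>. For
  \<open>\<alpha> < 1\<close> the expansion of \<open>q\<close> at infinity, with terms \<open>a\<^sub>n r powr (- d - n \<alpha>)\<close>, converges for every
  \<open>r > 0\<close> (\<open>stable_profile_series\<close>). For \<open>n \<alpha> < 1\<close> its coefficient is, up to the factor
  \<open>(-1)^(n-1) / n!\<close>, the normalising constant of the Levy measure of index \<open>n \<alpha>\<close>
  (\<open>a_coeff_stable_constant\<close>), so that the \<open>n\<close>-th subtracted term is exactly the integral of
  \<open>g (u z) a\<^sub>n |z| powr (- d - n \<alpha>)\<close>. What remains of the heat loss is the integral of
  \<open>g (u z) K(|z|)\<close>, where \<open>K\<close> is \<open>q\<close> minus the first \<open>N = [1/\<alpha>]\<close> terms of its series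
  (\<open>profile_remainder\<close>).

  Because \<open>1/\<alpha>\<close> is not an integer, \<open>N \<alpha> < 1 < (N + 1) \<alpha>\<close>. The first inequality controls
  \<open>|z| K(|z|)\<close> at the origin, the second one at infinity, and so \<open>|z| K(|z|)\<close> is integrable on the whole
  space. Finite perimeter gives \<open>g y \<le> |y| Per(\<Omega>)\<close> and the convergence of \<open>g (u z) / u\<close> to half the
  variation \<open>V z\<close> of the indicator of \<open>\<Omega>\<close> in direction \<open>z\<close>. Dominated convergence therefore applies
  to the rescaled remainder, and integration in polar coordinates turns the limit into a constant
  times \<open>Per(\<Omega>)\<close> times the integral of \<open>K(r) r^d\<close> over the half-line. Integrating the power series
  term by term, on \<open>(0, 1]\<close> for \<open>n \<le> N\<close> and on \<open>(1, \<infinity>)\<close> for \<open>n > N\<close>, contributes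
  \<open>- a\<^sub>n / (1 - n \<alpha>)\<close> in both cases and hence the series of the theorem (\<open>integral_profile_remainder\<close>).

  Two facts carry this argument. The first is the convergent series. Cauchy's formula in the right
  half-plane represents \<open>exp (- w powr \<alpha>)\<close> as a Stieltjes transform in \<open>w\<^sup>2\<close>
  (\<open>stieltjes_stretched_exp\<close>), hence as a signed mixture of the functions \<open>exp (- s w\<^sup>2)\<close>; the stable
  density is the corresponding mixture of Gaussian densities, and expanding the mixing weight into a
  power series produces Gamma integrals (\<open>gaussian_mixture_series\<close>). The second is the existence of
  \<open>V\<close> together with its average over directions (\<open>directional_variation\<close>). For a mollified indicator
  with gradient field \<open>G\<close>, the variation in direction \<open>z\<close> is the integral of \<open>|G x \<bullet> z|\<close>, and integrating it
  against a radial kernel in \<open>z\<close> leaves only the total mass of \<open>G\<close>, whatever the directions of \<open>G\<close> are.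
  Duality with test fields shows that these masses tend to the perimeter.\<close>


section \<open>A Stieltjes representation of the stretched exponential\<close>

text \<open>The function \<open>\<lambda> \<mapsto> exp (- \<lambda> powr (\<alpha>/2))\<close> is analytic off the negative half-line, and its jump
  across the cut at \<open>- \<tau>\<^sup>2\<close> is \<open>-2 \<i>\<close> times the following function.\<close>

definition stable_jump :: "real \<Rightarrow> real \<Rightarrow> real" where
  "stable_jump \<alpha> \<tau> = exp (- (\<tau> powr \<alpha> * cos (pi * \<alpha> / 2))) * sin (\<tau> powr \<alpha> * sin (pi * \<alpha> / 2))"

lemma cos_half_angle_pos:
  assumes "0 < \<alpha>" "\<alpha> < 1"
  shows "0 < cos (pi * \<alpha> / 2)"
  using assms by (intro cos_gt_zero_pi) (auto simp: field_simps intro: order_less_le_trans[of _ 0])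

text \<open>In the right half-plane the argument of \<open>z powr \<alpha>\<close> is at most \<open>\<pi> \<alpha> / 2\<close>, which is less than
  \<open>\<pi> / 2\<close> as \<open>\<alpha> < 1\<close>. Hence \<open>exp (- z powr \<alpha>)\<close> decays there in all directions.\<close>

lemma Re_powr_half_plane:
  fixes z :: complex
  assumes \<alpha>: "0 < \<alpha>" "\<alpha> < 1" and z: "0 \<le> Re z"
  shows "norm z powr \<alpha> * cos (pi * \<alpha> / 2) \<le> Re (z powr \<alpha>)"
proof (cases "z = 0")
  case False
  have "\<bar>Im (Ln z)\<bar> \<le> pi / 2" using False z Re_Ln_pos_le by blast
  then have *: "\<bar>\<alpha> * Im (Ln z)\<bar> \<le> pi * \<alpha> / 2"
    using \<alpha> by (simp add: abs_mult field_simps)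
  have "pi * \<alpha> / 2 \<le> pi" using \<alpha> pi_gt_zero by (simp add: field_simps)
  then have "cos (pi * \<alpha> / 2) \<le> cos \<bar>\<alpha> * Im (Ln z)\<bar>"
    using * by (intro cos_monotone_0_pi_le) auto
  then have "cos (pi * \<alpha> / 2) \<le> cos (\<alpha> * Im (Ln z))" by simp
  moreover have "Re (z powr \<alpha>) = norm z powr \<alpha> * cos (\<alpha> * Im (Ln z))"
    using False by (simp add: powr_def Re_exp)
  ultimately show ?thesis by (simp add: mult_left_mono)
qed auto

lemma norm_exp_minus_powr_le:
  fixes z :: complex
  assumes \<alpha>: "0 < \<alpha>" "\<alpha> < 1" and z: "0 \<le> Re z"
  shows "norm (exp (- (z powr \<alpha>))) \<le> exp (- (cos (pi * \<alpha> / 2) * norm z powr \<alpha>))"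
  using Re_powr_half_plane[OF assms] by (simp add: norm_exp_eq_Re mult.commute)

lemma exp_minus_powr_imaginary:
  assumes "0 < \<tau>"
  shows "Im (exp (- (Complex 0 \<tau> powr \<alpha>))) = - stable_jump \<alpha> \<tau>"
    and "exp (- (Complex 0 (- \<tau>) powr \<alpha>)) = cnj (exp (- (Complex 0 \<tau> powr \<alpha>)))"
proof -
  have "Ln (Complex 0 \<tau>) = Ln (of_real \<tau> * \<i>)" by (rule arg_cong[of _ _ Ln]) (simp add: complex_eq_iff)
  also have "\<dots> = of_real (ln \<tau>) + \<i> * (pi / 2)"
    using assms by (subst Ln_times_of_real) (auto simp: Ln_of_real)
  finally have L: "Ln (Complex 0 \<tau>) = of_real (ln \<tau>) + \<i> * (pi / 2)" .
  have nz: "Complex 0 \<tau> \<noteq> 0" using assms by (simp add: complex_eq_iff)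
  have R: "Re (Complex 0 \<tau> powr \<alpha>) = \<tau> powr \<alpha> * cos (pi * \<alpha> / 2)"
    and I: "Im (Complex 0 \<tau> powr \<alpha>) = \<tau> powr \<alpha> * sin (pi * \<alpha> / 2)"
    using nz assms by (simp_all add: powr_def L Re_exp Im_exp mult_ac)
  show "Im (exp (- (Complex 0 \<tau> powr \<alpha>))) = - stable_jump \<alpha> \<tau>"
    by (simp add: Im_exp R I stable_jump_def)
  have "cnj (Complex 0 \<tau> powr \<alpha>) = cnj (Complex 0 \<tau>) powr \<alpha>"
    using assms by (subst cnj_powr) (auto simp: complex_nonpos_Reals_iff complex_is_Real_iff)
  moreover have "cnj (Complex 0 \<tau>) = Complex 0 (-\<tau>)" by (simp add: complex_eq_iff)
  ultimately show "exp (- (Complex 0 (- \<tau>) powr \<alpha>)) = cnj (exp (- (Complex 0 \<tau> powr \<alpha>)))"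
    by (simp add: exp_cnj)
qed

lemma stable_jump_bound:
  assumes "0 < \<alpha>" "\<alpha> < 1" "0 \<le> \<tau>"
  shows "\<bar>stable_jump \<alpha> \<tau>\<bar> \<le> \<tau> powr \<alpha> * exp (- (cos (pi * \<alpha> / 2) * \<tau> powr \<alpha>))"
proof -
  have "\<bar>sin (\<tau> powr \<alpha> * sin (pi * \<alpha> / 2))\<bar> \<le> \<bar>\<tau> powr \<alpha> * sin (pi * \<alpha> / 2)\<bar>"
    by (rule abs_sin_x_le_abs_x)
  also have "\<dots> \<le> \<tau> powr \<alpha> * 1"
    unfolding abs_mult by (intro mult_mono) auto
  finally have "\<bar>sin (\<tau> powr \<alpha> * sin (pi * \<alpha> / 2))\<bar> \<le> \<tau> powr \<alpha>" by simp
  then show ?thesis by (simp add: stable_jump_def abs_mult mult_ac mult_left_mono)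
qed


text \<open>Cauchy's formula for \<open>exp (- z powr \<alpha>)\<close> at \<open>w\<close>, on the rectangle with vertices \<open>\<plusminus> \<i> R\<close> and
  \<open>R \<plusminus> \<i> R\<close>. The kernel \<open>2 z / (z\<^sup>2 - w\<^sup>2)\<close> replaces the usual one: it has the same residue at \<open>w\<close>, and
  being odd it combines the values at \<open>\<i> \<tau>\<close> and \<open>- \<i> \<tau>\<close>, which are conjugate, to a multiple of their
  imaginary part \<open>\<plusminus> stable_jump \<alpha> \<tau>\<close>. The error is the contribution of the three edges off the imaginary axis.\<close>

lemma half_plane_cauchy:
  assumes \<alpha>: "0 < \<alpha>" "\<alpha> < 1" and w: "0 < w" and R: "2 * w \<le> R"
  shows "\<bar>exp (- (w powr \<alpha>)) - 2 / pi * integral {0..R} (\<lambda>\<tau>. \<tau> * stable_jump \<alpha> \<tau> / (\<tau>\<^sup>2 + w\<^sup>2))\<bar>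
           \<le> 16 * exp (- (cos (pi * \<alpha> / 2) * R powr \<alpha>))"
proof -
  define c where "c = cos (pi * \<alpha> / 2)"
  have c: "0 < c" using cos_half_angle_pos[OF \<alpha>] by (simp add: c_def)
  define S where "S = {z::complex. 0 \<le> Re z}"
  define F where "F = (\<lambda>z::complex. exp (- (z powr \<alpha>)))"
  define f where "f = (\<lambda>z::complex. F z * (2 * z) / (z + w))"
  define h where "h = (\<lambda>z::complex. f z / (z - w))"
  have Rpos: "R > 0" using w R by simp
  have intS: "interior S = {z. 0 < Re z}"
    using interior_halfspace_ge[of "1::complex" 0] by (simp add: S_def inner_complex_def)
  have nzw: "z + complex_of_real w \<noteq> 0" if "z \<in> S" for z
    using that w by (auto simp: S_def complex_eq_iff)
  have contF: "continuous_on S F"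
    unfolding F_def by (intro continuous_intros) (use \<alpha> in \<open>auto simp: S_def\<close>)
  have contf: "continuous_on S f"
    unfolding f_def by (intro continuous_intros contF) (use nzw in auto)
  have difff: "f field_differentiable (at z)" if "z \<in> interior S - {}" for z
  proof -
    have "0 < Re z" using that intS by auto
    then have 1: "z \<notin> \<real>\<^sub>\<le>\<^sub>0" "z + complex_of_real w \<noteq> 0" using nzw[of z]
      by (auto simp: complex_nonpos_Reals_iff S_def)
    then have "f holomorphic_on {z. 0 < Re z}"
      unfolding f_def F_def
      by (intro holomorphic_intros) (use w in \<open>auto simp: complex_nonpos_Reals_iff complex_eq_iff\<close>)
    then show ?thesis using \<open>0 < Re z\<close> holomorphic_on_imp_differentiable_at[of f "{z. 0 < Re z}" z]
      by (simp add: open_halfspace_Re_gt)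
  qed
  define a1 a2 a3 a4 where "a1 = Complex 0 (-R)" and "a2 = Complex R (-R)" and "a3 = Complex R R" and "a4 = Complex 0 R"
  have rect: "rectpath a1 a3 = linepath a1 a2 +++ linepath a2 a3 +++ linepath a3 a4 +++ linepath a4 a1"
    by (simp add: rectpath_def Let_def a1_def a2_def a3_def a4_def)
  have wbox: "complex_of_real w \<in> box a1 a3"
    using w R by (auto simp: in_box_complex_iff a1_def a3_def)
  have img: "path_image (rectpath a1 a3) \<subseteq> S - {complex_of_real w}"
    using w R Rpos by (subst path_image_rectpath) (auto simp: a1_def a3_def S_def)
  have "(h has_contour_integral (2 * pi * \<i> * winding_number (rectpath a1 a3) w * f w)) (rectpath a1 a3)"
    unfolding h_def
    by (rule Cauchy_integral_formula_weak[of S "{}"])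
       (use contf difff img w intS in \<open>auto simp: S_def convex_halfspace_Re_ge\<close>)
  moreover have "f w = exp (- (w powr \<alpha>))"
    using w by (simp add: f_def F_def powr_of_real exp_of_real[symmetric])
  ultimately have CI: "(h has_contour_integral (2 * pi * \<i> * exp (- (w powr \<alpha>)))) (rectpath a1 a3)"
    using winding_number_rectpath[OF wbox] by simp
  have contint: "h contour_integrable_on (linepath p q)" if "path_image (linepath p q) \<subseteq> S - {complex_of_real w}" for p q
    unfolding h_def
    by (rule contour_integrable_continuous_linepath)
       (use that in \<open>auto intro!: continuous_intros continuous_on_subset[OF contf]\<close>)
  have sub: "path_image (linepath a1 a2) \<subseteq> path_image (rectpath a1 a3)"
     "path_image (linepath a2 a3) \<subseteq> path_image (rectpath a1 a3)"
     "path_image (linepath a3 a4) \<subseteq> path_image (rectpath a1 a3)"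
     "path_image (linepath a4 a1) \<subseteq> path_image (rectpath a1 a3)"
    unfolding rect by (auto simp: path_image_join)
  have i1: "h contour_integrable_on (linepath a1 a2)" and i2: "h contour_integrable_on (linepath a2 a3)"
    and i3: "h contour_integrable_on (linepath a3 a4)" and i4: "h contour_integrable_on (linepath a4 a1)"
    using sub img by (auto intro!: contint)
  have "contour_integral (rectpath a1 a3) h = contour_integral (linepath a1 a2) h + contour_integral (linepath a2 a3) h
      + contour_integral (linepath a3 a4) h + contour_integral (linepath a4 a1) h"
    unfolding rect using i1 i2 i3 i4 by (simp add: contour_integrable_joinI)
  then have sum4: "2 * pi * \<i> * exp (- (w powr \<alpha>)) = contour_integral (linepath a1 a2) h + contour_integral (linepath a2 a3) h
      + contour_integral (linepath a3 a4) h + contour_integral (linepath a4 a1) h"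
    using contour_integral_unique[OF CI] by simp
  \<comment> \<open>On the three outer edges \<open>|z + w| \<ge> |z|\<close> and, by \<open>R \<ge> 2 w\<close>, \<open>|z - w| \<ge> |z| / 2\<close>, so the kernel is
    at most \<open>4 / R\<close>; the edges have total length \<open>4 R\<close>.\<close>
  define B where "B = 4 / R * exp (- (c * R powr \<alpha>))"
  have B0: "0 \<le> B" using Rpos by (simp add: B_def)
  have hbound: "norm (h z) \<le> B" if z: "z \<in> S" "R \<le> norm z" for z
  proof -
    have nz: "norm z > 0" using z Rpos by linarith
    have "norm (F z) \<le> exp (- (c * norm z powr \<alpha>))"
      unfolding F_def c_def using norm_exp_minus_powr_le[OF \<alpha>] z(1) by (simp add: S_def)
    also have "\<dots> \<le> exp (- (c * R powr \<alpha>))"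
      using c z Rpos \<alpha> by (auto intro!: mult_left_mono powr_mono2)
    finally have 1: "norm (F z) \<le> exp (- (c * R powr \<alpha>))" .
    have "norm z / 2 \<le> norm (z - w)"
      using norm_triangle_ineq2[of z "complex_of_real w"] z R w by simp
    moreover have "norm z \<le> norm (z + w)"
      using z(1) w by (auto simp: cmod_def S_def intro!: real_sqrt_le_mono power_mono)
    ultimately have 2: "norm z * (norm z / 2) \<le> norm (z + w) * norm (z - w)"
      using nz by (intro mult_mono) auto
    have "norm (h z) = norm (F z) * (2 * norm z / (norm (z + w) * norm (z - w)))"
      by (simp add: h_def f_def norm_mult norm_divide)
    also have "\<dots> \<le> exp (- (c * R powr \<alpha>)) * (2 * norm z / (norm z * (norm z / 2)))"
    proof (rule mult_mono[OF 1 divide_left_mono[OF 2]])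
      have p: "0 < norm z * (norm z / 2)" using nz by simp
      have "0 < norm (z + w) * norm (z - w)" using p 2 by linarith
      then show "0 < norm (z + w) * norm (z - w) * (norm z * (norm z / 2))"
        using p by (rule mult_pos_pos)
    qed auto
    also have "\<dots> = exp (- (c * R powr \<alpha>)) * (4 / norm z)" using nz by simp
    also have "\<dots> \<le> exp (- (c * R powr \<alpha>)) * (4 / R)"
      using z Rpos nz by (intro mult_left_mono divide_left_mono mult_pos_pos) auto
    finally show ?thesis by (simp add: B_def mult.commute)
  qed
  have bd1: "norm (contour_integral (linepath a1 a2) h) \<le> B * norm (a2 - a1)"
  proof (rule contour_integral_bound_linepath[OF i1 B0], rule hbound)
    fix z assume "z \<in> closed_segment a1 a2"
    then have "Im z = -R \<and> 0 \<le> Re z" using Rpos 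
      by (auto simp: a1_def a2_def closed_segment_same_Im closed_segment_eq_real_ivl)
    then show "z \<in> S" "R \<le> norm z" using abs_Im_le_cmod[of z] by (auto simp: S_def)
  qed
  have bd2: "norm (contour_integral (linepath a2 a3) h) \<le> B * norm (a3 - a2)"
  proof (rule contour_integral_bound_linepath[OF i2 B0], rule hbound)
    fix z assume "z \<in> closed_segment a2 a3"
    then have "Re z = R" using Rpos 
      by (auto simp: a3_def a2_def closed_segment_same_Re closed_segment_eq_real_ivl)
    then show "z \<in> S" "R \<le> norm z" using abs_Re_le_cmod[of z] Rpos by (auto simp: S_def)
  qed
  have bd3: "norm (contour_integral (linepath a3 a4) h) \<le> B * norm (a4 - a3)"
  proof (rule contour_integral_bound_linepath[OF i3 B0], rule hbound)
    fix z assume "z \<in> closed_segment a3 a4"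
    then have "Im z = R \<and> 0 \<le> Re z" using Rpos 
      by (auto simp: a3_def a4_def closed_segment_same_Im closed_segment_eq_real_ivl)
    then show "z \<in> S" "R \<le> norm z" using abs_Im_le_cmod[of z] by (auto simp: S_def)
  qed
  have lens: "norm (a2 - a1) = R" "norm (a3 - a2) = 2 * R" "norm (a4 - a3) = R"
    using Rpos by (simp_all add: a1_def a2_def a3_def a4_def cmod_def real_sqrt_mult)
  have "norm (contour_integral (linepath a1 a2) h + contour_integral (linepath a2 a3) h
      + contour_integral (linepath a3 a4) h) \<le> B * R + B * (2 * R) + B * R"
    using bd1 bd2 bd3 unfolding lens by (intro norm_triangle_mono) auto
  also have "\<dots> = 16 * exp (- (c * R powr \<alpha>))" using Rpos by (simp add: B_def field_simps)
  finally have three: "norm (contour_integral (linepath a1 a2) h + contour_integral (linepath a2 a3) h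
      + contour_integral (linepath a3 a4) h) \<le> 16 * exp (- (c * R powr \<alpha>))" .
  define k where "k = (\<lambda>x. h (Complex 0 x))"
  have conthS: "continuous_on (S - {complex_of_real w}) h"
    unfolding h_def by (intro continuous_intros continuous_on_subset[OF contf]) auto
  have contk: "continuous_on {-R..R} k"
  proof -
    from conthS have "continuous_on ((\<lambda>x. Complex 0 x) ` {-R..R}) h"
      by (rule continuous_on_subset) (use w in \<open>auto simp: S_def complex_eq_iff\<close>)
    then show ?thesis unfolding k_def
      by (rule continuous_on_compose2) (auto intro!: continuous_intros)
  qed
  have "contour_integral (linepath a1 a4) h = \<i> * integral {-R..R} k"
    unfolding k_def by (rule contour_integral_linepath_same_Re) (use Rpos in \<open>auto simp: a1_def a4_def\<close>)
  moreover have conth: "continuous_on (closed_segment a4 a1) h"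
    using continuous_on_subset[OF conthS] sub(4) img by auto
  ultimately have left_edge: "contour_integral (linepath a4 a1) h = - (\<i> * integral {-R..R} k)"
    using contour_integral_reverse_linepath[OF conth] by simp
  have kk: "k x + k (- x) = of_real (- 4 * (x * stable_jump \<alpha> x / (x\<^sup>2 + w\<^sup>2)))" if "0 \<le> x" for x
  proof (cases "x = 0")
    case True
    have "Complex 0 0 = 0" by (simp add: complex_eq_iff)
    then show ?thesis by (simp add: k_def h_def f_def True)
  next
    case False
    then have x: "0 < x" using that by simp
    define u where "u = F (Complex 0 x)"
    have hf: "h z = F z * (2 * z) / (z * z - w * w)" for z
      by (simp add: h_def f_def algebra_simps)
    have sq: "Complex 0 x * Complex 0 x = - of_real (x\<^sup>2)" "Complex 0 (-x) * Complex 0 (-x) = - of_real (x\<^sup>2)"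
      by (simp_all add: complex_eq_iff power2_eq_square)
    have "u - cnj u = of_real (2 * Im u) * \<i>" by (rule complex_diff_cnj)
    moreover have "Im u = - stable_jump \<alpha> x" and "F (Complex 0 (-x)) = cnj u"
      unfolding u_def F_def using exp_minus_powr_imaginary[OF x] by blast+
    ultimately have u: "u - cnj u = of_real (- 2 * stable_jump \<alpha> x) * \<i>" and u': "F (Complex 0 (-x)) = cnj u" by auto
    have D: "x\<^sup>2 + w\<^sup>2 > 0" using x by (simp add: add_pos_nonneg)
    define E where "E = - complex_of_real (x\<^sup>2) - of_real w * of_real w"
    have E: "E = - of_real (x\<^sup>2 + w\<^sup>2)" by (simp add: E_def power2_eq_square)
    have m: "Complex 0 (- x) = - Complex 0 x" by (simp add: complex_eq_iff)
    have k1: "k x = u * (2 * Complex 0 x) / E"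
      unfolding k_def hf sq(1) u_def E_def by simp
    have k2: "k (- x) = cnj u * (2 * Complex 0 (- x)) / E"
      unfolding k_def hf sq(2) u' E_def by simp
    have "k x + k (- x) = (u - cnj u) * (2 * Complex 0 x) / E"
      unfolding k1 k2 m by (simp add: diff_divide_distrib left_diff_distrib)
    also have "\<dots> = of_real (4 * stable_jump \<alpha> x * x) / E"
      unfolding u by (simp add: Complex_eq)
    also have "\<dots> = of_real (4 * stable_jump \<alpha> x * x / - (x\<^sup>2 + w\<^sup>2))"
      unfolding E by simp
    also have "4 * stable_jump \<alpha> x * x / - (x\<^sup>2 + w\<^sup>2) = - 4 * (x * stable_jump \<alpha> x / (x\<^sup>2 + w\<^sup>2))"
      by (simp only: divide_minus_right) (simp add: mult_ac)
    finally show ?thesis .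
  qed
  define J where "J = integral {0..R} (\<lambda>\<tau>. \<tau> * stable_jump \<alpha> \<tau> / (\<tau>\<^sup>2 + w\<^sup>2))"
  have contk': "continuous_on {0..R} k" "continuous_on {-R..0} k" "continuous_on {0..R} (\<lambda>x. k (-x))"
    by (auto intro!: continuous_on_subset[OF contk] continuous_on_compose2[OF contk] continuous_intros)
  have "integral {-R..R} k = integral {-R..0} k + integral {0..R} k"
    using Rpos contk by (intro Henstock_Kurzweil_Integration.integral_combine[symmetric] integrable_continuous_interval) auto
  also have "integral {-R..0} k = integral {0..R} (\<lambda>x. k (- x))"
    using Henstock_Kurzweil_Integration.integral_reflect_real[of R 0 "\<lambda>x. k (-x)"] by simp
  also have "\<dots> + integral {0..R} k = integral {0..R} (\<lambda>x. k (-x) + k x)"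
    by (intro Henstock_Kurzweil_Integration.integral_add[symmetric] integrable_continuous_interval contk')
  also have "\<dots> = integral {0..R} (\<lambda>x. of_real (- 4 * (x * stable_jump \<alpha> x / (x\<^sup>2 + w\<^sup>2))))"
    by (intro integral_cong) (use kk in \<open>simp add: add.commute\<close>)
  also have "\<dots> = of_real (integral {0..R} (\<lambda>x. - 4 * (x * stable_jump \<alpha> x / (x\<^sup>2 + w\<^sup>2))))"
  proof -
    let ?g = "\<lambda>x. - 4 * (x * stable_jump \<alpha> x / (x\<^sup>2 + w\<^sup>2))"
    have "(\<lambda>x. k (-x) + k x) integrable_on {0..R}"
      by (intro integrable_continuous_interval continuous_intros contk')
    then have "(\<lambda>x. complex_of_real (?g x)) integrable_on {0..R}"
      by (rule integrable_eq) (use kk in \<open>simp add: add.commute\<close>)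
    from integrable_linear[OF this bounded_linear_Re] have "?g integrable_on {0..R}"
      by (simp add: o_def)
    from integral_linear[OF this bounded_linear_of_real[where ?'a = complex]] show ?thesis
      by (simp only: o_def)
  qed
  also have "\<dots> = of_real (- 4 * J)" unfolding J_def by (subst integral_mult_right) simp
  finally have kJ: "integral {-R..R} k = of_real (- 4 * J)" .
  have "2 * pi * \<i> * (of_real (exp (- (w powr \<alpha>)) - 2 / pi * J)) = contour_integral (linepath a1 a2) h + contour_integral (linepath a2 a3) h
      + contour_integral (linepath a3 a4) h"
    using sum4 unfolding left_edge kJ by (simp add: algebra_simps)
  then have "norm (2 * pi * \<i> * (of_real (exp (- (w powr \<alpha>)) - 2 / pi * J))) \<le> 16 * exp (- (c * R powr \<alpha>))"
    using three by simp
  then have "2 * pi * \<bar>exp (- (w powr \<alpha>)) - 2 / pi * J\<bar> \<le> 16 * exp (- (c * R powr \<alpha>))"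
    by (simp add: norm_mult del: of_real_diff of_real_mult of_real_divide)
  moreover have "1 * \<bar>exp (- (w powr \<alpha>)) - 2 / pi * J\<bar> \<le> 2 * pi * \<bar>exp (- (w powr \<alpha>)) - 2 / pi * J\<bar>"
    using pi_gt3 by (intro mult_right_mono) auto
  ultimately show ?thesis by (simp add: J_def c_def)
qed

section \<open>Integrals over the half-line\<close>
text \<open>Lebesgue measure on the positive half-line, kept as a measure on all Borel sets of the line, so
  that products of half-lines and Fubini's theorem need no restriction to subsets.\<close>

definition halfline :: "real measure" where
  "halfline = density lborel (indicator {0<..})"

lemma sets_halfline [simp, measurable_cong]: "sets halfline = sets borel"
  by (simp add: halfline_def)

lemma space_halfline [simp]: "space halfline = UNIV"
  by (simp add: halfline_def)

lemma AE_halfline: "AE x in halfline. 0 < x"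
  unfolding halfline_def by (subst AE_density) (auto split: split_indicator)

lemma nn_integral_halfline:
  "f \<in> borel_measurable borel \<Longrightarrow> (\<integral>\<^sup>+x. f x \<partial>halfline) = (\<integral>\<^sup>+x. f x * indicator {0<..} x \<partial>lborel)"
  by (simp add: halfline_def nn_integral_density mult.commute)

lemma integral_halfline:
  fixes f :: "real \<Rightarrow> 'a::{banach, second_countable_topology}"
  assumes "f \<in> borel_measurable borel"
  shows "(\<integral>x. f x \<partial>halfline) = (\<integral>x. indicator {0<..} x *\<^sub>R f x \<partial>lborel)"
proof -
  have *: "halfline = density lborel (\<lambda>x. ennreal (indicator {0<..} x))"
    by (simp add: halfline_def ennreal_indicator)
  show ?thesis unfolding * using assms by (subst integral_density) auto
qed

lemma integrable_halfline_iff: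
  fixes f :: "real \<Rightarrow> 'a::{banach, second_countable_topology}"
  assumes "f \<in> borel_measurable borel"
  shows "integrable halfline f \<longleftrightarrow> integrable lborel (\<lambda>x. indicator {0<..} x *\<^sub>R f x)"
proof -
  have *: "halfline = density lborel (\<lambda>x. ennreal (indicator {0<..} x))"
    by (simp add: halfline_def ennreal_indicator)
  show ?thesis unfolding * using assms by (subst integrable_density) auto
qed

lemma nn_integral_halfline_cong:
  "(\<And>x. 0 < x \<Longrightarrow> f x = g x) \<Longrightarrow> (\<integral>\<^sup>+x. f x \<partial>halfline) = (\<integral>\<^sup>+x. g x \<partial>halfline)"
  by (rule nn_integral_cong_AE) (use AE_halfline in \<open>auto elim: eventually_mono\<close>)

lemma nn_integral_halfline_mono:
  "(\<And>x. 0 < x \<Longrightarrow> f x \<le> g x) \<Longrightarrow> (\<integral>\<^sup>+x. f x \<partial>halfline) \<le> (\<integral>\<^sup>+x. g x \<partial>halfline)"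
  by (rule nn_integral_mono_AE) (use AE_halfline in \<open>auto elim: eventually_mono\<close>)

interpretation halfline: sigma_finite_measure halfline
  unfolding halfline_def by (subst sigma_finite_measure.sigma_finite_iff_density_finite[OF sigma_finite_lborel]) (auto split: split_indicator)

interpretation halfline_pair: pair_sigma_finite halfline halfline ..

lemma AE_halfline_pair: "AE p in halfline \<Otimes>\<^sub>M halfline. 0 < fst p \<and> 0 < snd p"
proof (rule halfline_pair.AE_pair_measure)
  have "Measurable.pred (halfline \<Otimes>\<^sub>M halfline) (\<lambda>p. 0 < fst p \<and> 0 < snd p)"
    by measurable
  then show "{p \<in> space (halfline \<Otimes>\<^sub>M halfline). 0 < fst p \<and> 0 < snd p} \<in> sets (halfline \<Otimes>\<^sub>M halfline)"
    by (simp add: pred_def)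
  show "AE x in halfline. AE y in halfline. 0 < fst (x, y) \<and> 0 < snd (x, y)"
    using AE_halfline by (auto elim!: eventually_mono)
qed

text \<open>All explicit half-line integrals of this theory are Gamma integrals in disguise. Stating the
  change of variables once, for a nonnegative integrand of the substituted form, yields value and
  integrability together.\<close>

lemma nn_integral_Gamma_substitution:
  fixes g g' :: "real \<Rightarrow> real"
  assumes a: "0 < a"
    and der: "\<And>x. 0 < x \<Longrightarrow> (g has_field_derivative g' x) (at x)"
    and bij: "bij_betw g {0<..} {0<..}"
    and [measurable]: "g \<in> borel_measurable borel" "g' \<in> borel_measurable borel"
    and C: "0 \<le> C" and h: "\<And>x. 0 < x \<Longrightarrow> h x = C * (\<bar>g' x\<bar> * (g x powr (a - 1) / exp (g x)))"
  shows "(\<integral>\<^sup>+x. ennreal (h x) \<partial>halfline) = ennreal (C * Gamma a)"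
proof -
  define f where "f = (\<lambda>t::real. t powr (a - 1) / exp t)"
  have "(f has_integral Gamma a) {0<..}"
  proof -
    have "((\<lambda>t. if t \<in> {0<..} then f t else 0) has_integral Gamma a) {0..}"
      by (rule has_integral_spike[OF _ _ Gamma_integral_real[OF a], of "{0}"]) (auto simp: f_def)
    then show ?thesis by (subst (asm) has_integral_restrict) auto
  qed
  then have "f absolutely_integrable_on (g ` {0<..}) \<and> integral (g ` {0<..}) f = Gamma a"
    using bij by (auto simp: bij_betw_def f_def has_integral_iff intro!: nonnegative_absolutely_integrable_1)
  then have "(\<lambda>x. \<bar>g' x\<bar> * f (g x)) absolutely_integrable_on {0<..} \<and>
     integral {0<..} (\<lambda>x. \<bar>g' x\<bar> * f (g x)) = Gamma a"
    by (subst has_absolute_integral_change_of_variables_1')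
       (use bij der in \<open>auto simp: bij_betw_def intro: has_field_derivative_at_within\<close>)
  then have "((\<lambda>x. \<bar>g' x\<bar> * f (g x)) has_integral Gamma a) {0<..}"
    by (auto simp: has_integral_iff absolutely_integrable_on_def)
  from nn_integral_has_integral_lebesgue'[OF _ this]
  have *: "(\<integral>\<^sup>+x. ennreal (\<bar>g' x\<bar> * f (g x)) \<partial>halfline) = ennreal (Gamma a)"
    by (subst nn_integral_halfline) (auto simp: f_def)
  have "(\<integral>\<^sup>+x. ennreal (h x) \<partial>halfline) = (\<integral>\<^sup>+x. ennreal C * ennreal (\<bar>g' x\<bar> * f (g x)) \<partial>halfline)"
    using h C by (intro nn_integral_halfline_cong) (simp add: f_def ennreal_mult'[symmetric])
  also have "\<dots> = ennreal C * (\<integral>\<^sup>+x. ennreal (\<bar>g' x\<bar> * f (g x)) \<partial>halfline)"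
    by (rule nn_integral_cmult) (simp add: f_def)
  finally show ?thesis using * C by (simp add: ennreal_mult'[symmetric])
qed

lemma nn_integral_exp_halfline:
  assumes "0 < b"
  shows "(\<integral>\<^sup>+s. ennreal (exp (- (s * b))) \<partial>halfline) = ennreal (1 / b)"
proof -
  have "bij_betw (\<lambda>x. b * x) {0<..} {0<..}"
    by (rule bij_betwI[of _ _ _ "\<lambda>x. x / b"]) (use assms in auto)
  then have "(\<integral>\<^sup>+s. ennreal (exp (- (s * b))) \<partial>halfline) = ennreal (1 / b * Gamma 1)"
    by (rule nn_integral_Gamma_substitution[where g' = "\<lambda>_. b", rotated 2])
       (use assms in \<open>auto intro!: derivative_eq_intros simp: exp_minus field_simps\<close>)
  then show ?thesis by simp
qed

lemma nn_integral_gaussian_moment: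
  assumes a: "0 < a" and b: "0 < b"
  shows "(\<integral>\<^sup>+\<tau>. ennreal (\<tau> powr (2 * a - 1) * exp (- (b * \<tau>\<^sup>2))) \<partial>halfline) = ennreal (b powr (- a) / 2 * Gamma a)"
proof (rule nn_integral_Gamma_substitution[where g = "\<lambda>x. b * x\<^sup>2" and g' = "\<lambda>x. b * (2 * x)"])
  show "bij_betw (\<lambda>x. b * x\<^sup>2) {0<..} {0<..}"
    by (rule bij_betwI[of _ _ _ "\<lambda>x. sqrt (x / b)"]) (use b in \<open>auto simp: real_sqrt_unique\<close>)
  fix x :: real assume x: "0 < x"
  have "x powr (2 * a - 1) = x powr (2 * (a - 1)) * x" 
    using x by (simp add: powr_diff powr_numeral field_simps power2_eq_square)
  moreover have "(b * x\<^sup>2) powr (a - 1) = b powr (a - 1) * x powr (2 * (a - 1))"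
    using x b powr_powr[of x 2 "a - 1"] by (simp add: powr_mult powr_numeral)
  moreover have "b powr (a - 1) * b = b powr a" using b by (simp add: powr_diff)
  then have "b powr (- a) * (b * b powr (a - 1)) = 1" using b by (simp add: powr_minus field_simps)
  ultimately show "x powr (2 * a - 1) * exp (- (b * x\<^sup>2)) =
      b powr (- a) / 2 * (\<bar>b * (2 * x)\<bar> * ((b * x\<^sup>2) powr (a - 1) / exp (b * x\<^sup>2)))"
    using x b by (simp add: exp_minus field_simps abs_mult) 
qed (use assms in \<open>auto intro!: derivative_eq_intros\<close>)

lemma nn_integral_inverse_Gamma:
  assumes a: "0 < a" and b: "0 < b"
  shows "(\<integral>\<^sup>+s. ennreal (s powr (- a - 1) * exp (- (b / s))) \<partial>halfline) = ennreal (b powr (- a) * Gamma a)"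
proof (rule nn_integral_Gamma_substitution[where g = "\<lambda>x. b / x" and g' = "\<lambda>x. - b / x\<^sup>2"])
  show "bij_betw (\<lambda>x. b / x) {0<..} {0<..}"
    by (rule bij_betwI[of _ _ _ "\<lambda>x. b / x"]) (use b in auto)
  fix x :: real assume x: "0 < x"
  have "x powr (- a - 1) = x powr (1 - a) / x\<^sup>2" 
    using x by (simp add: powr_diff powr_minus field_simps power2_eq_square)
  moreover have "(b / x) powr (a - 1) = b powr (a - 1) * x powr (1 - a)"
    using x b by (simp add: powr_divide) (simp add: powr_diff field_simps)
  moreover have "b powr (a - 1) * b = b powr a" using b by (simp add: powr_diff)
  then have "b powr (- a) * (b * b powr (a - 1)) = 1" using b by (simp add: powr_minus field_simps)
  ultimately show "x powr (- a - 1) * exp (- (b / x)) =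
      b powr (- a) * (\<bar>- b / x\<^sup>2\<bar> * ((b / x) powr (a - 1) / exp (b / x)))"
    using x b by (simp add: exp_minus field_simps) 
qed (use assms in \<open>auto intro!: derivative_eq_intros simp: power2_eq_square\<close>)

lemma nn_integral_stretched_exp:
  assumes \<alpha>: "0 < \<alpha>" and c: "0 < c"
  shows "(\<integral>\<^sup>+\<tau>. ennreal (\<tau> powr (\<alpha> - 1) * exp (- (c * \<tau> powr \<alpha>))) \<partial>halfline) = ennreal (1 / (c * \<alpha>))"
proof -
  have "(\<integral>\<^sup>+\<tau>. ennreal (\<tau> powr (\<alpha> - 1) * exp (- (c * \<tau> powr \<alpha>))) \<partial>halfline) = ennreal (1 / (c * \<alpha>) * Gamma 1)"
  proof (rule nn_integral_Gamma_substitution[where g = "\<lambda>x. c * x powr \<alpha>" and g' = "\<lambda>x. c * (\<alpha> * x powr (\<alpha> - 1))"])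
    show "bij_betw (\<lambda>x. c * x powr \<alpha>) {0<..} {0<..}"
      by (rule bij_betwI[of _ _ _ "\<lambda>x. (x / c) powr (1 / \<alpha>)"]) (use assms in \<open>auto simp: powr_powr\<close>)
  qed (use assms in \<open>auto intro!: derivative_eq_intros simp: exp_minus field_simps\<close>)
  then show ?thesis by simp
qed

section \<open>The stretched exponential as a signed mixture of Gaussians\<close>

lemma measurable_stable_jump [measurable]: "stable_jump \<alpha> \<in> borel_measurable borel"
  unfolding stable_jump_def[abs_def] by measurable

lemma integrable_stable_jump_div:
  assumes \<alpha>: "0 < \<alpha>" "\<alpha> < 1"
  shows "integrable halfline (\<lambda>\<tau>. stable_jump \<alpha> \<tau> / \<tau>)"
proof (rule integrableI_bounded)
  let ?c = "cos (pi * \<alpha> / 2)"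
  have "(\<integral>\<^sup>+\<tau>. ennreal (norm (stable_jump \<alpha> \<tau> / \<tau>)) \<partial>halfline)
      \<le> (\<integral>\<^sup>+\<tau>. ennreal (\<tau> powr (\<alpha> - 1) * exp (- (?c * \<tau> powr \<alpha>))) \<partial>halfline)"
  proof (rule nn_integral_halfline_mono, rule ennreal_leI)
    fix \<tau> :: real assume "0 < \<tau>"
    then show "norm (stable_jump \<alpha> \<tau> / \<tau>) \<le> \<tau> powr (\<alpha> - 1) * exp (- (?c * \<tau> powr \<alpha>))"
      using stable_jump_bound[OF \<alpha>, of \<tau>] by (simp add: powr_diff divide_right_mono)
  qed
  also have "\<dots> < \<infinity>"
    using nn_integral_stretched_exp[OF \<alpha>(1) cos_half_angle_pos[OF \<alpha>]] by simp
  finally show "(\<integral>\<^sup>+\<tau>. ennreal (norm (stable_jump \<alpha> \<tau> / \<tau>)) \<partial>halfline) < \<infinity>" .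
qed simp

text \<open>The limit \<open>R \<rightarrow> \<infinity>\<close> in \<open>half_plane_cauchy\<close>. The integrand is dominated by
  \<open>stable_jump \<alpha> \<tau> / \<tau>\<close>, uniformly in \<open>w\<close>.\<close>

lemma stieltjes_stretched_exp:
  assumes \<alpha>: "0 < \<alpha>" "\<alpha> < 1" and w: "0 < w"
  shows "integrable halfline (\<lambda>\<tau>. \<tau> * stable_jump \<alpha> \<tau> / (\<tau>\<^sup>2 + w\<^sup>2))" (is "integrable _ ?f")
    and "(\<integral>\<tau>. \<tau> * stable_jump \<alpha> \<tau> / (\<tau>\<^sup>2 + w\<^sup>2) \<partial>halfline) = pi / 2 * exp (- (w powr \<alpha>))"
proof -
  define c where "c = cos (pi * \<alpha> / 2)"
  have c: "0 < c" using cos_half_angle_pos[OF \<alpha>] by (simp add: c_def)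
  show int: "integrable halfline ?f"
  proof (rule Bochner_Integration.integrable_bound[OF integrable_stable_jump_div[OF \<alpha>]])
    show "AE \<tau> in halfline. norm (?f \<tau>) \<le> norm (stable_jump \<alpha> \<tau> / \<tau>)"
      using AE_halfline
    proof eventually_elim
      case (elim \<tau>)
      then have "\<tau> / (\<tau>\<^sup>2 + w\<^sup>2) \<le> \<tau> / \<tau>\<^sup>2"
        by (intro divide_left_mono) (auto intro!: add_pos_nonneg mult_pos_pos)
      then have "\<bar>stable_jump \<alpha> \<tau>\<bar> * (\<tau> / (\<tau>\<^sup>2 + w\<^sup>2)) \<le> \<bar>stable_jump \<alpha> \<tau>\<bar> * (\<tau> / \<tau>\<^sup>2)"
        by (rule mult_left_mono) simp
      then show ?case using elim by (simp add: abs_mult power2_eq_square mult.commute)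
    qed
  qed simp
  have intl: "integrable lborel (\<lambda>\<tau>. indicator {0<..} \<tau> *\<^sub>R ?f \<tau>)"
    using int by (subst (asm) integrable_halfline_iff) auto
  let ?J = "\<lambda>n::nat. integral {0..real n} ?f"
  have J: "?J n = (\<integral>\<tau>. indicator {0..real n} \<tau> *\<^sub>R (indicator {0<..} \<tau> *\<^sub>R ?f \<tau>) \<partial>lborel)" for n
  proof -
    have "set_integrable lborel {0..real n} (\<lambda>\<tau>. indicator {0<..} \<tau> *\<^sub>R ?f \<tau>)"
      unfolding set_integrable_def by (rule integrable_mult_indicator[OF _ intl]) simp
    from set_borel_integral_eq_integral(2)[OF this]
    have "(\<integral>\<tau>. indicator {0..real n} \<tau> *\<^sub>R (indicator {0<..} \<tau> *\<^sub>R ?f \<tau>) \<partial>lborel)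
       = integral {0..real n} (\<lambda>\<tau>. indicator {0<..} \<tau> *\<^sub>R ?f \<tau>)"
      by (simp add: set_lebesgue_integral_def)
    also have "\<dots> = ?J n"
      by (intro integral_cong) (auto simp: indicator_def)
    finally show ?thesis ..
  qed
  have "?J \<longlonglongrightarrow> (\<integral>\<tau>. indicator {0<..} \<tau> *\<^sub>R ?f \<tau> \<partial>lborel)"
    unfolding J
  proof (rule integral_dominated_convergence[where w = "\<lambda>\<tau>. norm (indicator {0<..} \<tau> *\<^sub>R ?f \<tau>)"])
    show "AE \<tau> in lborel. (\<lambda>n. indicator {0..real n} \<tau> *\<^sub>R (indicator {0<..} \<tau> *\<^sub>R ?f \<tau>)) \<longlonglongrightarrow> indicator {0<..} \<tau> *\<^sub>R ?f \<tau>"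
    proof (rule AE_I2, rule tendsto_eventually)
      fix \<tau> :: real
      obtain m :: nat where "\<tau> \<le> real m" using real_arch_simple by blast
      then have "\<forall>n\<ge>m. \<tau> \<le> real n" by (meson of_nat_mono order_trans)
      then show "\<forall>\<^sub>F n in sequentially. indicator {0..real n} \<tau> *\<^sub>R (indicator {0<..} \<tau> *\<^sub>R ?f \<tau>) = indicator {0<..} \<tau> *\<^sub>R ?f \<tau>"
        by (auto simp: eventually_sequentially indicator_def intro!: exI[of _ m])
    qed
  qed (use intl integrable_norm[OF intl] in \<open>auto simp: indicator_def\<close>)
  then have l1: "?J \<longlonglongrightarrow> (\<integral>\<tau>. ?f \<tau> \<partial>halfline)"
    by (subst integral_halfline) auto
  have "(\<lambda>n. 16 * exp (- (c * real n powr \<alpha>))) \<longlonglongrightarrow> 0"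
    using c \<alpha> by real_asymp
  then have "(\<lambda>n. \<bar>exp (- (w powr \<alpha>)) - 2 / pi * ?J n\<bar>) \<longlonglongrightarrow> 0"
  proof (rule Lim_null_comparison[rotated])
    obtain m :: nat where m: "2 * w \<le> real m" using real_arch_simple by blast
    have "norm \<bar>exp (- (w powr \<alpha>)) - 2 / pi * ?J n\<bar> \<le> 16 * exp (- (c * real n powr \<alpha>))" if "n \<ge> m" for n
      using half_plane_cauchy[OF \<alpha> w, of "real n"] m that by (simp add: c_def)
    then show "\<forall>\<^sub>F n in sequentially. norm \<bar>exp (- (w powr \<alpha>)) - 2 / pi * ?J n\<bar> \<le> 16 * exp (- (c * real n powr \<alpha>))"
      by (auto simp: eventually_sequentially)
  qed
  then have "(\<lambda>n. exp (- (w powr \<alpha>)) - 2 / pi * ?J n) \<longlonglongrightarrow> 0"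
    by (simp add: tendsto_rabs_zero_iff)
  moreover have "(\<lambda>n. exp (- (w powr \<alpha>)) - 2 / pi * ?J n) \<longlonglongrightarrow> exp (- (w powr \<alpha>)) - 2 / pi * (\<integral>\<tau>. ?f \<tau> \<partial>halfline)"
    by (intro tendsto_intros l1)
  ultimately have "exp (- (w powr \<alpha>)) - 2 / pi * (\<integral>\<tau>. ?f \<tau> \<partial>halfline) = 0"
    using LIMSEQ_unique by blast
  then show "(\<integral>\<tau>. ?f \<tau> \<partial>halfline) = pi / 2 * exp (- (w powr \<alpha>))"
    by (simp add: field_simps)
qed

text \<open>Writing \<open>1 / (\<tau>\<^sup>2 + w\<^sup>2)\<close> as the integral of \<open>exp (- s (\<tau>\<^sup>2 + w\<^sup>2))\<close> over \<open>s\<close> in the Stieltjes formula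
  gives \<open>exp (- w powr \<alpha>)\<close> as a mixture of \<open>exp (- s w\<^sup>2)\<close> over pairs \<open>(s, \<tau>)\<close>. Integrating out
  \<open>\<tau>\<close> would leave the density of the \<open>\<alpha>/2\<close>-stable subordinator; the signed weight on pairs is kept
  instead, since it is the variable \<open>\<tau>\<close> in which it expands into a power series.\<close>

definition mix_weight :: "real \<Rightarrow> real \<times> real \<Rightarrow> real" where
  "mix_weight \<alpha> = (\<lambda>(s, \<tau>). 2 / pi * (\<tau> * stable_jump \<alpha> \<tau> * exp (- (s * \<tau>\<^sup>2))))"

lemma measurable_mix_weight [measurable]: "mix_weight \<alpha> \<in> borel_measurable (borel \<Otimes>\<^sub>M borel)"
  unfolding mix_weight_def by measurable

lemma integrable_mix_weight:
  assumes \<alpha>: "0 < \<alpha>" "\<alpha> < 1"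
  shows "integrable (halfline \<Otimes>\<^sub>M halfline) (mix_weight \<alpha>)"
proof (rule integrableI_bounded)
  have "(\<integral>\<^sup>+p. ennreal (norm (mix_weight \<alpha> p)) \<partial>(halfline \<Otimes>\<^sub>M halfline))
     = (\<integral>\<^sup>+\<tau>. \<integral>\<^sup>+s. ennreal (norm (mix_weight \<alpha> (s, \<tau>))) \<partial>halfline \<partial>halfline)"
    by (rule halfline_pair.nn_integral_snd[symmetric]) simp
  also have "\<dots> = (\<integral>\<^sup>+\<tau>. ennreal (2 / pi) * ennreal (norm (stable_jump \<alpha> \<tau> / \<tau>)) \<partial>halfline)"
  proof (rule nn_integral_halfline_cong)
    fix \<tau> :: real assume \<tau>: "0 < \<tau>"
    have "(\<integral>\<^sup>+s. ennreal (norm (mix_weight \<alpha> (s, \<tau>))) \<partial>halfline)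
       = (\<integral>\<^sup>+s. ennreal (2 / pi * (\<tau> * \<bar>stable_jump \<alpha> \<tau>\<bar>)) * ennreal (exp (- (s * \<tau>\<^sup>2))) \<partial>halfline)"
      using \<tau> by (intro nn_integral_cong) (simp add: mix_weight_def abs_mult ennreal_mult'[symmetric] mult_ac)
    also have "\<dots> = ennreal (2 / pi * (\<tau> * \<bar>stable_jump \<alpha> \<tau>\<bar>)) * ennreal (1 / \<tau>\<^sup>2)"
      using \<tau> by (subst nn_integral_cmult) (auto simp: nn_integral_exp_halfline)
    also have "\<dots> = ennreal (2 / pi) * ennreal (norm (stable_jump \<alpha> \<tau> / \<tau>))"
      using \<tau> by (simp add: ennreal_mult'[symmetric] power2_eq_square)
    finally show "(\<integral>\<^sup>+s. ennreal (norm (mix_weight \<alpha> (s, \<tau>))) \<partial>halfline) = \<dots>" .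
  qed
  also have "\<dots> < \<infinity>"
    using integrable_stable_jump_div[OF \<alpha>]
    by (subst nn_integral_cmult) (auto simp: integrable_iff_bounded ennreal_mult_less_top)
  finally show "(\<integral>\<^sup>+p. ennreal (norm (mix_weight \<alpha> p)) \<partial>(halfline \<Otimes>\<^sub>M halfline)) < \<infinity>" .
qed simp

lemma mix_weight_laplace:
  assumes \<alpha>: "0 < \<alpha>" "\<alpha> < 1" and w: "0 < w"
  shows "(\<integral>p. mix_weight \<alpha> p * exp (- (fst p * w\<^sup>2)) \<partial>(halfline \<Otimes>\<^sub>M halfline)) = exp (- (w powr \<alpha>))"
proof -
  have int: "integrable (halfline \<Otimes>\<^sub>M halfline) (\<lambda>p. mix_weight \<alpha> p * exp (- (fst p * w\<^sup>2)))"
  proof (rule Bochner_Integration.integrable_bound[OF integrable_mix_weight[OF \<alpha>]])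
    show "AE p in halfline \<Otimes>\<^sub>M halfline. norm (mix_weight \<alpha> p * exp (- (fst p * w\<^sup>2))) \<le> norm (mix_weight \<alpha> p)"
      using AE_halfline_pair by eventually_elim (auto simp: abs_mult mult_left_le)
  qed simp
  have "(\<integral>p. mix_weight \<alpha> p * exp (- (fst p * w\<^sup>2)) \<partial>(halfline \<Otimes>\<^sub>M halfline))
     = (\<integral>\<tau>. \<integral>s. mix_weight \<alpha> (s, \<tau>) * exp (- (s * w\<^sup>2)) \<partial>halfline \<partial>halfline)"
    using halfline_pair.integral_snd[of "\<lambda>s \<tau>. mix_weight \<alpha> (s, \<tau>) * exp (- (s * w\<^sup>2))"] int
    by (simp add: case_prod_beta')
  also have "\<dots> = (\<integral>\<tau>. 2 / pi * (\<tau> * stable_jump \<alpha> \<tau> / (\<tau>\<^sup>2 + w\<^sup>2)) \<partial>halfline)"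
  proof (rule integral_cong_AE)
    show "AE \<tau> in halfline. (\<integral>s. mix_weight \<alpha> (s, \<tau>) * exp (- (s * w\<^sup>2)) \<partial>halfline) = 2 / pi * (\<tau> * stable_jump \<alpha> \<tau> / (\<tau>\<^sup>2 + w\<^sup>2))"
      using AE_halfline
    proof eventually_elim
      case (elim \<tau>)
      have pos: "0 < \<tau>\<^sup>2 + w\<^sup>2" using elim by (simp add: add_pos_nonneg)
      have "(\<integral>s. exp (- (s * (\<tau>\<^sup>2 + w\<^sup>2))) \<partial>halfline) = 1 / (\<tau>\<^sup>2 + w\<^sup>2)"
        by (subst integral_eq_nn_integral) (use pos nn_integral_exp_halfline[OF pos] in auto)
      moreover have "mix_weight \<alpha> (s, \<tau>) * exp (- (s * w\<^sup>2)) = 2 / pi * (\<tau> * stable_jump \<alpha> \<tau>) * exp (- (s * (\<tau>\<^sup>2 + w\<^sup>2)))" for s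
        by (simp add: mix_weight_def algebra_simps exp_add[symmetric] exp_diff)
      ultimately show ?case by simp
    qed
  qed measurable
  also have "\<dots> = exp (- (w powr \<alpha>))"
    by (subst integral_mult_right_zero, subst stieltjes_stretched_exp(2)[OF \<alpha> w]) simp
  finally show ?thesis .
qed

text \<open>The Gauss-Weierstrass kernel at time \<open>s\<close> and distance \<open>r\<close> from the origin.\<close>

definition heat_profile :: "nat \<Rightarrow> real \<Rightarrow> real \<Rightarrow> real" where
  "heat_profile d s r = (4 * pi * s) powr (- real d / 2) * exp (- (r\<^sup>2 / (4 * s)))"

lemma measurable_heat_profile [measurable (raw)]:
  assumes [measurable]: "f \<in> borel_measurable M" "g \<in> borel_measurable M"
  shows "(\<lambda>x. heat_profile d (f x) (g x)) \<in> borel_measurable M"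
  unfolding heat_profile_def by measurable

lemma heat_profile_nonneg [simp]: "0 \<le> heat_profile d s r"
  by (simp add: heat_profile_def)

text \<open>The integral over \<open>\<tau>\<close> is a Gaussian moment and the remaining one over \<open>s\<close> an inverse Gamma integral.
  For \<open>\<beta> = n \<alpha>\<close> they produce the two Gamma factors of the coefficient \<open>a\<^sub>n\<close>.\<close>

lemma nn_integral_mixed_moment:
  assumes d: "0 < d" and r: "0 < r" and \<beta>: "0 \<le> \<beta>"
  shows "(\<integral>\<^sup>+p. ennreal (snd p powr (\<beta> + 1) * exp (- (fst p * (snd p)\<^sup>2)) * heat_profile d (fst p) r) \<partial>(halfline \<Otimes>\<^sub>M halfline))
    = ennreal (Gamma (\<beta> / 2 + 1) * Gamma ((\<beta> + real d) / 2) * 2 powr \<beta> / (2 * pi powr (real d / 2)) * r powr (- real d - \<beta>))"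
proof -
  let ?K = "Gamma (\<beta> / 2 + 1) / 2 * (4 * pi) powr (- real d / 2)"
  have "(\<integral>\<^sup>+p. ennreal (snd p powr (\<beta> + 1) * exp (- (fst p * (snd p)\<^sup>2)) * heat_profile d (fst p) r) \<partial>(halfline \<Otimes>\<^sub>M halfline))
     = (\<integral>\<^sup>+s. \<integral>\<^sup>+\<tau>. ennreal (\<tau> powr (\<beta> + 1) * exp (- (s * \<tau>\<^sup>2)) * heat_profile d s r) \<partial>halfline \<partial>halfline)"
    by (subst halfline.nn_integral_fst[symmetric]) auto
  also have "\<dots> = (\<integral>\<^sup>+s. ennreal (?K) * ennreal (s powr (- ((\<beta> + real d) / 2) - 1) * exp (- (r\<^sup>2 / 4 / s))) \<partial>halfline)"
  proof (rule nn_integral_halfline_cong)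
    fix s :: real assume s: "0 < s"
    have "(\<integral>\<^sup>+\<tau>. ennreal (\<tau> powr (\<beta> + 1) * exp (- (s * \<tau>\<^sup>2)) * heat_profile d s r) \<partial>halfline)
      = (\<integral>\<^sup>+\<tau>. ennreal (heat_profile d s r) * ennreal (\<tau> powr (2 * (\<beta> / 2 + 1) - 1) * exp (- (s * \<tau>\<^sup>2))) \<partial>halfline)"
      by (intro nn_integral_cong) (simp add: ennreal_mult'[symmetric] mult_ac add.commute)
    also have "\<dots> = ennreal (heat_profile d s r) * ennreal (s powr (- (\<beta> / 2 + 1)) / 2 * Gamma (\<beta> / 2 + 1))"
      using s \<beta> by (subst nn_integral_cmult, measurable) (subst nn_integral_gaussian_moment, auto)
    also have "\<dots> = ennreal (heat_profile d s r * (s powr (- (\<beta> / 2 + 1)) / 2 * Gamma (\<beta> / 2 + 1)))"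
      by (rule ennreal_mult'[symmetric]) simp
    also have "heat_profile d s r * (s powr (- (\<beta> / 2 + 1)) / 2 * Gamma (\<beta> / 2 + 1))
      = ?K * (s powr (- ((\<beta> + real d) / 2) - 1) * exp (- (r\<^sup>2 / 4 / s)))"
    proof -
      have "heat_profile d s r = (4 * pi) powr (- real d / 2) * s powr (- real d / 2) * exp (- (r\<^sup>2 / 4 / s))"
        using s by (simp add: heat_profile_def powr_mult)
      moreover have "s powr (- real d / 2) * s powr (- (\<beta> / 2 + 1)) = s powr (- ((\<beta> + real d) / 2) - 1)"
        unfolding powr_add[symmetric] by (rule arg_cong[of _ _ "\<lambda>e. s powr e"]) (simp add: field_simps)
      ultimately show ?thesis by (simp only: flip: \<open>s powr (- real d / 2) * s powr (- (\<beta> / 2 + 1)) = s powr (- ((\<beta> + real d) / 2) - 1)\<close>) (simp add: mult_ac)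
    qed
    also have "ennreal \<dots> = ennreal ?K * ennreal (s powr (- ((\<beta> + real d) / 2) - 1) * exp (- (r\<^sup>2 / 4 / s)))"
      by (rule ennreal_mult'') simp
    finally show "(\<integral>\<^sup>+\<tau>. ennreal (\<tau> powr (\<beta> + 1) * exp (- (s * \<tau>\<^sup>2)) * heat_profile d s r) \<partial>halfline)
      = ennreal (?K) * ennreal (s powr (- ((\<beta> + real d) / 2) - 1) * exp (- (r\<^sup>2 / 4 / s)))" .
  qed
  also have "\<dots> = ennreal (?K) * ennreal ((r\<^sup>2 / 4) powr (- ((\<beta> + real d) / 2)) * Gamma ((\<beta> + real d) / 2))"
    using d r \<beta> by (subst nn_integral_cmult, measurable) (subst nn_integral_inverse_Gamma, auto)
  also have "\<dots> = ennreal (?K * ((r\<^sup>2 / 4) powr (- ((\<beta> + real d) / 2)) * Gamma ((\<beta> + real d) / 2)))"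
    using d \<beta> by (subst ennreal_mult''[symmetric]) (auto intro!: Gamma_real_nonneg mult_nonneg_nonneg)
  also have "(r\<^sup>2 / 4) powr (- ((\<beta> + real d) / 2)) = (r / 2) powr (- (\<beta> + real d))"
  proof -
    have "r\<^sup>2 / 4 = (r / 2) powr 2" using r by (simp add: powr_numeral power_divide)
    moreover have "2 * (- (x / 2)) = - x" for x :: real by simp
    ultimately show ?thesis by (simp only: powr_powr)
  qed
  also have "(r / 2) powr (- (\<beta> + real d)) = r powr (- real d - \<beta>) * 2 powr (\<beta> + real d)"
  proof -
    have 1: "(r / 2) powr (- (\<beta> + real d)) = r powr (- (\<beta> + real d)) / 2 powr (- (\<beta> + real d))"
      using r by (simp add: powr_divide)
    have 2: "2 powr (- (\<beta> + real d)) = 1 / 2 powr (\<beta> + real d)"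
      by (rule powr_minus_divide)
    have 3: "- real d - \<beta> = - (\<beta> + real d)" by simp
    show ?thesis unfolding 1 2 3 by simp
  qed
  also have "2 powr (\<beta> + real d) = 2 powr \<beta> * 2 powr real d" by (rule powr_add)
  also have "(4 * pi) powr (- real d / 2) = 2 powr (- real d) / pi powr (real d / 2)"
  proof -
    have "(4::real) = 2 powr 2" by simp
    then have "(4::real) powr (- real d / 2) = 2 powr (- real d)" by (simp only: powr_powr) simp
    then show ?thesis by (simp add: powr_mult powr_minus_divide)
  qed
  also have "2 powr (- real d) = 1 / 2 powr real d" by (rule powr_minus_divide)
  finally show ?thesis by (simp add: mult_ac)
qed

text \<open>The series of absolute values of the terms of the mixture is dominated by this integral. It is
  finite because \<open>\<alpha> < 1\<close>: beyond a threshold \<open>T\<close> the exponent \<open>\<tau> powr \<alpha>\<close> stays below \<open>\<tau> r / 2\<close>, and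
  \<open>\<tau> r / 2 \<le> s \<tau>\<^sup>2 / 2 + r\<^sup>2 / (8 s)\<close> uses up only half of each of the two Gaussian exponents.\<close>

lemma nn_integral_exp_majorant_finite:
  assumes d: "0 < d" and r: "0 < r" and \<alpha>: "0 < \<alpha>" "\<alpha> < 1"
  shows "(\<integral>\<^sup>+p. ennreal (exp (snd p powr \<alpha>) * snd p * exp (- (fst p * (snd p)\<^sup>2)) * heat_profile d (fst p) r) \<partial>(halfline \<Otimes>\<^sub>M halfline)) < \<infinity>"
proof -
  \<comment> \<open>the solution of \<open>T powr (\<alpha> - 1) = r / 2\<close>\<close>
  define T where "T = (r / 2) powr (1 / (\<alpha> - 1))"
  have T: "0 < T" "T powr (\<alpha> - 1) = r / 2"
    using r \<alpha> by (simp_all add: T_def powr_powr)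
  have le: "\<tau> powr \<alpha> \<le> T powr \<alpha> + \<tau> * r / 2" if \<tau>: "0 < \<tau>" for \<tau>
  proof (cases "\<tau> \<le> T")
    case True
    then show ?thesis using \<tau> \<alpha> r powr_mono2[of \<alpha> \<tau> T] by (simp add: add_increasing2)
  next
    case False
    have "\<tau> powr \<alpha> = \<tau> * \<tau> powr (\<alpha> - 1)" using \<tau> by (simp add: powr_diff)
    also have "\<dots> \<le> \<tau> * T powr (\<alpha> - 1)"
      using False T \<tau> \<alpha> by (intro mult_left_mono powr_mono2') auto
    finally show ?thesis using T by (simp add: add_increasing)
  qed
  let ?K = "exp (T powr \<alpha>) * (4 * pi) powr (- real d / 2)"
  have "(\<integral>\<^sup>+p. ennreal (exp (snd p powr \<alpha>) * snd p * exp (- (fst p * (snd p)\<^sup>2)) * heat_profile d (fst p) r) \<partial>(halfline \<Otimes>\<^sub>M halfline))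
     = (\<integral>\<^sup>+s. \<integral>\<^sup>+\<tau>. ennreal (exp (\<tau> powr \<alpha>) * \<tau> * exp (- (s * \<tau>\<^sup>2)) * heat_profile d s r) \<partial>halfline \<partial>halfline)"
    by (subst halfline.nn_integral_fst[symmetric]) auto
  also have "\<dots> \<le> (\<integral>\<^sup>+s. ennreal ?K * ennreal (s powr (- (real d / 2) - 1) * exp (- (r\<^sup>2 / 8 / s))) \<partial>halfline)"
  proof (rule nn_integral_halfline_mono)
    fix s :: real assume s: "0 < s"
    let ?A = "?K * (s powr (- (real d / 2)) * exp (- (r\<^sup>2 / 8 / s)))"
    have "(\<integral>\<^sup>+\<tau>. ennreal (exp (\<tau> powr \<alpha>) * \<tau> * exp (- (s * \<tau>\<^sup>2)) * heat_profile d s r) \<partial>halfline)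
       \<le> (\<integral>\<^sup>+\<tau>. ennreal ?A * ennreal (\<tau> powr (2 * 1 - 1) * exp (- (s / 2 * \<tau>\<^sup>2))) \<partial>halfline)"
    proof (rule nn_integral_halfline_mono)
      fix \<tau> :: real assume \<tau>: "0 < \<tau>"
      have "0 \<le> (s * \<tau> - r / 2)\<^sup>2 / (2 * s)" using s by simp
      also have "\<dots> = s * \<tau>\<^sup>2 / 2 + r\<^sup>2 / 8 / s - \<tau> * r / 2"
        using s by (simp add: field_simps power2_eq_square)
      finally have "\<tau> * r / 2 \<le> s * \<tau>\<^sup>2 / 2 + r\<^sup>2 / 8 / s" by simp
      then have "\<tau> powr \<alpha> + - (s * \<tau>\<^sup>2) + - (r\<^sup>2 / (4 * s)) \<le> T powr \<alpha> + - (s / 2 * \<tau>\<^sup>2) + - (r\<^sup>2 / 8 / s)"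
        using le[OF \<tau>] by (simp add: field_simps)
      then have "exp (\<tau> powr \<alpha>) * exp (- (s * \<tau>\<^sup>2)) * exp (- (r\<^sup>2 / (4 * s))) \<le> exp (T powr \<alpha>) * exp (- (s / 2 * \<tau>\<^sup>2)) * exp (- (r\<^sup>2 / 8 / s))"
        by (simp only: exp_add[symmetric] exp_le_cancel_iff)
      then have "(\<tau> * (4 * pi * s) powr (- real d / 2)) * (exp (\<tau> powr \<alpha>) * exp (- (s * \<tau>\<^sup>2)) * exp (- (r\<^sup>2 / (4 * s))))
         \<le> (\<tau> * (4 * pi * s) powr (- real d / 2)) * (exp (T powr \<alpha>) * exp (- (s / 2 * \<tau>\<^sup>2)) * exp (- (r\<^sup>2 / 8 / s)))"
        using \<tau> by (intro mult_left_mono) auto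
      moreover have "(4 * pi * s) powr (- real d / 2) = (4 * pi) powr (- real d / 2) * s powr (- (real d / 2))"
        using s by (simp add: powr_mult)
      ultimately have "exp (\<tau> powr \<alpha>) * \<tau> * exp (- (s * \<tau>\<^sup>2)) * heat_profile d s r \<le> ?A * (\<tau> powr (2 * 1 - 1) * exp (- (s / 2 * \<tau>\<^sup>2)))"
        using \<tau> by (simp add: heat_profile_def mult_ac)
      then show "ennreal (exp (\<tau> powr \<alpha>) * \<tau> * exp (- (s * \<tau>\<^sup>2)) * heat_profile d s r) \<le> ennreal ?A * ennreal (\<tau> powr (2 * 1 - 1) * exp (- (s / 2 * \<tau>\<^sup>2)))"
        by (subst ennreal_mult'[symmetric]) (auto intro!: ennreal_leI)
    qed
    also have "\<dots> = ennreal ?A * ennreal ((s / 2) powr (- 1) / 2 * Gamma 1)"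
      using s nn_integral_gaussian_moment[of 1 "s / 2"] by (subst nn_integral_cmult) auto
    also have "\<dots> = ennreal (?A * (1 / s))"
      using s by (subst ennreal_mult''[symmetric]) (auto simp: powr_minus)
    also have "?A * (1 / s) = ?K * (s powr (- (real d / 2) - 1) * exp (- (r\<^sup>2 / 8 / s)))"
      using s by (simp add: powr_diff)
    finally show "(\<integral>\<^sup>+\<tau>. ennreal (exp (\<tau> powr \<alpha>) * \<tau> * exp (- (s * \<tau>\<^sup>2)) * heat_profile d s r) \<partial>halfline)
       \<le> ennreal ?K * ennreal (s powr (- (real d / 2) - 1) * exp (- (r\<^sup>2 / 8 / s)))"
      by (simp only: ennreal_mult''[symmetric] mult_nonneg_nonneg powr_ge_zero exp_ge_zero)
  qed
  also have "\<dots> = ennreal ?K * ennreal ((r\<^sup>2 / 8) powr (- (real d / 2)) * Gamma (real d / 2))"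
    using nn_integral_inverse_Gamma[of "real d / 2" "r\<^sup>2 / 8"] d r by (subst nn_integral_cmult) auto
  also have "\<dots> < \<infinity>" by (simp add: ennreal_mult_less_top)
  finally show ?thesis .
qed

text \<open>\<open>stable_jump\<close> is minus the imaginary part of \<open>exp (- z)\<close> at
  \<open>z = \<tau> powr \<alpha> * cis (\<pi> \<alpha> / 2)\<close>; its series is the imaginary part of the exponential series. The term
  at \<open>n = 0\<close> vanishes because of the sine, so the truncated exponent \<open>n - 1\<close> does no harm there.\<close>

lemma stable_jump_sums:
  assumes "0 < \<tau>"
  shows "(\<lambda>n. (-1) ^ (n - 1) / fact n * sin (pi * real n * \<alpha> / 2) * \<tau> powr (real n * \<alpha>)) sums stable_jump \<alpha> \<tau>"
proof -
  define z where "z = of_real (\<tau> powr \<alpha>) * cis (pi * \<alpha> / 2)"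
  have "(\<lambda>n. (- z) ^ n /\<^sub>R fact n) sums exp (- z)" by (rule exp_converges)
  then have "(\<lambda>n. - Im ((- z) ^ n /\<^sub>R fact n)) sums (- Im (exp (- z)))"
    by (intro sums_minus sums_Im)
  moreover have "- Im (exp (- z)) = stable_jump \<alpha> \<tau>"
    by (simp add: z_def Im_exp stable_jump_def)
  moreover have "- Im ((- z) ^ n /\<^sub>R fact n) = (-1) ^ (n - 1) / fact n * sin (pi * real n * \<alpha> / 2) * \<tau> powr (real n * \<alpha>)" for n
  proof (cases n)
    case (Suc m)
    have "(- z) ^ n = (-1) ^ n * (of_real ((\<tau> powr \<alpha>) ^ n) * cis (pi * \<alpha> / 2) ^ n)"
      unfolding z_def power_mult_distrib[symmetric] of_real_power by simp
    also have "(\<tau> powr \<alpha>) ^ n = \<tau> powr (real n * \<alpha>)"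
      using assms by (simp add: powr_power mult.commute)
    also have "cis (pi * \<alpha> / 2) ^ n = cis (real n * (pi * \<alpha> / 2))" by (rule Complex.DeMoivre)
    also have "(-1) ^ n * (of_real (\<tau> powr (real n * \<alpha>)) * cis (real n * (pi * \<alpha> / 2)))
      = of_real ((-1) ^ n * \<tau> powr (real n * \<alpha>)) * cis (real n * (pi * \<alpha> / 2))" by simp
    finally have "(- z) ^ n = of_real ((-1) ^ n * \<tau> powr (real n * \<alpha>)) * cis (real n * (pi * \<alpha> / 2))" .
    then show ?thesis by (simp add: Suc field_simps)
  qed simp
  ultimately show ?thesis by simp
qed

text \<open>Insert the series of \<open>stable_jump\<close> into the mixture and integrate term by term. Absolute
  convergence comes from replacing each sine by \<open>1\<close>, which turns the series into the exponential
  series of \<open>\<tau> powr \<alpha>\<close>.\<close>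

lemma gaussian_mixture_series:
  assumes d: "0 < d" and r: "0 < r" and \<alpha>: "0 < \<alpha>" "\<alpha> < 1"
  shows "summable (\<lambda>n. \<bar>a_coeff d \<alpha> n\<bar> * r powr (- real d - real n * \<alpha>))"
    and "(\<lambda>n. a_coeff d \<alpha> n * r powr (- real d - real n * \<alpha>)) sums
           (\<integral>p. mix_weight \<alpha> p * heat_profile d (fst p) r \<partial>(halfline \<Otimes>\<^sub>M halfline))"
proof -
  let ?P = "halfline \<Otimes>\<^sub>M halfline"
  define c where "c n = (-1) ^ (n - 1) / fact n * sin (pi * real n * \<alpha> / 2)" for n
  define M where "M n = Gamma (real n * \<alpha> / 2 + 1) * Gamma ((real n * \<alpha> + real d) / 2) * 2 powr (real n * \<alpha>)
     / (2 * pi powr (real d / 2)) * r powr (- real d - real n * \<alpha>)" for n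
  define G where "G n p = snd p powr (real n * \<alpha> + 1) * exp (- (fst p * (snd p)\<^sup>2)) * heat_profile d (fst p) r" for n and p :: "real \<times> real"
  have G_meas [measurable]: "G n \<in> borel_measurable (borel \<Otimes>\<^sub>M borel)" for n
    unfolding G_def by measurable
  have G0: "0 \<le> G n p" for n p by (simp add: G_def)
  have M0: "0 \<le> M n" for n
  proof -
    have "0 < real n * \<alpha> / 2 + 1" "0 < real n * \<alpha> + real d"
      using d \<alpha> by (auto intro!: add_nonneg_pos)
    then show ?thesis
      unfolding M_def by (intro mult_nonneg_nonneg divide_nonneg_nonneg Gamma_real_nonneg) auto
  qed
  have GM: "(\<integral>\<^sup>+p. ennreal (G n p) \<partial>?P) = ennreal (M n)" for n
    unfolding G_def M_def using nn_integral_mixed_moment[OF d r, of "real n * \<alpha>"] \<alpha> by simp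
  have intG: "integrable ?P (G n)" for n
    by (rule integrableI_bounded) (use GM G0 in \<open>simp_all\<close>)
  have intGM: "(\<integral>p. G n p \<partial>?P) = M n" for n
    by (subst integral_eq_nn_integral) (use GM G0 M0 in auto)
  have a: "a_coeff d \<alpha> n * r powr (- real d - real n * \<alpha>) = 2 / pi * c n * M n" for n
    by (simp add: a_coeff_def c_def M_def powr_add mult_ac)
  have c_le: "\<bar>c n\<bar> \<le> 1 / fact n" for n
    by (simp add: c_def abs_mult divide_right_mono)
  have exp_sum: "(\<lambda>n. G n p / fact n) sums (exp (snd p powr \<alpha>) * snd p * exp (- (fst p * (snd p)\<^sup>2)) * heat_profile d (fst p) r)"
    if "0 < fst p" "0 < snd p" for p
  proof -
    have "(\<lambda>n. (snd p powr \<alpha>) ^ n /\<^sub>R fact n * (snd p * exp (- (fst p * (snd p)\<^sup>2)) * heat_profile d (fst p) r))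
      sums (exp (snd p powr \<alpha>) * (snd p * exp (- (fst p * (snd p)\<^sup>2)) * heat_profile d (fst p) r))"
      by (intro sums_mult2 exp_converges)
    moreover have "(snd p powr \<alpha>) ^ n = snd p powr (real n * \<alpha>)" for n
      using that by (simp add: powr_power mult.commute)
    ultimately show ?thesis using that
      by (simp add: G_def powr_add divide_inverse mult_ac)
  qed
  \<comment> \<open>Summability of \<open>M n / n!\<close>: by monotone convergence its sum is the integral of the exponential
    majorant.\<close>
  have "(\<Sum>n. ennreal (M n / fact n)) = (\<Sum>n. \<integral>\<^sup>+p. ennreal (G n p / fact n) \<partial>?P)"
  proof (rule suminf_cong)
    fix n
    have "(\<integral>\<^sup>+p. ennreal (G n p / fact n) \<partial>?P) = (\<integral>\<^sup>+p. ennreal (1 / fact n) * ennreal (G n p) \<partial>?P)"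
      by (intro nn_integral_cong) (simp add: ennreal_mult'[symmetric])
    also have "\<dots> = ennreal (1 / fact n) * ennreal (M n)"
      by (subst nn_integral_cmult) (auto simp: GM)
    finally show "ennreal (M n / fact n) = (\<integral>\<^sup>+p. ennreal (G n p / fact n) \<partial>?P)"
      by (simp add: ennreal_mult'[symmetric])
  qed
  also have "\<dots> = (\<integral>\<^sup>+p. (\<Sum>n. ennreal (G n p / fact n)) \<partial>?P)"
    by (rule nn_integral_suminf[symmetric]) simp
  also have "\<dots> = (\<integral>\<^sup>+p. ennreal (exp (snd p powr \<alpha>) * snd p * exp (- (fst p * (snd p)\<^sup>2)) * heat_profile d (fst p) r) \<partial>?P)"
  proof (rule nn_integral_cong_AE)
    show "AE p in ?P. (\<Sum>n. ennreal (G n p / fact n)) = ennreal (exp (snd p powr \<alpha>) * snd p * exp (- (fst p * (snd p)\<^sup>2)) * heat_profile d (fst p) r)"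
      using AE_halfline_pair by eventually_elim (rule suminf_ennreal_eq, use G0 exp_sum in auto)
  qed
  also have "\<dots> < \<infinity>" by (rule nn_integral_exp_majorant_finite[OF d r \<alpha>])
  finally have "summable (\<lambda>n. M n / fact n)"
    using M0 by (intro summable_suminf_not_top) auto
  then have sM: "summable (\<lambda>n. \<bar>2 / pi * c n * M n\<bar>)"
  proof (rule summable_comparison_test_ev[OF always_eventually, rotated, OF summable_mult[of _ "2 / pi"]], intro allI)
    fix n
    have "\<bar>c n\<bar> * M n \<le> 1 / fact n * M n" by (intro mult_right_mono c_le M0)
    then have "2 / pi * (\<bar>c n\<bar> * M n) \<le> 2 / pi * (1 / fact n * M n)" by (rule mult_left_mono) simp
    then show "norm \<bar>2 / pi * c n * M n\<bar> \<le> 2 / pi * (M n / fact n)" using M0[of n] by (simp add: abs_mult)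
  qed
  show "summable (\<lambda>n. \<bar>a_coeff d \<alpha> n\<bar> * r powr (- real d - real n * \<alpha>))"
  proof -
    have "\<bar>a_coeff d \<alpha> n\<bar> * r powr (- real d - real n * \<alpha>) = \<bar>2 / pi * c n * M n\<bar>" for n
      unfolding a[symmetric] by (simp add: abs_mult)
    then show ?thesis using sM by simp
  qed
  let ?f = "\<lambda>n p. 2 / pi * c n * G n p"
  have jump: "(\<lambda>n. ?f n p) sums (mix_weight \<alpha> p * heat_profile d (fst p) r)" if "0 < fst p" "0 < snd p" for p
  proof -
    have "(\<lambda>n. 2 / pi * (snd p * exp (- (fst p * (snd p)\<^sup>2)) * heat_profile d (fst p) r) * (c n * snd p powr (real n * \<alpha>)))
      sums (2 / pi * (snd p * exp (- (fst p * (snd p)\<^sup>2)) * heat_profile d (fst p) r) * stable_jump \<alpha> (snd p))"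
      unfolding c_def by (intro sums_mult stable_jump_sums that)
    then show ?thesis using that
      by (simp add: G_def mix_weight_def powr_add case_prod_beta mult_ac)
  qed
  have "(\<lambda>n. \<integral>p. ?f n p \<partial>?P) sums (\<integral>p. (\<Sum>n. ?f n p) \<partial>?P)"
  proof (rule sums_integral)
    show "AE p in ?P. summable (\<lambda>n. norm (?f n p))"
      using AE_halfline_pair
    proof eventually_elim
      case (elim p)
      have "summable (\<lambda>n. 2 / pi * (G n p / fact n))"
        using exp_sum[of p] elim by (intro summable_mult) (auto simp: sums_iff)
      then show ?case
      proof (rule summable_comparison_test_ev[OF always_eventually, rotated], intro allI)
        fix n
        have "\<bar>c n\<bar> * G n p \<le> 1 / fact n * G n p" by (intro mult_right_mono c_le G0)
        then have "2 / pi * (\<bar>c n\<bar> * G n p) \<le> 2 / pi * (1 / fact n * G n p)" by (rule mult_left_mono) simp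
        then show "norm (norm (?f n p)) \<le> 2 / pi * (G n p / fact n)" using G0[of n p] by (simp add: abs_mult)
      qed
    qed
    have "(\<integral>p. norm (?f n p) \<partial>?P) = \<bar>2 / pi * c n * M n\<bar>" for n
    proof -
      have "(\<integral>p. norm (?f n p) \<partial>?P) = (\<integral>p. \<bar>2 / pi * c n\<bar> * G n p \<partial>?P)"
        using G0 by (intro Bochner_Integration.integral_cong) (auto simp: abs_mult)
      also have "\<dots> = \<bar>2 / pi * c n\<bar> * M n" by (simp add: intGM)
      finally show ?thesis using M0[of n] by (simp add: abs_mult)
    qed
    then show "summable (\<lambda>n. \<integral>p. norm (?f n p) \<partial>?P)" using sM by simp
  qed (use intG in auto)
  moreover have "(\<integral>p. (\<Sum>n. ?f n p) \<partial>?P) = (\<integral>p. mix_weight \<alpha> p * heat_profile d (fst p) r \<partial>?P)"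
  proof (rule integral_cong_AE)
    show "AE p in ?P. (\<Sum>n. ?f n p) = mix_weight \<alpha> p * heat_profile d (fst p) r"
      using AE_halfline_pair by eventually_elim (use jump in \<open>auto simp: sums_iff\<close>)
  qed measurable
  moreover have "(\<integral>p. ?f n p \<partial>?P) = 2 / pi * c n * M n" for n
    by (simp add: intGM)
  ultimately show "(\<lambda>n. a_coeff d \<alpha> n * r powr (- real d - real n * \<alpha>)) sums
           (\<integral>p. mix_weight \<alpha> p * heat_profile d (fst p) r \<partial>?P)"
    unfolding a by (simp only:)
qed

section \<open>Heat kernels\<close>
lemma lborel_integral_affine_euclidean:
  fixes f :: "'a::euclidean_space \<Rightarrow> 'b::{banach, second_countable_topology}"
  assumes [measurable]: "f \<in> borel_measurable borel" and c: "0 < c"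
  shows "(\<integral>x. f x \<partial>lborel) = c ^ DIM('a) *\<^sub>R (\<integral>x. f (t + c *\<^sub>R x) \<partial>lborel)"
proof -
  have "lborel = density (distr lborel borel (\<lambda>x::'a. t + c *\<^sub>R x)) (\<lambda>_. ennreal (c ^ DIM('a)))"
    using lborel_affine[of c t] c by simp
  then have "(\<integral>x. f x \<partial>lborel) = (\<integral>x. f x \<partial>(density (distr lborel borel (\<lambda>x::'a. t + c *\<^sub>R x)) (\<lambda>_. ennreal (c ^ DIM('a)))))"
    by (rule arg_cong[of _ _ "\<lambda>M. integral\<^sup>L M f"])
  then show ?thesis using c
    by (simp add: integral_density integral_distr)
qed

lemma lborel_nn_integral_affine_euclidean:
  fixes f :: "'a::euclidean_space \<Rightarrow> ennreal"
  assumes [measurable]: "f \<in> borel_measurable borel" and c: "0 < c"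
  shows "(\<integral>\<^sup>+x. f x \<partial>lborel) = ennreal (c ^ DIM('a)) * (\<integral>\<^sup>+x. f (t + c *\<^sub>R x) \<partial>lborel)"
proof -
  have "lborel = density (distr lborel borel (\<lambda>x::'a. t + c *\<^sub>R x)) (\<lambda>_. ennreal (c ^ DIM('a)))"
    using lborel_affine[of c t] c by simp
  then have "(\<integral>\<^sup>+x. f x \<partial>lborel) = (\<integral>\<^sup>+x. f x \<partial>(density (distr lborel borel (\<lambda>x::'a. t + c *\<^sub>R x)) (\<lambda>_. ennreal (c ^ DIM('a)))))"
    by (rule arg_cong[of _ _ "\<lambda>M. integral\<^sup>N M f"])
  then show ?thesis
    by (simp add: nn_integral_density nn_integral_distr nn_integral_cmult)
qed

lemma lborel_integrable_affine_euclidean: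
  fixes f :: "'a::euclidean_space \<Rightarrow> 'b::{banach, second_countable_topology}"
  assumes f: "integrable lborel f" and c: "0 < c"
  shows "integrable lborel (\<lambda>x. f (t + c *\<^sub>R x))"
proof (rule integrableI_bounded)
  have m [measurable]: "f \<in> borel_measurable borel" using f by (simp add: integrable_iff_bounded)
  show "(\<lambda>x. f (t + c *\<^sub>R x)) \<in> borel_measurable lborel" by simp
  have "ennreal (c ^ DIM('a)) * (\<integral>\<^sup>+x. ennreal (norm (f (t + c *\<^sub>R x))) \<partial>lborel) < \<infinity>"
    using lborel_nn_integral_affine_euclidean[of "\<lambda>x. ennreal (norm (f x))" c t] f c
    by (simp add: integrable_iff_bounded)
  then show "(\<integral>\<^sup>+x. ennreal (norm (f (t + c *\<^sub>R x))) \<partial>lborel) < \<infinity>"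
    using c by (auto simp: ennreal_mult_less_top)
qed

definition heat_kernel :: "real \<Rightarrow> real ^ 'n \<Rightarrow> real" where
  "heat_kernel s x = heat_profile CARD('n) s (norm x)"

lemma measurable_heat_kernel [measurable (raw)]:
  assumes [measurable]: "f \<in> borel_measurable M" "g \<in> borel_measurable M"
  shows "(\<lambda>x. heat_kernel (f x) (g x)) \<in> borel_measurable M"
  unfolding heat_kernel_def by measurable

lemma heat_kernel_nonneg [simp]: "0 \<le> heat_kernel s x"
  by (simp add: heat_kernel_def)

lemma heat_kernel_prod:
  fixes x :: "real ^ 'n"
  assumes s: "0 < s"
  shows "heat_kernel s x = (\<Prod>b\<in>Basis. normal_density 0 (sqrt (2 * s)) (x \<bullet> b))"
proof -
  have "(norm x)\<^sup>2 = (\<Sum>b\<in>Basis. (x \<bullet> b)\<^sup>2)"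
    unfolding power2_norm_eq_inner by (subst euclidean_inner) (simp add: power2_eq_square)
  then have "exp (- ((norm x)\<^sup>2 / (4 * s))) = (\<Prod>b\<in>Basis. exp (- ((x \<bullet> b)\<^sup>2 / (4 * s))))"
    by (simp only: exp_sum[symmetric] sum_divide_distrib sum_negf[symmetric] finite_Basis)
  moreover have "(4 * pi * s) powr (- real CARD('n) / 2) = (\<Prod>b\<in>(Basis::(real^'n) set). 1 / sqrt (4 * pi * s))"
  proof -
    have pos: "0 < 4 * pi * s" using s by simp
    have "1 / sqrt (4 * pi * s) = (4 * pi * s) powr (- (1 / 2))"
      unfolding powr_minus_divide using pos by (subst powr_half_sqrt) (simp_all only: less_imp_le)
    then have "(1 / sqrt (4 * pi * s)) ^ CARD('n) = (4 * pi * s) powr (- (1 / 2) * real CARD('n))"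
      using pos powr_realpow[of "(4 * pi * s) powr (- (1 / 2))" "CARD('n)"] s by (simp add: powr_powr)
    then show ?thesis by simp
  qed
  ultimately show ?thesis using s
    by (simp add: heat_kernel_def heat_profile_def normal_density_def prod_dividef power_one_over mult_ac)
qed

lemma integral_normal_density_char:
  assumes "0 < \<sigma>"
  shows "(\<integral>x. complex_of_real (normal_density 0 \<sigma> x) * exp (\<i> * complex_of_real (t * x)) \<partial>lborel)
    = complex_of_real (exp (- (\<sigma>\<^sup>2 * t\<^sup>2 / 2)))"
proof -
  have nd: "normal_density 0 \<sigma> (\<sigma> * x) * \<sigma> = std_normal_density x" for x
    using assms by (simp add: normal_density_def real_sqrt_mult power_mult_distrib field_simps)
  have "(\<integral>x. complex_of_real (normal_density 0 \<sigma> x) * exp (\<i> * complex_of_real (t * x)) \<partial>lborel)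
    = \<sigma> *\<^sub>R (\<integral>x. complex_of_real (normal_density 0 \<sigma> (\<sigma> * x)) * exp (\<i> * complex_of_real (t * (\<sigma> * x))) \<partial>lborel)"
    using assms by (subst lborel_integral_real_affine[where c = \<sigma> and t = 0]) auto
  also have "\<dots> = (\<integral>x. \<sigma> *\<^sub>R (complex_of_real (normal_density 0 \<sigma> (\<sigma> * x)) * exp (\<i> * complex_of_real (t * (\<sigma> * x)))) \<partial>lborel)"
    by (rule integral_scaleR_right[symmetric]) 
  also have "\<dots> = (\<integral>x. std_normal_density x *\<^sub>R exp (\<i> * complex_of_real ((\<sigma> * t) * x)) \<partial>lborel)"
    by (intro Bochner_Integration.integral_cong refl) (simp add: nd[symmetric] scaleR_conv_of_real mult_ac)
  also have "\<dots> = (\<integral>x. exp (\<i> * complex_of_real ((\<sigma> * t) * x)) \<partial>(density lborel std_normal_density))"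
    by (subst integral_density) auto
  also have "\<dots> = char std_normal_distribution (\<sigma> * t)"
    by (simp add: char_def)
  also have "\<dots> = complex_of_real (exp (- (\<sigma>\<^sup>2 * t\<^sup>2 / 2)))"
    by (simp add: char_std_normal_distribution power_mult_distrib)
  finally show ?thesis .
qed

text \<open>The heat kernel is a product of one-dimensional normal densities over an orthonormal basis, and
  so is the exponential; the Fourier integral factorises.\<close>

lemma
  fixes \<xi> :: "real ^ 'n"
  assumes s: "0 < s"
  shows integrable_heat_kernel: "integrable lborel (heat_kernel s :: real ^ 'n \<Rightarrow> real)"
    and fourier_heat_kernel: "(\<integral>x. complex_of_real (heat_kernel s x) * exp (\<i> * complex_of_real (\<xi> \<bullet> x)) \<partial>lborel)
        = complex_of_real (exp (- (s * (norm \<xi>)\<^sup>2)))"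
proof -
  interpret product_sigma_finite "\<lambda>_::real^'n. lborel :: real measure" ..
  let ?\<sigma> = "sqrt (2 * s)"
  have \<sigma>: "0 < ?\<sigma>" using s by simp
  let ?f = "\<lambda>(b::real^'n) u. complex_of_real (normal_density 0 ?\<sigma> u) * exp (\<i> * complex_of_real ((\<xi> \<bullet> b) * u))"
  have intf: "integrable lborel (?f b)" for b
  proof (rule Bochner_Integration.integrable_bound[OF integrable_normal_density[OF \<sigma>, of 0]])
    show "AE x in lborel. norm (?f b x) \<le> norm (normal_density 0 ?\<sigma> x)"
      by (simp add: norm_mult)
  qed simp
  have "(\<integral>\<^sup>+x. ennreal (heat_kernel s (x::real^'n)) \<partial>lborel) = (\<integral>\<^sup>+x. (\<Prod>b\<in>(Basis::(real^'n) set). ennreal (normal_density 0 ?\<sigma> (x \<bullet> b))) \<partial>lborel)"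
    using s by (simp add: heat_kernel_prod prod_ennreal)
  also have "\<dots> = (\<Prod>b\<in>(Basis::(real^'n) set). \<integral>\<^sup>+u. ennreal (normal_density 0 ?\<sigma> u) \<partial>lborel)"
    by (rule nn_integral_lborel_prod) auto
  also have "(\<integral>\<^sup>+u. ennreal (normal_density 0 ?\<sigma> u) \<partial>lborel) = 1"
    using integral_normal_density[OF \<sigma>, of 0] integrable_normal_density[OF \<sigma>, of 0]
    by (subst nn_integral_eq_integral) auto
  finally show "integrable lborel (heat_kernel s :: real ^ 'n \<Rightarrow> real)"
    by (intro integrableI_bounded) auto
  let ?v = "\<lambda>f::real^'n \<Rightarrow> real. \<Sum>b\<in>Basis. f b *\<^sub>R b"
  have "(\<integral>x. complex_of_real (heat_kernel s x) * exp (\<i> * complex_of_real (\<xi> \<bullet> x)) \<partial>lborel)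
      = (\<integral>x. (\<Prod>b\<in>Basis. ?f b (x \<bullet> b)) \<partial>lborel)"
  proof (intro Bochner_Integration.integral_cong refl)
    fix x :: "real^'n"
    have "\<xi> \<bullet> x = (\<Sum>b\<in>Basis. (\<xi> \<bullet> b) * (x \<bullet> b))" by (rule euclidean_inner)
    then have "exp (\<i> * complex_of_real (\<xi> \<bullet> x)) = (\<Prod>b\<in>Basis. exp (\<i> * complex_of_real ((\<xi> \<bullet> b) * (x \<bullet> b))))"
      by (simp only: of_real_sum sum_distrib_left exp_sum finite_Basis)
    then show "complex_of_real (heat_kernel s x) * exp (\<i> * complex_of_real (\<xi> \<bullet> x)) = (\<Prod>b\<in>Basis. ?f b (x \<bullet> b))"
      by (simp only: heat_kernel_prod[OF s] prod.distrib of_real_prod)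
  qed
  also have "\<dots> = (\<integral>f. (\<Prod>b\<in>Basis. ?f b (?v f \<bullet> b)) \<partial>(\<Pi>\<^sub>M b\<in>Basis. lborel))"
    unfolding lborel_eq[where ?'a = "real^'n"] by (rule integral_distr) (auto intro!: borel_measurable_prod)
  also have "\<dots> = (\<integral>f. (\<Prod>b\<in>Basis. ?f b (f b)) \<partial>(\<Pi>\<^sub>M b\<in>Basis. lborel))"
    by (intro Bochner_Integration.integral_cong prod.cong refl) simp
  also have "\<dots> = (\<Prod>b\<in>Basis. integral\<^sup>L lborel (?f b))"
    by (rule product_integral_prod) (use intf in auto)
  also have "\<dots> = (\<Prod>b\<in>Basis. complex_of_real (exp (- (s * (\<xi> \<bullet> b)\<^sup>2))))"
  proof (rule prod.cong[OF refl])
    fix b :: "real^'n"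
    have "?\<sigma>\<^sup>2 * (\<xi> \<bullet> b)\<^sup>2 / 2 = s * (\<xi> \<bullet> b)\<^sup>2" using s by simp
    then show "integral\<^sup>L lborel (?f b) = complex_of_real (exp (- (s * (\<xi> \<bullet> b)\<^sup>2)))"
      using integral_normal_density_char[OF \<sigma>, of "\<xi> \<bullet> b"] by (simp only:)
  qed
  also have "\<dots> = complex_of_real (exp (- (s * (norm \<xi>)\<^sup>2)))"
  proof -
    have "(norm \<xi>)\<^sup>2 = (\<Sum>b\<in>Basis. (\<xi> \<bullet> b)\<^sup>2)"
      unfolding power2_norm_eq_inner by (subst euclidean_inner) (simp add: power2_eq_square)
    then have "exp (- (s * (norm \<xi>)\<^sup>2)) = (\<Prod>b\<in>Basis. exp (- (s * (\<xi> \<bullet> b)\<^sup>2)))"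
      by (simp only: exp_sum[symmetric] sum_distrib_left sum_negf finite_Basis)
    then show ?thesis by (simp only: of_real_prod)
  qed
  finally show "(\<integral>x. complex_of_real (heat_kernel s x) * exp (\<i> * complex_of_real (\<xi> \<bullet> x)) \<partial>lborel)
        = complex_of_real (exp (- (s * (norm \<xi>)\<^sup>2)))" .
qed

lemma integral_heat_kernel:
  assumes "0 < s"
  shows "(\<integral>x. heat_kernel s (x::real^'n) \<partial>lborel) = 1"
  using fourier_heat_kernel[OF assms, of "0::real^'n"] by simp

section \<open>Uniqueness of Fourier transforms of signed measures\<close>
lemma (in pair_sigma_finite) integrable_product_bounded:
  fixes u :: "'a \<Rightarrow> real" and v :: "'b \<Rightarrow> real"
    and f :: "'a \<times> 'b \<Rightarrow> 'c::{banach, second_countable_topology}"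
  assumes u: "integrable M1 u" and v: "integrable M2 v"
    and [measurable]: "f \<in> borel_measurable (M1 \<Otimes>\<^sub>M M2)"
    and bound: "\<And>x y. norm (f (x, y)) \<le> \<bar>u x\<bar> * \<bar>v y\<bar>"
  shows "integrable (M1 \<Otimes>\<^sub>M M2) f"
proof (rule integrableI_bounded)
  have [measurable]: "u \<in> borel_measurable M1" "v \<in> borel_measurable M2"
    using u v by (simp_all add: integrable_iff_bounded)
  have "(\<integral>\<^sup>+p. ennreal (norm (f p)) \<partial>(M1 \<Otimes>\<^sub>M M2)) \<le> (\<integral>\<^sup>+p. ennreal \<bar>u (fst p)\<bar> * ennreal \<bar>v (snd p)\<bar> \<partial>(M1 \<Otimes>\<^sub>M M2))"
    using bound by (intro nn_integral_mono) (auto simp: ennreal_mult'[symmetric] ennreal_leI)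
  also have "\<dots> = (\<integral>\<^sup>+x. \<integral>\<^sup>+y. ennreal \<bar>u x\<bar> * ennreal \<bar>v y\<bar> \<partial>M2 \<partial>M1)"
    by (subst M2.nn_integral_fst[symmetric]) auto
  also have "\<dots> = (\<integral>\<^sup>+x. ennreal \<bar>u x\<bar> \<partial>M1) * (\<integral>\<^sup>+y. ennreal \<bar>v y\<bar> \<partial>M2)"
    by (simp add: nn_integral_cmult nn_integral_multc)
  also have "\<dots> < \<infinity>"
    using u v by (simp add: integrable_iff_bounded ennreal_mult_less_top)
  finally show "(\<integral>\<^sup>+p. ennreal (norm (f p)) \<partial>(M1 \<Otimes>\<^sub>M M2)) < \<infinity>" .
qed simp

text \<open>Up to a constant the Gaussian is its own Fourier transform. Hence the convolution of the signed
  measure \<open>h M\<close> with a Gaussian is an integral of the Fourier transform of \<open>h M\<close>.\<close>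

lemma smoothing_fourier:
  fixes M :: "(real ^ 'n) measure" and h :: "real ^ 'n \<Rightarrow> real" and y :: "real ^ 'n"
  assumes "sigma_finite_measure M" and sets [measurable_cong]: "sets M = sets borel"
    and h: "integrable M h" and s: "0 < s"
  shows "complex_of_real (\<integral>x. heat_kernel s (y - x) * h x \<partial>M)
    = complex_of_real ((4 * pi * s) powr (- real CARD('n) / 2)) *
      (\<integral>\<xi>. complex_of_real (heat_kernel (1 / (4 * s)) \<xi>) * exp (\<i> * complex_of_real (\<xi> \<bullet> y)) *
         (\<integral>x. exp (\<i> * complex_of_real (- \<xi> \<bullet> x)) * complex_of_real (h x) \<partial>M) \<partial>lborel)"
proof -
  interpret M: sigma_finite_measure M by fact
  interpret pair_sigma_finite M "lborel :: (real^'n) measure" ..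
  let ?K = "heat_kernel (1 / (4 * s)) :: real^'n \<Rightarrow> real"
  let ?c = "complex_of_real ((4 * pi * s) powr (- real CARD('n) / 2))"
  have s': "0 < 1 / (4 * s)" using s by simp
  have [measurable]: "h \<in> borel_measurable borel"
    using h sets by (simp add: integrable_iff_bounded cong: measurable_cong_sets)
  let ?g = "\<lambda>x \<xi>. complex_of_real (h x) * (complex_of_real (?K \<xi>) * exp (\<i> * complex_of_real (\<xi> \<bullet> (y - x))))"
  have int: "integrable (M \<Otimes>\<^sub>M lborel) (\<lambda>(x, \<xi>). ?g x \<xi>)"
    by (rule integrable_product_bounded[OF h integrable_heat_kernel[OF s']])
       (simp_all add: norm_mult)
  have 1: "complex_of_real (heat_kernel s z) = ?c * (\<integral>\<xi>. complex_of_real (?K \<xi>) * exp (\<i> * complex_of_real (\<xi> \<bullet> z)) \<partial>lborel)" for z :: "real^'n"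
    using fourier_heat_kernel[OF s', of z] by (simp add: heat_kernel_def heat_profile_def inner_commute)
  have "complex_of_real (\<integral>x. heat_kernel s (y - x) * h x \<partial>M) = (\<integral>x. complex_of_real (heat_kernel s (y - x)) * complex_of_real (h x) \<partial>M)"
    by (subst integral_complex_of_real[symmetric]) simp
  also have "\<dots> = (\<integral>x. ?c * (\<integral>\<xi>. ?g x \<xi> \<partial>lborel) \<partial>M)"
    unfolding 1 by (intro Bochner_Integration.integral_cong refl) (simp add: mult_ac)
  also have "\<dots> = ?c * (\<integral>x. \<integral>\<xi>. ?g x \<xi> \<partial>lborel \<partial>M)"
    by simp
  also have "(\<integral>x. \<integral>\<xi>. ?g x \<xi> \<partial>lborel \<partial>M) = (\<integral>\<xi>. \<integral>x. ?g x \<xi> \<partial>M \<partial>lborel)"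
    by (rule Fubini_integral[OF int, symmetric])
  also have "(\<integral>\<xi>. \<integral>x. ?g x \<xi> \<partial>M \<partial>lborel) = (\<integral>\<xi>. complex_of_real (?K \<xi>) * exp (\<i> * complex_of_real (\<xi> \<bullet> y)) *
         (\<integral>x. exp (\<i> * complex_of_real (- \<xi> \<bullet> x)) * complex_of_real (h x) \<partial>M) \<partial>lborel)"
  proof (intro Bochner_Integration.integral_cong refl)
    fix \<xi> :: "real^'n"
    have "(\<integral>x. ?g x \<xi> \<partial>M) = (\<integral>x. (complex_of_real (?K \<xi>) * exp (\<i> * complex_of_real (\<xi> \<bullet> y))) * (exp (\<i> * complex_of_real (- \<xi> \<bullet> x)) * complex_of_real (h x)) \<partial>M)"
    proof (intro Bochner_Integration.integral_cong refl)
      fix x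
      have "exp (\<i> * complex_of_real (\<xi> \<bullet> (y - x))) = exp (\<i> * complex_of_real (\<xi> \<bullet> y)) * exp (\<i> * complex_of_real (- \<xi> \<bullet> x))"
        by (simp add: exp_add[symmetric] inner_diff_right algebra_simps)
      then show "?g x \<xi> = (complex_of_real (?K \<xi>) * exp (\<i> * complex_of_real (\<xi> \<bullet> y))) * (exp (\<i> * complex_of_real (- \<xi> \<bullet> x)) * complex_of_real (h x))"
        by (simp only: mult_ac)
    qed
    then show "(\<integral>x. ?g x \<xi> \<partial>M) = complex_of_real (?K \<xi>) * exp (\<i> * complex_of_real (\<xi> \<bullet> y)) *
         (\<integral>x. exp (\<i> * complex_of_real (- \<xi> \<bullet> x)) * complex_of_real (h x) \<partial>M)"
      by simp
  qed
  finally show ?thesis .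
qed

text \<open>By symmetry of the heat kernel, smoothing the test function is the same as smoothing the signed
  measure.\<close>

lemma integral_smoothing_swap:
  fixes M :: "(real ^ 'n) measure" and h \<phi> :: "real ^ 'n \<Rightarrow> real"
  assumes "sigma_finite_measure M" and sets [measurable_cong]: "sets M = sets borel"
    and h: "integrable M h" and s: "0 < s"
    and [measurable]: "\<phi> \<in> borel_measurable borel" and B: "\<And>x. \<bar>\<phi> x\<bar> \<le> B"
  shows "(\<integral>x. (\<integral>z. \<phi> (x + sqrt s *\<^sub>R z) * heat_kernel 1 z \<partial>lborel) * h x \<partial>M)
    = (\<integral>y. \<phi> y * (\<integral>x. heat_kernel s (y - x) * h x \<partial>M) \<partial>lborel)"
proof -
  interpret M: sigma_finite_measure M by fact
  interpret pair_sigma_finite M "lborel :: (real^'n) measure" ..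
  have [measurable]: "h \<in> borel_measurable borel"
    using h sets by (simp add: integrable_iff_bounded cong: measurable_cong_sets)
  have B0: "0 \<le> B" using B[of 0] by linarith
  have hk: "heat_kernel s (sqrt s *\<^sub>R z) * sqrt s ^ CARD('n) = heat_kernel 1 z" for z :: "real^'n"
  proof -
    have "sqrt s ^ CARD('n) = s powr (real CARD('n) / 2)"
      using s by (simp add: powr_half_sqrt[symmetric] powr_power)
    then have "(4 * pi * s) powr (- real CARD('n) / 2) * sqrt s ^ CARD('n) = (4 * pi) powr (- real CARD('n) / 2)"
      using s by (simp add: powr_mult powr_add[symmetric] mult.assoc)
    then show ?thesis using s
      by (simp add: heat_kernel_def heat_profile_def power_mult_distrib mult_ac)
  qed
  have A: "(\<integral>z. \<phi> (x + sqrt s *\<^sub>R z) * heat_kernel 1 z \<partial>lborel) = (\<integral>y. \<phi> y * heat_kernel s (y - x) \<partial>lborel)" for x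
  proof -
    have "(\<integral>y. \<phi> y * heat_kernel s (y - x) \<partial>lborel)
      = sqrt s ^ DIM(real^'n) *\<^sub>R (\<integral>z. \<phi> (x + sqrt s *\<^sub>R z) * heat_kernel s ((x + sqrt s *\<^sub>R z) - x) \<partial>lborel)"
      using s by (intro lborel_integral_affine_euclidean) auto
    also have "\<dots> = (\<integral>z. sqrt s ^ CARD('n) * (\<phi> (x + sqrt s *\<^sub>R z) * heat_kernel s (sqrt s *\<^sub>R z)) \<partial>lborel)"
      by simp
    also have "\<dots> = (\<integral>z. \<phi> (x + sqrt s *\<^sub>R z) * heat_kernel 1 z \<partial>lborel)"
      unfolding hk[symmetric] by (simp add: mult_ac)
    finally show ?thesis ..
  qed
  let ?g = "\<lambda>x y. \<phi> y * heat_kernel s (y - x) * h x"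
  have int: "integrable (M \<Otimes>\<^sub>M lborel) (\<lambda>(x, y). ?g x y)"
  proof (rule integrableI_bounded)
    have "(\<integral>\<^sup>+p. ennreal (norm (case p of (x, y) \<Rightarrow> ?g x y)) \<partial>(M \<Otimes>\<^sub>M lborel))
       = (\<integral>\<^sup>+x. \<integral>\<^sup>+y. ennreal (norm (?g x y)) \<partial>lborel \<partial>M)"
      by (subst lborel.nn_integral_fst[symmetric]) auto
    also have "\<dots> \<le> (\<integral>\<^sup>+x. ennreal B * ennreal \<bar>h x\<bar> \<partial>M)"
    proof (intro nn_integral_mono)
      fix x
      have "(\<integral>\<^sup>+y. ennreal (norm (?g x y)) \<partial>lborel) \<le> (\<integral>\<^sup>+y. ennreal (B * \<bar>h x\<bar>) * ennreal (heat_kernel s (- x + 1 *\<^sub>R y)) \<partial>lborel)"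
      proof (intro nn_integral_mono)
        fix y
        have "norm (?g x y) = \<bar>\<phi> y\<bar> * (heat_kernel s (y - x) * \<bar>h x\<bar>)" by (simp add: abs_mult)
        also have "\<dots> \<le> B * (heat_kernel s (y - x) * \<bar>h x\<bar>)"
          using B by (intro mult_right_mono) auto
        finally show "ennreal (norm (?g x y)) \<le> ennreal (B * \<bar>h x\<bar>) * ennreal (heat_kernel s (- x + 1 *\<^sub>R y))"
          using B0 by (simp add: ennreal_mult'[symmetric] ennreal_leI mult_ac)
      qed
      also have "\<dots> = ennreal (B * \<bar>h x\<bar>) * (\<integral>\<^sup>+y. ennreal (heat_kernel s (- x + 1 *\<^sub>R y)) \<partial>lborel)"
        by (rule nn_integral_cmult) simp
      also have "(\<integral>\<^sup>+y. ennreal (heat_kernel s (- x + 1 *\<^sub>R y)) \<partial>lborel) = (\<integral>\<^sup>+y. ennreal (heat_kernel s y) \<partial>(lborel::(real^'n) measure))"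
        by (subst lborel_nn_integral_affine_euclidean[where c = 1 and t = "- x"]) auto
      also have "\<dots> = 1"
        using s by (subst nn_integral_eq_integral) (auto simp: integrable_heat_kernel integral_heat_kernel)
      finally show "(\<integral>\<^sup>+y. ennreal (norm (?g x y)) \<partial>lborel) \<le> ennreal B * ennreal \<bar>h x\<bar>"
        using B0 by (simp add: ennreal_mult'[symmetric])
    qed
    also have "\<dots> < \<infinity>"
      using h by (subst nn_integral_cmult) (auto simp: integrable_iff_bounded ennreal_mult_less_top)
    finally show "(\<integral>\<^sup>+p. ennreal (norm (case p of (x, y) \<Rightarrow> ?g x y)) \<partial>(M \<Otimes>\<^sub>M lborel)) < \<infinity>" .
  qed measurable
  have "(\<integral>x. (\<integral>z. \<phi> (x + sqrt s *\<^sub>R z) * heat_kernel 1 z \<partial>lborel) * h x \<partial>M) = (\<integral>x. \<integral>y. ?g x y \<partial>lborel \<partial>M)"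
    unfolding A by simp
  also have "\<dots> = (\<integral>y. \<integral>x. ?g x y \<partial>M \<partial>lborel)"
    by (rule Fubini_integral[OF int, symmetric])
  also have "\<dots> = (\<integral>y. \<phi> y * (\<integral>x. heat_kernel s (y - x) * h x \<partial>M) \<partial>lborel)"
    by (simp add: mult.assoc)
  finally show ?thesis .
qed

lemma smoothing_tendsto:
  fixes M :: "(real ^ 'n) measure" and h \<phi> :: "real ^ 'n \<Rightarrow> real"
  assumes sets [measurable_cong]: "sets M = sets borel"
    and h: "integrable M h"
    and cont: "continuous_on UNIV \<phi>" and B: "\<And>x. \<bar>\<phi> x\<bar> \<le> B"
  shows "(\<lambda>m. \<integral>x. (\<integral>z. \<phi> (x + sqrt (1 / real (Suc m)) *\<^sub>R z) * heat_kernel 1 z \<partial>lborel) * h x \<partial>M)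
    \<longlonglongrightarrow> (\<integral>x. \<phi> x * h x \<partial>M)"
proof -
  have [measurable]: "\<phi> \<in> borel_measurable borel" using cont by (rule borel_measurable_continuous_onI)
  have [measurable]: "h \<in> borel_measurable borel"
    using h sets by (simp add: integrable_iff_bounded cong: measurable_cong_sets)
  have B0: "0 \<le> B" using B[of 0] by linarith
  have ihk: "integrable lborel (\<lambda>z::real^'n. B * heat_kernel 1 z)"
    by (simp add: integrable_heat_kernel)
  let ?A = "\<lambda>m x. \<integral>z. \<phi> (x + sqrt (1 / real (Suc m)) *\<^sub>R z) * heat_kernel 1 z \<partial>lborel"
  have lim: "(\<lambda>m. ?A m x) \<longlonglongrightarrow> \<phi> x" for x
  proof -
    have "(\<lambda>m. ?A m x) \<longlonglongrightarrow> (\<integral>z. \<phi> x * heat_kernel 1 (z::real^'n) \<partial>lborel)"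
    proof (rule integral_dominated_convergence[where w = "\<lambda>z::real^'n. B * heat_kernel 1 z"])
      show "AE z in lborel. (\<lambda>m. \<phi> (x + sqrt (1 / real (Suc m)) *\<^sub>R z) * heat_kernel 1 z) \<longlonglongrightarrow> \<phi> x * heat_kernel 1 z"
      proof (rule AE_I2)
        fix z :: "real^'n"
        have "(\<lambda>m. sqrt (1 / real (Suc m))) \<longlonglongrightarrow> sqrt 0"
          by (rule tendsto_real_sqrt[OF LIMSEQ_Suc[OF lim_1_over_n]])
        then have "(\<lambda>m. x + sqrt (1 / real (Suc m)) *\<^sub>R z) \<longlonglongrightarrow> x + sqrt 0 *\<^sub>R z"
          by (intro tendsto_add tendsto_scaleR tendsto_const)
        then have "(\<lambda>m. x + sqrt (1 / real (Suc m)) *\<^sub>R z) \<longlonglongrightarrow> x" by simp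
        moreover have "isCont \<phi> x" using cont by (simp add: continuous_on_eq_continuous_at)
        ultimately have "(\<lambda>m. \<phi> (x + sqrt (1 / real (Suc m)) *\<^sub>R z)) \<longlonglongrightarrow> \<phi> x"
          by (rule isCont_tendsto_compose[rotated])
        then show "(\<lambda>m. \<phi> (x + sqrt (1 / real (Suc m)) *\<^sub>R z) * heat_kernel 1 z) \<longlonglongrightarrow> \<phi> x * heat_kernel 1 z"
          by (intro tendsto_intros)
      qed
      show "AE z in lborel. norm (\<phi> (x + sqrt (1 / real (Suc m)) *\<^sub>R z) * heat_kernel 1 z) \<le> B * heat_kernel 1 z" for m
        using B by (intro AE_I2) (auto simp: abs_mult intro!: mult_right_mono)
      show "integrable lborel (\<lambda>z. B * heat_kernel 1 (z::real^'n))" by (rule ihk)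
    qed measurable
    then show ?thesis by (simp add: integral_heat_kernel)
  qed
  have bd: "\<bar>?A m x\<bar> \<le> B" for m x
  proof -
    have "norm (?A m x) \<le> (\<integral>z. B * heat_kernel 1 (z::real^'n) \<partial>lborel)"
    proof (rule Bochner_Integration.integral_norm_bound_integral[OF _ ihk])
      show "integrable lborel (\<lambda>z. \<phi> (x + sqrt (1 / real (Suc m)) *\<^sub>R z) * heat_kernel 1 z)"
        by (rule Bochner_Integration.integrable_bound[OF ihk])
           (use B B0 in \<open>auto simp: abs_mult intro!: mult_right_mono\<close>)
    qed (use B in \<open>auto simp: abs_mult intro!: mult_right_mono\<close>)
    then show ?thesis by (simp add: integral_heat_kernel)
  qed
  show ?thesis
  proof (rule integral_dominated_convergence[where w = "\<lambda>x. B * \<bar>h x\<bar>"])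
    show "integrable M (\<lambda>x. B * \<bar>h x\<bar>)" using h by simp
    show "AE x in M. (\<lambda>m. ?A m x * h x) \<longlonglongrightarrow> \<phi> x * h x"
      using lim by (intro AE_I2 tendsto_intros)
    show "AE x in M. norm (?A m x * h x) \<le> B * \<bar>h x\<bar>" for m
      using bd by (intro AE_I2) (auto simp: abs_mult intro!: mult_right_mono)
  qed measurable
qed

text \<open>Two finite signed measures \<open>h1 M1\<close> and \<open>h2 M2\<close> with the same Fourier transform have the same
  Gaussian smoothings, by \<open>smoothing_fourier\<close>, and the smoothing is removed by letting its width tend to
  zero. The single point \<open>\<xi> = 0\<close> may be left out because it is a null set; the mixture formula is
  available only for \<open>w > 0\<close>, so this matters below. Allowing densities \<open>h\<close> of either sign makes the
  lemma applicable to the mixture of Gaussians before its positivity is known.\<close>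

theorem fourier_determines_integrals:
  fixes M1 M2 :: "(real ^ 'n) measure" and h1 h2 \<phi> :: "real ^ 'n \<Rightarrow> real"
  assumes "sigma_finite_measure M1" "sets M1 = sets borel" "integrable M1 h1"
    and "sigma_finite_measure M2" "sets M2 = sets borel" "integrable M2 h2"
    and eq: "\<And>\<xi>. \<xi> \<noteq> 0 \<Longrightarrow> (\<integral>x. exp (\<i> * complex_of_real (\<xi> \<bullet> x)) * complex_of_real (h1 x) \<partial>M1)
            = (\<integral>x. exp (\<i> * complex_of_real (\<xi> \<bullet> x)) * complex_of_real (h2 x) \<partial>M2)"
    and cont: "continuous_on UNIV \<phi>" and B: "\<And>x. \<bar>\<phi> x\<bar> \<le> B"
  shows "(\<integral>x. \<phi> x * h1 x \<partial>M1) = (\<integral>x. \<phi> x * h2 x \<partial>M2)"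
proof -
  have [measurable]: "\<phi> \<in> borel_measurable borel" using cont by (rule borel_measurable_continuous_onI)
  have smooth: "(\<integral>x. heat_kernel s (y - x) * h1 x \<partial>M1) = (\<integral>x. heat_kernel s (y - x) * h2 x \<partial>M2)" if s: "0 < s" for s y
  proof -
    let ?F = "\<lambda>M h \<xi>. \<integral>x. exp (\<i> * complex_of_real (- \<xi> \<bullet> x)) * complex_of_real (h x) \<partial>M"
    have m: "?F M h \<in> borel_measurable borel"
      if "sigma_finite_measure M" "sets M = sets borel" "integrable M h" for M and h :: "real^'n \<Rightarrow> real"
    proof -
      interpret sigma_finite_measure M by fact
      note that(2) [measurable_cong]
      have [measurable]: "h \<in> borel_measurable borel"
        using that by (simp add: integrable_iff_bounded cong: measurable_cong_sets)
      show ?thesis by measurable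
    qed
    have "AE \<xi> in lborel. ?F M1 h1 \<xi> = ?F M2 h2 \<xi>"
      using AE_lborel_singleton[of 0] by eventually_elim (rule eq, simp)
    then have "(\<integral>\<xi>. complex_of_real (heat_kernel (1 / (4 * s)) \<xi>) * exp (\<i> * complex_of_real (\<xi> \<bullet> y)) * ?F M1 h1 \<xi> \<partial>lborel)
      = (\<integral>\<xi>. complex_of_real (heat_kernel (1 / (4 * s)) \<xi>) * exp (\<i> * complex_of_real (\<xi> \<bullet> y)) * ?F M2 h2 \<xi> \<partial>lborel)"
      using m[OF assms(1-3)] m[OF assms(4-6)] by (intro integral_cong_AE) auto
    then have "complex_of_real (\<integral>x. heat_kernel s (y - x) * h1 x \<partial>M1) = complex_of_real (\<integral>x. heat_kernel s (y - x) * h2 x \<partial>M2)"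
      unfolding smoothing_fourier[OF assms(1-3) s] smoothing_fourier[OF assms(4-6) s] by (simp only:)
    then show ?thesis by (simp only: of_real_eq_iff)
  qed
  have "(\<integral>x. (\<integral>z. \<phi> (x + sqrt (1 / real (Suc m)) *\<^sub>R z) * heat_kernel 1 z \<partial>lborel) * h1 x \<partial>M1)
     = (\<integral>x. (\<integral>z. \<phi> (x + sqrt (1 / real (Suc m)) *\<^sub>R z) * heat_kernel 1 z \<partial>lborel) * h2 x \<partial>M2)" for m
    by (subst integral_smoothing_swap[OF assms(1-3) _ _ B], simp, simp,
        subst integral_smoothing_swap[OF assms(4-6) _ _ B], simp, simp, subst smooth, simp_all)
  then show ?thesis
    using smoothing_tendsto[OF assms(2,3) cont B] smoothing_tendsto[OF assms(5,6) cont B]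
    by (simp add: LIMSEQ_unique)
qed

section \<open>The stable density as a radial profile\<close>
lemma emeasure_lborel_ball_nonzero:
  fixes y :: "real ^ 'n"
  assumes "0 < \<delta>"
  shows "emeasure lborel (ball y \<delta>) \<noteq> 0"
proof -
  have "unit_ball_vol (real CARD('n)) \<noteq> 0"
    using unit_ball_vol_pos[of "real CARD('n)"] by (metis less_irrefl of_nat_0_le_iff)
  then show ?thesis using assms by (simp add: emeasure_ball)
qed

text \<open>The mixture of heat kernels with the weight that represents \<open>exp (- w powr \<alpha>)\<close>: at \<open>r = |x|\<close> this is
  the density of the stable law at \<open>x \<noteq> 0\<close>, see \<open>stable_density_eq_profile\<close>.\<close>

definition stable_profile :: "nat \<Rightarrow> real \<Rightarrow> real \<Rightarrow> real" where
  "stable_profile d \<alpha> r = (\<integral>p. mix_weight \<alpha> p * heat_profile d (fst p) r \<partial>(halfline \<Otimes>\<^sub>M halfline))"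

lemma measurable_stable_profile [measurable]: "stable_profile d \<alpha> \<in> borel_measurable borel"
proof -
  interpret sigma_finite_measure "halfline \<Otimes>\<^sub>M halfline" ..
  show ?thesis unfolding stable_profile_def[abs_def] by measurable
qed

text \<open>Fubini moves the Fourier integral inside the mixture, where it turns each heat kernel into
  \<open>exp (- s |\<xi>|\<^sup>2)\<close>; the mixture then collapses by \<open>mix_weight_laplace\<close>.\<close>

lemma
  fixes \<xi> :: "real ^ 'n"
  assumes \<alpha>: "0 < \<alpha>" "\<alpha> < 1"
  shows integrable_stable_profile: "integrable lborel (\<lambda>x::real^'n. stable_profile CARD('n) \<alpha> (norm x))"
    and fourier_stable_profile: "\<xi> \<noteq> 0 \<Longrightarrow>
      (\<integral>x. exp (\<i> * complex_of_real (\<xi> \<bullet> x)) * complex_of_real (stable_profile CARD('n) \<alpha> (norm x)) \<partial>lborel)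
        = complex_of_real (exp (- (norm \<xi> powr \<alpha>)))"
proof -
  let ?P = "halfline \<Otimes>\<^sub>M halfline"
  interpret pair_sigma_finite ?P "lborel :: (real^'n) measure" ..
  let ?f = "\<lambda>p (x::real^'n). mix_weight \<alpha> p * heat_kernel (fst p) x"
  have hk: "(\<integral>\<^sup>+x. ennreal (heat_kernel s x) \<partial>(lborel::(real^'n) measure)) = 1" if "0 < s" for s
    using that by (subst nn_integral_eq_integral) (auto simp: integrable_heat_kernel integral_heat_kernel)
  have int: "integrable (?P \<Otimes>\<^sub>M lborel) (\<lambda>(p, x). ?f p x)"
  proof (rule integrableI_bounded)
    have "(\<integral>\<^sup>+q. ennreal (norm (case q of (p, x) \<Rightarrow> ?f p x)) \<partial>(?P \<Otimes>\<^sub>M lborel))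
       = (\<integral>\<^sup>+p. \<integral>\<^sup>+x. ennreal (norm (?f p x)) \<partial>lborel \<partial>?P)"
      by (subst lborel.nn_integral_fst[symmetric]) auto
    also have "\<dots> = (\<integral>\<^sup>+p. ennreal (norm (mix_weight \<alpha> p)) \<partial>?P)"
    proof (rule nn_integral_cong_AE)
      show "AE p in ?P. (\<integral>\<^sup>+x. ennreal (norm (?f p x)) \<partial>lborel) = ennreal (norm (mix_weight \<alpha> p))"
        using AE_halfline_pair
      proof eventually_elim
        case (elim p)
        then show ?case
          by (simp add: abs_mult ennreal_mult' nn_integral_cmult hk)
      qed
    qed
    also have "\<dots> < \<infinity>" using integrable_mix_weight[OF \<alpha>] by (simp add: integrable_iff_bounded)
    finally show "(\<integral>\<^sup>+q. ennreal (norm (case q of (p, x) \<Rightarrow> ?f p x)) \<partial>(?P \<Otimes>\<^sub>M lborel)) < \<infinity>" .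
  qed measurable
  have sp: "stable_profile CARD('n) \<alpha> (norm x) = (\<integral>p. ?f p x \<partial>?P)" for x :: "real^'n"
    by (simp add: stable_profile_def heat_kernel_def)
  show "integrable lborel (\<lambda>x::real^'n. stable_profile CARD('n) \<alpha> (norm x))"
    unfolding sp by (rule integrable_snd[OF int])
  assume \<xi>: "\<xi> \<noteq> 0"
  let ?e = "\<lambda>x. exp (\<i> * complex_of_real (\<xi> \<bullet> x))"
  have int': "integrable (?P \<Otimes>\<^sub>M lborel) (\<lambda>(p, x). ?e x * complex_of_real (?f p x))"
    by (rule Bochner_Integration.integrable_bound[OF int]) (auto simp: norm_mult case_prod_beta)
  have "(\<integral>x. ?e x * complex_of_real (stable_profile CARD('n) \<alpha> (norm x)) \<partial>lborel)
     = (\<integral>x. \<integral>p. ?e x * complex_of_real (?f p x) \<partial>?P \<partial>lborel)"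
  proof (intro Bochner_Integration.integral_cong refl)
    fix x :: "real^'n"
    have "complex_of_real (stable_profile CARD('n) \<alpha> (norm x)) = (\<integral>p. complex_of_real (?f p x) \<partial>?P)"
      unfolding sp by (rule integral_complex_of_real[symmetric])
    then show "?e x * complex_of_real (stable_profile CARD('n) \<alpha> (norm x)) = (\<integral>p. ?e x * complex_of_real (?f p x) \<partial>?P)"
      by (simp only: integral_mult_right_zero)
  qed
  also have "\<dots> = (\<integral>p. \<integral>x. ?e x * complex_of_real (?f p x) \<partial>lborel \<partial>?P)"
    by (rule Fubini_integral[OF int'])
  also have "\<dots> = (\<integral>p. complex_of_real (mix_weight \<alpha> p * exp (- (fst p * (norm \<xi>)\<^sup>2))) \<partial>?P)"
  proof (rule integral_cong_AE)
    show "AE p in ?P. (\<integral>x. ?e x * complex_of_real (?f p x) \<partial>lborel) = complex_of_real (mix_weight \<alpha> p * exp (- (fst p * (norm \<xi>)\<^sup>2)))"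
      using AE_halfline_pair
    proof eventually_elim
      case (elim p)
      have "(\<integral>x. ?e x * complex_of_real (?f p x) \<partial>lborel)
         = (\<integral>x. complex_of_real (mix_weight \<alpha> p) * (complex_of_real (heat_kernel (fst p) x) * ?e x) \<partial>lborel)"
        by (intro Bochner_Integration.integral_cong refl) (simp add: mult_ac)
      also have "\<dots> = complex_of_real (mix_weight \<alpha> p) * complex_of_real (exp (- (fst p * (norm \<xi>)\<^sup>2)))"
        using elim by (subst integral_mult_right_zero, subst fourier_heat_kernel) auto
      finally show ?case by simp
    qed
  qed measurable
  also have "\<dots> = complex_of_real (exp (- (norm \<xi> powr \<alpha>)))"
    using mix_weight_laplace[OF \<alpha>, of "norm \<xi>"] \<xi> by (subst integral_complex_of_real) simp
  finally show "(\<integral>x. ?e x * complex_of_real (stable_profile CARD('n) \<alpha> (norm x)) \<partial>lborel) = \<dots>" .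
qed

lemma stable_profile_series:
  assumes d: "0 < d" and r: "0 < r" and \<alpha>: "0 < \<alpha>" "\<alpha> < 1"
  shows "summable (\<lambda>n. \<bar>a_coeff d \<alpha> n\<bar> * r powr (- real d - real n * \<alpha>))"
    and "(\<lambda>n. a_coeff d \<alpha> n * r powr (- real d - real n * \<alpha>)) sums stable_profile d \<alpha> r"
  using gaussian_mixture_series[OF assms] by (simp_all add: stable_profile_def)

text \<open>The series is \<open>r powr (- d)\<close> times a power series in \<open>r powr (- \<alpha>)\<close> that converges everywhere.\<close>

lemma continuous_on_stable_profile:
  assumes d: "0 < d" and \<alpha>: "0 < \<alpha>" "\<alpha> < 1"
  shows "continuous_on {0<..} (stable_profile d \<alpha>)"
proof -
  let ?a = "a_coeff d \<alpha>"
  have pw: "r powr (- real d - real n * \<alpha>) = r powr (- real d) * (r powr (- \<alpha>)) ^ n" if "0 < r" for r n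
  proof -
    have "(r powr (- \<alpha>)) ^ n = r powr (- \<alpha> * real n)"
      using that powr_realpow[of "r powr (- \<alpha>)" n] by (simp add: powr_powr)
    then show ?thesis by (simp add: powr_add[symmetric] mult.commute)
  qed
  have summ: "summable (\<lambda>n. ?a n * x ^ n)" if x: "0 < x" for x
  proof -
    define r where "r = x powr (- 1 / \<alpha>)"
    have r: "0 < r" "r powr (- \<alpha>) = x" using x \<alpha> by (simp_all add: r_def powr_powr)
    have "summable (\<lambda>n. r powr real d * (?a n * r powr (- real d - real n * \<alpha>)))"
      using stable_profile_series(2)[OF d r(1) \<alpha>] by (intro summable_mult) (simp add: sums_iff)
    moreover have "r powr real d * (?a n * r powr (- real d - real n * \<alpha>)) = ?a n * x ^ n" for n
    proof -
      have "r powr real d * r powr (- real d) = 1" using r by (simp add: powr_minus)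
      then have "(r powr real d * r powr (- real d)) * (?a n * x ^ n) = ?a n * x ^ n" by simp
      then show ?thesis unfolding pw[OF r(1)] r(2) by (simp only: mult_ac)
    qed
    ultimately show ?thesis by simp
  qed
  have cont: "isCont (\<lambda>x. \<Sum>n. ?a n * x ^ n) x" if "0 < x" for x
    by (rule isCont_powser[OF summ[of "x + 1"]]) (use that in auto)
  have "continuous_on {0<..} (\<lambda>r. r powr (- real d) * (\<Sum>n. ?a n * (r powr (- \<alpha>)) ^ n))"
  proof (rule continuous_on_mult)
    show "continuous_on {0<..} (\<lambda>r. \<Sum>n. ?a n * (r powr (- \<alpha>)) ^ n)"
      by (rule continuous_on_compose2[of "{0<..}" "\<lambda>x. \<Sum>n. ?a n * x ^ n"])
         (auto intro!: continuous_at_imp_continuous_on cont continuous_intros)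
  qed (auto intro!: continuous_intros)
  then show ?thesis
  proof (rule continuous_on_eq)
    fix r :: real assume "r \<in> {0<..}"
    then have that: "0 < r" by simp
    have "stable_profile d \<alpha> r = (\<Sum>n. ?a n * r powr (- real d - real n * \<alpha>))"
      using stable_profile_series(2)[OF d that \<alpha>] by (simp add: sums_iff)
    also have "\<dots> = (\<Sum>n. r powr (- real d) * (?a n * (r powr (- \<alpha>)) ^ n))"
      unfolding pw[OF that] by (simp only: mult_ac)
    also have "\<dots> = r powr (- real d) * (\<Sum>n. ?a n * (r powr (- \<alpha>)) ^ n)"
      using that by (intro suminf_mult summ) simp
    finally show "r powr (- real d) * (\<Sum>n. ?a n * (r powr (- \<alpha>)) ^ n) = stable_profile d \<alpha> r" ..
  qed
qed

lemma stable_measure_integral: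
  fixes \<mu> :: "(real ^ 'n) measure" and \<phi> :: "real ^ 'n \<Rightarrow> real"
  assumes \<alpha>: "0 < \<alpha>" "\<alpha> < 1" and "prob_space \<mu>" and sets: "sets \<mu> = sets borel"
    and cf: "\<And>\<xi>. (\<integral>x. exp (\<i> * complex_of_real (\<xi> \<bullet> x)) \<partial>\<mu>) = complex_of_real (exp (- (norm \<xi> powr \<alpha>)))"
    and cont: "continuous_on UNIV \<phi>" and B: "\<And>x. \<bar>\<phi> x\<bar> \<le> B"
  shows "(\<integral>x. \<phi> x \<partial>\<mu>) = (\<integral>x. \<phi> x * stable_profile CARD('n) \<alpha> (norm x) \<partial>lborel)"
proof -
  interpret prob_space \<mu> by fact
  have "(\<integral>x. \<phi> x * 1 \<partial>\<mu>) = (\<integral>x. \<phi> x * stable_profile CARD('n) \<alpha> (norm x) \<partial>lborel)"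
  proof (rule fourier_determines_integrals[OF _ sets _ sigma_finite_lborel _ integrable_stable_profile[OF \<alpha>] _ cont B])
    show "sigma_finite_measure \<mu>" ..
    fix \<xi> :: "real^'n" assume "\<xi> \<noteq> 0"
    then show "(\<integral>x. exp (\<i> * complex_of_real (\<xi> \<bullet> x)) * complex_of_real 1 \<partial>\<mu>)
      = (\<integral>x. exp (\<i> * complex_of_real (\<xi> \<bullet> x)) * complex_of_real (stable_profile CARD('n) \<alpha> (norm x)) \<partial>lborel)"
      using cf[of \<xi>] fourier_stable_profile[OF \<alpha>, of \<xi>] by simp
  qed auto
  then show ?thesis by simp
qed

text \<open>Self-similarity: the image of \<open>p t\<close> under the dilation by \<open>t powr (- 1 / \<alpha>)\<close> has the Fourier
  transform \<open>exp (- |\<xi>| powr \<alpha>)\<close>, and so has the signed measure whose density is the profile.\<close>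

lemma stable_semigroup_integral:
  fixes p :: "real \<Rightarrow> (real ^ 'n) measure" and \<phi> :: "real ^ 'n \<Rightarrow> real"
  assumes \<alpha>: "0 < \<alpha>" "\<alpha> < 1" and p: "stable_semigroup \<alpha> p" and t: "0 < t"
    and cont: "continuous_on UNIV \<phi>" and B: "\<And>x. \<bar>\<phi> x\<bar> \<le> B"
  shows "(\<integral>x. \<phi> x \<partial>p t) = (\<integral>x. \<phi> (t powr (1 / \<alpha>) *\<^sub>R x) * stable_profile CARD('n) \<alpha> (norm x) \<partial>lborel)"
proof -
  have sets [measurable_cong]: "sets (p t) = sets borel" and "prob_space (p t)"
    and cf: "(\<integral>x. exp (\<i> * complex_of_real (\<xi> \<bullet> x)) \<partial>p t) = complex_of_real (exp (- t * norm \<xi> powr \<alpha>))" for \<xi>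
    using p t by (simp_all add: stable_semigroup_def)
  interpret prob_space "p t" by fact
  have [measurable]: "\<phi> \<in> borel_measurable borel" using cont by (rule borel_measurable_continuous_onI)
  define c where "c = t powr (1 / \<alpha>)"
  have c: "0 < c" "c powr \<alpha> = t" using t \<alpha> by (simp_all add: c_def powr_powr)
  let ?\<mu> = "distr (p t) borel (\<lambda>x. (1 / c) *\<^sub>R x)"
  have "(\<integral>x. \<phi> (c *\<^sub>R x) \<partial>?\<mu>) = (\<integral>x. \<phi> (c *\<^sub>R x) * stable_profile CARD('n) \<alpha> (norm x) \<partial>lborel)"
  proof (rule stable_measure_integral[OF \<alpha>])
    show "prob_space ?\<mu>" by (rule prob_space_distr) simp
    show "sets ?\<mu> = sets borel" by simp
    show "continuous_on UNIV (\<lambda>x. \<phi> (c *\<^sub>R x))"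
      by (rule continuous_on_compose2[OF cont]) (auto intro!: continuous_intros)
    show "\<bar>\<phi> (c *\<^sub>R x)\<bar> \<le> B" for x by (rule B)
    fix \<xi> :: "real^'n"
    have "(\<integral>x. exp (\<i> * complex_of_real (\<xi> \<bullet> x)) \<partial>?\<mu>) = (\<integral>x. exp (\<i> * complex_of_real (((1 / c) *\<^sub>R \<xi>) \<bullet> x)) \<partial>p t)"
      by (subst integral_distr) auto
    also have "\<dots> = complex_of_real (exp (- t * norm ((1 / c) *\<^sub>R \<xi>) powr \<alpha>))" by (rule cf)
    also have "t * norm ((1 / c) *\<^sub>R \<xi>) powr \<alpha> = norm \<xi> powr \<alpha>"
      using c t by (simp add: powr_divide)
    then have "exp (- t * norm ((1 / c) *\<^sub>R \<xi>) powr \<alpha>) = exp (- (norm \<xi> powr \<alpha>))" by simp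
    finally show "(\<integral>x. exp (\<i> * complex_of_real (\<xi> \<bullet> x)) \<partial>?\<mu>) = complex_of_real (exp (- (norm \<xi> powr \<alpha>)))" .
  qed
  moreover have "(\<integral>x. \<phi> (c *\<^sub>R x) \<partial>?\<mu>) = (\<integral>x. \<phi> x \<partial>p t)"
    using c by (subst integral_distr) auto
  ultimately show ?thesis by (simp add: c_def)
qed

text \<open>Both functions are continuous off the origin and integrate every bounded continuous function to the
  same value. If they differed at \<open>y\<close>, a tent function supported near \<open>y\<close> would tell them apart.\<close>

lemma stable_density_eq_profile:
  fixes p :: "real \<Rightarrow> (real ^ 'n) measure" and p1 :: "real ^ 'n \<Rightarrow> real"
  assumes \<alpha>: "0 < \<alpha>" "\<alpha> < 1" and p: "stable_semigroup \<alpha> p" and p1: "continuous_density (p 1) p1"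
    and y: "y \<noteq> 0"
  shows "p1 y = stable_profile CARD('n) \<alpha> (norm y)"
proof (rule ccontr)
  let ?q = "\<lambda>x::real^'n. stable_profile CARD('n) \<alpha> (norm x)"
  assume neq: "p1 y \<noteq> ?q y"
  have cp: "continuous_on UNIV p1" and pnn: "\<And>x. 0 \<le> p1 x" and dens: "p 1 = density lborel (\<lambda>x. ennreal (p1 x))"
    using p1 by (auto simp: continuous_density_def)
  have [measurable]: "p1 \<in> borel_measurable borel" using cp by (rule borel_measurable_continuous_onI)
  define \<sigma> where "\<sigma> = sgn (p1 y - ?q y)"
  have \<sigma>: "\<sigma> \<noteq> 0" "0 < \<sigma> * (p1 y - ?q y)" using neq by (auto simp: \<sigma>_def sgn_if)
  have d: "0 < CARD('n)" by simp
  have co: "continuous_on (- {0}) (\<lambda>x. \<sigma> * (p1 x - ?q x))"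
    by (intro continuous_intros continuous_on_subset[OF cp]
        continuous_on_compose2[OF continuous_on_stable_profile[OF d \<alpha>]]) auto
  then have "isCont (\<lambda>x. \<sigma> * (p1 x - ?q x)) y"
    using y continuous_on_eq_continuous_at[of "- {0::real^'n}"] by auto
  from order_tendstoD(1)[OF this[unfolded isCont_def] \<sigma>(2)]
  have "\<forall>\<^sub>F x in nhds y. 0 < \<sigma> * (p1 x - ?q x)"
    using \<sigma>(2) by (simp add: eventually_nhds_conv_at)
  then obtain \<delta> where \<delta>: "0 < \<delta>" "\<And>x. dist x y < \<delta> \<Longrightarrow> 0 < \<sigma> * (p1 x - ?q x)"
    by (auto simp: eventually_nhds_metric)
  let ?\<phi> = "\<lambda>x. max 0 (\<delta> - dist x y)"
  have c\<phi>: "continuous_on UNIV ?\<phi>" by (intro continuous_intros)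
  have b\<phi>: "\<bar>?\<phi> x\<bar> \<le> \<delta>" for x using \<delta>(1) by auto
  have "prob_space (p 1)" using p by (simp add: stable_semigroup_def)
  then have ip1: "integrable lborel p1"
    using pnn by (intro integrableI_bounded) (auto simp: dens emeasure_density dest!: prob_space.emeasure_space_1)
  have ints: "integrable lborel (\<lambda>x. ?\<phi> x * p1 x)" "integrable lborel (\<lambda>x. ?\<phi> x * ?q x)"
    by (rule Bochner_Integration.integrable_bound[OF integrable_mult_right[OF ip1, of \<delta>]],
        use b\<phi> \<delta> in \<open>auto simp: abs_mult intro!: mult_mono\<close>,
        rule Bochner_Integration.integrable_bound[OF integrable_mult_right[OF integrable_stable_profile[OF \<alpha>], of \<delta>]],
        use b\<phi> \<delta> in \<open>auto simp: abs_mult intro!: mult_mono\<close>)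
  have "(\<integral>x. ?\<phi> x * p1 x \<partial>lborel) = (\<integral>x. ?\<phi> x \<partial>p 1)"
    unfolding dens using pnn by (subst integral_density) (auto simp: mult.commute)
  also have "\<dots> = (\<integral>x. ?\<phi> x * ?q x \<partial>lborel)"
    using stable_semigroup_integral[OF \<alpha> p _ c\<phi> b\<phi>, of 1] by simp
  finally have zero: "(\<integral>x. \<sigma> * (?\<phi> x * p1 x - ?\<phi> x * ?q x) \<partial>lborel) = 0"
    using ints by simp
  have factor: "\<sigma> * (a * b - a * c) = a * (\<sigma> * (b - c))" for a b c
    by (simp add: algebra_simps)
  have nn: "0 \<le> \<sigma> * (?\<phi> x * p1 x - ?\<phi> x * ?q x)" for x
  proof (cases "dist x y < \<delta>")
    case True
    then show ?thesis unfolding factor using \<delta>(2)[OF True] by (intro mult_nonneg_nonneg[of "?\<phi> x"]) auto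
  qed simp
  have "AE x in lborel. \<sigma> * (?\<phi> x * p1 x - ?\<phi> x * ?q x) = 0"
    using zero nn ints by (subst (asm) integral_nonneg_eq_0_iff_AE) auto
  then have "AE x in lborel. x \<notin> ball y \<delta>"
  proof eventually_elim
    case (elim x)
    show ?case
    proof
      assume "x \<in> ball y \<delta>"
      then have "0 < ?\<phi> x * (\<sigma> * (p1 x - ?q x))"
        using \<delta>(2)[of x] by (intro mult_pos_pos[of "?\<phi> x"]) (auto simp: dist_commute)
      then show False using elim unfolding factor by simp
    qed
  qed
  then have "emeasure lborel (ball y \<delta>) = 0"
    by (subst (asm) AE_iff_measurable[of "ball y \<delta>"]) auto
  then show False using emeasure_lborel_ball_nonzero[OF \<delta>(1), of y] by simp
qed

section \<open>Polar integration against radial kernels\<close>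
lemma distr_heat_kernel_projection:
  fixes a :: "real ^ 'n"
  assumes s: "0 < s" and a: "a \<noteq> 0"
  shows "distr (density lborel (\<lambda>z. ennreal (heat_kernel s z))) borel (\<lambda>z. a \<bullet> z)
    = density lborel (normal_density 0 (norm a * sqrt (2 * s)))"
proof (rule Levy_uniqueness)
  let ?M = "density lborel (\<lambda>z::real^'n. ennreal (heat_kernel s z))"
  let ?\<sigma> = "norm a * sqrt (2 * s)"
  have \<sigma>: "0 < ?\<sigma>" using s a by simp
  have "prob_space ?M"
    by (rule prob_spaceI) (simp add: emeasure_density nn_integral_eq_integral integrable_heat_kernel[OF s] integral_heat_kernel[OF s])
  then show "real_distribution (distr ?M borel (\<lambda>z. a \<bullet> z))"
    by (intro real_distribution.intro real_distribution_axioms.intro prob_space.prob_space_distr) auto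
  show "real_distribution (density lborel (normal_density 0 ?\<sigma>))"
    by (intro real_distribution.intro real_distribution_axioms.intro prob_space_normal_density \<sigma>) auto
  show "char (distr ?M borel (\<lambda>z. a \<bullet> z)) = char (density lborel (normal_density 0 ?\<sigma>))"
  proof
    fix t
    have "char (distr ?M borel (\<lambda>z. a \<bullet> z)) t = (\<integral>z. exp (\<i> * complex_of_real ((t *\<^sub>R a) \<bullet> z)) \<partial>?M)"
      by (simp add: char_def integral_distr)
    also have "\<dots> = (\<integral>z. complex_of_real (heat_kernel s z) * exp (\<i> * complex_of_real ((t *\<^sub>R a) \<bullet> z)) \<partial>lborel)"
      by (subst integral_density) (auto simp: scaleR_conv_of_real)
    also have "\<dots> = complex_of_real (exp (- (s * (norm (t *\<^sub>R a))\<^sup>2)))"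
      by (rule fourier_heat_kernel[OF s])
    also have "s * (norm (t *\<^sub>R a))\<^sup>2 = ?\<sigma>\<^sup>2 * t\<^sup>2 / 2"
      using s by (simp add: power_mult_distrib)
    also have "complex_of_real (exp (- (?\<sigma>\<^sup>2 * t\<^sup>2 / 2)))
      = (\<integral>x. complex_of_real (normal_density 0 ?\<sigma> x) * exp (\<i> * complex_of_real (t * x)) \<partial>lborel)"
      by (rule integral_normal_density_char[OF \<sigma>, symmetric])
    also have "\<dots> = char (density lborel (normal_density 0 ?\<sigma>)) t"
      unfolding char_def by (subst integral_density) (auto simp: scaleR_conv_of_real)
    finally show "char (distr ?M borel (\<lambda>z. a \<bullet> z)) t = char (density lborel (normal_density 0 ?\<sigma>)) t" .
  qed
qed

text \<open>Under the heat kernel, \<open>a \<bullet> z\<close> is a centred normal variable with variance \<open>2 s |a|\<^sup>2\<close>.\<close>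

lemma nn_integral_abs_inner_heat_kernel:
  fixes a :: "real ^ 'n"
  assumes s: "0 < s"
  shows "(\<integral>\<^sup>+z. ennreal \<bar>a \<bullet> z\<bar> * ennreal (heat_kernel s z) \<partial>lborel) = ennreal (2 * norm a * sqrt (s / pi))"
proof (cases "a = 0")
  case False
  let ?M = "density lborel (\<lambda>z::real^'n. ennreal (heat_kernel s z))"
  let ?\<sigma> = "norm a * sqrt (2 * s)"
  have \<sigma>: "0 < ?\<sigma>" using s False by simp
  have "(\<integral>\<^sup>+z. ennreal \<bar>a \<bullet> z\<bar> * ennreal (heat_kernel s z) \<partial>lborel) = (\<integral>\<^sup>+z. ennreal \<bar>a \<bullet> z\<bar> \<partial>?M)"
    by (subst nn_integral_density) (auto simp: mult.commute)
  also have "\<dots> = (\<integral>\<^sup>+x. ennreal \<bar>x\<bar> \<partial>(distr ?M borel (\<lambda>z. a \<bullet> z)))"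
    by (subst nn_integral_distr) auto
  also have "\<dots> = (\<integral>\<^sup>+x. ennreal (normal_density 0 ?\<sigma> x * \<bar>x\<bar>) \<partial>lborel)"
    unfolding distr_heat_kernel_projection[OF s False]
    by (subst nn_integral_density) (auto simp: ennreal_mult')
  also have "\<dots> = ennreal (?\<sigma> * sqrt (2 / pi))"
    using normal_moment_abs_odd[OF \<sigma>, of 0 0] 
    by (subst nn_integral_eq_integral) (auto simp: has_bochner_integral_iff mult_ac)
  also have "?\<sigma> * sqrt (2 / pi) = 2 * norm a * sqrt (s / pi)"
    by (simp add: real_sqrt_mult real_sqrt_divide)
  finally show ?thesis .
qed simp

lemma nn_integral_halfline_scale:
  assumes [measurable]: "f \<in> borel_measurable borel" and c: "0 < c"
  shows "(\<integral>\<^sup>+x. f x \<partial>halfline) = ennreal c * (\<integral>\<^sup>+x. f (c * x) \<partial>halfline)"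
proof -
  have "(\<integral>\<^sup>+x. f x \<partial>halfline) = (\<integral>\<^sup>+x. f x * indicator {0<..} x \<partial>lborel)"
    by (rule nn_integral_halfline) simp
  also have "\<dots> = ennreal c * (\<integral>\<^sup>+x. f (c * x) * indicator {0<..} (c * x) \<partial>lborel)"
    using c by (subst nn_integral_real_affine[where c = c and t = 0]) auto
  also have "(\<integral>\<^sup>+x. f (c * x) * indicator {0<..} (c * x) \<partial>lborel) = (\<integral>\<^sup>+x. f (c * x) * indicator {0<..} x \<partial>lborel)"
    using c by (intro nn_integral_cong) (auto simp: indicator_def zero_less_mult_iff)
  also have "\<dots> = (\<integral>\<^sup>+x. f (c * x) \<partial>halfline)"
    by (rule nn_integral_halfline[symmetric]) simp
  finally show ?thesis .
qed

lemma polar_kernel_moment: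
  shows "(\<integral>\<^sup>+s. ennreal (heat_profile d (1/4) (1 / s) * (1 / s) ^ (d + 2)) \<partial>halfline)
     = ennreal (pi powr (- real d / 2) / 2 * Gamma ((real d + 1) / 2))"
proof (rule nn_integral_Gamma_substitution[where g = "\<lambda>s. 1 / s\<^sup>2" and g' = "\<lambda>s. - 2 / s ^ 3"])
  show "bij_betw (\<lambda>s. 1 / s\<^sup>2) {0<..} ({0<..}::real set)"
  proof (rule bij_betwI[of _ _ _ "\<lambda>x. 1 / sqrt x"])
    fix x :: real assume "x \<in> {0<..}"
    then show "1 / sqrt (1 / x\<^sup>2) = x" "1 / (1 / sqrt x)\<^sup>2 = x"
      by (auto simp: real_sqrt_divide power_divide)
  qed auto
  fix s :: real assume s: "0 < s"
  have e: "(1 / s\<^sup>2) powr ((real d + 1) / 2 - 1) * (1 / s ^ 3) = (1 / s) ^ (d + 2)"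
  proof -
    have e1: "1 / s\<^sup>2 = (1 / s) powr 2" using s by (simp add: powr_numeral power_divide)
    have e2: "1 / s ^ 3 = (1 / s) powr 3" using s by (simp add: powr_numeral power_divide)
    have e3: "(1 / s) ^ (d + 2) = (1 / s) powr (real (d + 2))" using s by (subst powr_realpow) auto
    have "2 * ((real d + 1) / 2 - 1) + 3 = real (d + 2)" by (simp add: diff_divide_distrib add_divide_distrib)
    then show ?thesis unfolding e1 e2 e3 powr_powr powr_add[symmetric] by (simp only:)
  qed
  have hp: "heat_profile d (1/4) (1 / s) = pi powr (- real d / 2) * exp (- (1 / s\<^sup>2))"
    by (simp add: heat_profile_def power_divide)
  have ab: "\<bar>- 2 / s ^ 3\<bar> = 2 * (1 / s ^ 3)" using s by simp
  show "heat_profile d (1/4) (1 / s) * (1 / s) ^ (d + 2) = pi powr (- real d / 2) / 2 *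
     (\<bar>- 2 / s ^ 3\<bar> * ((1 / s\<^sup>2) powr ((real d + 1) / 2 - 1) / exp (1 / s\<^sup>2)))"
    unfolding hp e[symmetric] ab by (simp add: exp_minus field_simps)
  have "((\<lambda>s. inverse (s ^ 2)) has_field_derivative - (inverse (s ^ 2) * (2 * s) * inverse (s ^ 2))) (at s)"
    using s by (auto intro!: derivative_eq_intros)
  moreover have "- (inverse (s ^ 2) * (2 * s) * inverse (s ^ 2)) = - 2 / s ^ 3"
    using s by (simp add: field_simps power2_eq_square power3_eq_cube)
  ultimately show "((\<lambda>s. 1 / s\<^sup>2) has_field_derivative - 2 / s ^ 3) (at s)"
    by (simp only: inverse_eq_divide)
qed auto

text \<open>Polar coordinates without a measure on the sphere: for \<open>w\<close> homogeneous of degree one, the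
  integral of \<open>w z * \<kappa> (norm z)\<close> is a constant depending on \<open>w\<close> times the integral of \<open>\<kappa> r * r^d\<close>, and the
  Gaussian \<open>\<kappa>\<close> identifies the constant. The proof evaluates the double integral of
  \<open>w z E(|z|) |z|^(d+1) \<kappa>(|z| s) s^d\<close> over \<open>z\<close> and \<open>s > 0\<close> in two ways, \<open>E\<close> being the Gaussian profile:
  the substitution \<open>r = |z| s\<close> in the inner variable gives the left-hand side, the substitution
  \<open>y = s z\<close> the right-hand side.\<close>

lemma homogeneous_radial_integral:
  fixes w :: "real ^ 'n \<Rightarrow> ennreal" and \<kappa> :: "real \<Rightarrow> ennreal"
  assumes [measurable]: "w \<in> borel_measurable borel" "\<kappa> \<in> borel_measurable borel"
    and hom: "\<And>c z. 0 < c \<Longrightarrow> w (c *\<^sub>R z) = ennreal c * w z"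
  shows "(\<integral>\<^sup>+z. w z * ennreal (heat_kernel (1/4) z) \<partial>lborel) * (\<integral>\<^sup>+r. \<kappa> r * ennreal (r ^ CARD('n)) \<partial>halfline)
    = ennreal (pi powr (- real CARD('n) / 2) / 2 * Gamma ((real CARD('n) + 1) / 2)) * (\<integral>\<^sup>+z. w z * \<kappa> (norm z) \<partial>lborel)"
proof -
  let ?d = "CARD('n)"
  interpret pair_sigma_finite halfline "lborel :: (real^'n) measure" ..
  let ?E = "\<lambda>r. ennreal (heat_profile ?d (1/4) r)"
  let ?K = "\<integral>\<^sup>+r. \<kappa> r * ennreal (r ^ ?d) \<partial>halfline"
  let ?T = "\<integral>\<^sup>+s. ennreal (heat_profile ?d (1/4) (1 / s) * (1 / s) ^ (?d + 2)) \<partial>halfline"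
  have K: "?K = (\<integral>\<^sup>+s. ennreal (norm z ^ (?d + 1)) * (\<kappa> (norm z * s) * ennreal (s ^ ?d)) \<partial>halfline)" if z: "z \<noteq> 0" for z :: "real^'n"
  proof -
    have "?K = ennreal (norm z) * (\<integral>\<^sup>+s. \<kappa> (norm z * s) * ennreal ((norm z * s) ^ ?d) \<partial>halfline)"
      using z by (intro nn_integral_halfline_scale) auto
    also have "\<dots> = (\<integral>\<^sup>+s. ennreal (norm z) * (\<kappa> (norm z * s) * ennreal ((norm z * s) ^ ?d)) \<partial>halfline)"
      by (rule nn_integral_cmult[symmetric]) simp
    also have "\<dots> = (\<integral>\<^sup>+s. ennreal (norm z ^ (?d + 1)) * (\<kappa> (norm z * s) * ennreal (s ^ ?d)) \<partial>halfline)"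
      by (intro nn_integral_halfline_cong) (simp add: power_mult_distrib ennreal_mult mult_ac)
    finally show ?thesis .
  qed
  have T: "(\<integral>\<^sup>+s. ennreal (heat_profile ?d (1/4) (norm y / s) * (norm y / s) ^ (?d + 1) / s) \<partial>halfline) = ?T" if y: "y \<noteq> 0" for y :: "real^'n"
  proof -
    have "(\<integral>\<^sup>+s. ennreal (heat_profile ?d (1/4) (norm y / s) * (norm y / s) ^ (?d + 1) / s) \<partial>halfline)
       = ennreal (norm y) * (\<integral>\<^sup>+s. ennreal (heat_profile ?d (1/4) (norm y / (norm y * s)) * (norm y / (norm y * s)) ^ (?d + 1) / (norm y * s)) \<partial>halfline)"
      using y by (intro nn_integral_halfline_scale) auto
    also have "\<dots> = (\<integral>\<^sup>+s. ennreal (norm y) * ennreal (heat_profile ?d (1/4) (norm y / (norm y * s)) * (norm y / (norm y * s)) ^ (?d + 1) / (norm y * s)) \<partial>halfline)"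
      by (rule nn_integral_cmult[symmetric]) simp
    also have "\<dots> = ?T"
      using y by (intro nn_integral_halfline_cong) (simp add: ennreal_mult'[symmetric] field_simps)
    finally show ?thesis .
  qed
  have "(\<integral>\<^sup>+z. w z * ennreal (heat_kernel (1/4) z) \<partial>lborel) * ?K = (\<integral>\<^sup>+z. w z * ?E (norm z) * ?K \<partial>lborel)"
    by (subst nn_integral_multc) (auto simp: heat_kernel_def)
  also have "\<dots> = (\<integral>\<^sup>+z. \<integral>\<^sup>+s. w z * ?E (norm z) * (ennreal (norm z ^ (?d + 1)) * (\<kappa> (norm z * s) * ennreal (s ^ ?d))) \<partial>halfline \<partial>lborel)"
  proof (rule nn_integral_cong_AE)
    show "AE z in lborel. w z * ?E (norm z) * ?K = (\<integral>\<^sup>+s. w z * ?E (norm z) * (ennreal (norm z ^ (?d + 1)) * (\<kappa> (norm z * s) * ennreal (s ^ ?d))) \<partial>halfline)"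
      using AE_lborel_singleton[of "0::real^'n"]
    proof eventually_elim
      case (elim z)
      show ?case unfolding K[OF elim] by (rule nn_integral_cmult[symmetric]) simp
    qed
  qed
  also have "\<dots> = (\<integral>\<^sup>+s. \<integral>\<^sup>+z. w z * ?E (norm z) * (ennreal (norm z ^ (?d + 1)) * (\<kappa> (norm z * s) * ennreal (s ^ ?d))) \<partial>lborel \<partial>halfline)"
    by (rule Fubini') simp
  also have "\<dots> = (\<integral>\<^sup>+s. \<integral>\<^sup>+y. w y * \<kappa> (norm y) * ennreal (heat_profile ?d (1/4) (norm y / s) * (norm y / s) ^ (?d + 1) / s) \<partial>lborel \<partial>halfline)"
  proof (rule nn_integral_halfline_cong)
    fix s :: real assume s: "0 < s"
    have "(\<integral>\<^sup>+z. w z * ?E (norm z) * (ennreal (norm z ^ (?d + 1)) * (\<kappa> (norm z * s) * ennreal (s ^ ?d))) \<partial>lborel)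
      = ennreal ((1 / s) ^ DIM(real^'n)) * (\<integral>\<^sup>+y. w (0 + (1 / s) *\<^sub>R y) * ?E (norm (0 + (1 / s) *\<^sub>R y)) * (ennreal (norm (0 + (1 / s) *\<^sub>R y) ^ (?d + 1)) * (\<kappa> (norm (0 + (1 / s) *\<^sub>R y) * s) * ennreal (s ^ ?d))) \<partial>lborel)"
      using s by (intro lborel_nn_integral_affine_euclidean) auto
    also have "\<dots> = (\<integral>\<^sup>+y. ennreal ((1 / s) ^ ?d) * (w (0 + (1 / s) *\<^sub>R y) * ?E (norm (0 + (1 / s) *\<^sub>R y)) * (ennreal (norm (0 + (1 / s) *\<^sub>R y) ^ (?d + 1)) * (\<kappa> (norm (0 + (1 / s) *\<^sub>R y) * s) * ennreal (s ^ ?d)))) \<partial>lborel)"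
      by (subst nn_integral_cmult) auto
    also have "\<dots> = (\<integral>\<^sup>+y. w y * \<kappa> (norm y) * ennreal (heat_profile ?d (1/4) (norm y / s) * (norm y / s) ^ (?d + 1) / s) \<partial>lborel)"
    proof (rule nn_integral_cong)
      fix y :: "real^'n"
      have n: "norm (0 + (1 / s) *\<^sub>R y) = norm y / s" "norm y / s * s = norm y" using s by simp_all
      have h: "w (0 + (1 / s) *\<^sub>R y) = ennreal (1 / s) * w y" using s hom[of "1 / s" y] by simp
      have "ennreal ((1 / s) ^ ?d) * (ennreal (1 / s) * w y * ?E (norm y / s) * (ennreal ((norm y / s) ^ (?d + 1)) * (\<kappa> (norm y) * ennreal (s ^ ?d))))
        = w y * \<kappa> (norm y) * (ennreal ((1 / s) ^ ?d) * ennreal (s ^ ?d) * (?E (norm y / s) * ennreal ((norm y / s) ^ (?d + 1)) * ennreal (1 / s)))"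
        by (simp only: mult_ac)
      also have "ennreal ((1 / s) ^ ?d) * ennreal (s ^ ?d) = 1"
        using s by (simp add: ennreal_mult'[symmetric] power_mult_distrib[symmetric])
      also have "?E (norm y / s) * ennreal ((norm y / s) ^ (?d + 1)) * ennreal (1 / s) = ennreal (heat_profile ?d (1/4) (norm y / s) * (norm y / s) ^ (?d + 1) / s)"
        using s by (simp only: ennreal_mult'[symmetric] heat_profile_nonneg mult_nonneg_nonneg zero_le_power divide_nonneg_pos norm_ge_zero) simp
      finally show "ennreal ((1 / s) ^ ?d) * (w (0 + (1 / s) *\<^sub>R y) * ?E (norm (0 + (1 / s) *\<^sub>R y)) * (ennreal (norm (0 + (1 / s) *\<^sub>R y) ^ (?d + 1)) * (\<kappa> (norm (0 + (1 / s) *\<^sub>R y) * s) * ennreal (s ^ ?d))))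
         = w y * \<kappa> (norm y) * ennreal (heat_profile ?d (1/4) (norm y / s) * (norm y / s) ^ (?d + 1) / s)"
        unfolding n h by simp
    qed
    finally show "(\<integral>\<^sup>+z. w z * ?E (norm z) * (ennreal (norm z ^ (?d + 1)) * (\<kappa> (norm z * s) * ennreal (s ^ ?d))) \<partial>lborel) = \<dots>" .
  qed
  also have "\<dots> = (\<integral>\<^sup>+y. \<integral>\<^sup>+s. w y * \<kappa> (norm y) * ennreal (heat_profile ?d (1/4) (norm y / s) * (norm y / s) ^ (?d + 1) / s) \<partial>halfline \<partial>lborel)"
    by (rule Fubini'[symmetric]) simp
  also have "\<dots> = (\<integral>\<^sup>+y. ?T * (w y * \<kappa> (norm y)) \<partial>lborel)"
  proof (rule nn_integral_cong_AE)
    show "AE y in lborel. (\<integral>\<^sup>+s. w y * \<kappa> (norm y) * ennreal (heat_profile ?d (1/4) (norm y / s) * (norm y / s) ^ (?d + 1) / s) \<partial>halfline) = ?T * (w y * \<kappa> (norm y))"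
      using AE_lborel_singleton[of "0::real^'n"]
    proof eventually_elim
      case (elim y)
      show ?case by (subst nn_integral_cmult, measurable) (subst T[OF elim], rule mult.commute)
    qed
  qed
  also have "\<dots> = ?T * (\<integral>\<^sup>+y. w y * \<kappa> (norm y) \<partial>lborel)"
    by (rule nn_integral_cmult) simp
  finally show ?thesis unfolding polar_kernel_moment .
qed

text \<open>The integral of \<open>|a \<bullet> \<theta>|\<close> over the unit sphere of dimension \<open>d - 1\<close>, for any unit vector \<open>a\<close>.\<close>

definition sphere_moment :: "nat \<Rightarrow> real" where
  "sphere_moment d = 2 * pi powr ((real d - 1) / 2) / Gamma ((real d + 1) / 2)"

lemma sphere_moment_pos: "0 < sphere_moment d"
  by (auto simp: sphere_moment_def intro!: divide_pos_pos Gamma_real_pos)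

theorem nn_integral_abs_inner_radial:
  fixes a :: "real ^ 'n" and \<kappa> :: "real \<Rightarrow> ennreal"
  assumes [measurable]: "\<kappa> \<in> borel_measurable borel"
  shows "(\<integral>\<^sup>+z. ennreal \<bar>a \<bullet> z\<bar> * \<kappa> (norm z) \<partial>lborel)
    = ennreal (norm a * sphere_moment CARD('n)) * (\<integral>\<^sup>+r. \<kappa> r * ennreal (r ^ CARD('n)) \<partial>halfline)"
proof -
  let ?d = "CARD('n)"
  define T where "T = pi powr (- real ?d / 2) / 2 * Gamma ((real ?d + 1) / 2)"
  have T: "0 < T" unfolding T_def by (intro mult_pos_pos divide_pos_pos Gamma_real_pos) auto
  have "ennreal (2 * norm a * sqrt (1/4 / pi)) * (\<integral>\<^sup>+r. \<kappa> r * ennreal (r ^ ?d) \<partial>halfline) = ennreal T * (\<integral>\<^sup>+z. ennreal \<bar>a \<bullet> z\<bar> * \<kappa> (norm z) \<partial>lborel)"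
    using homogeneous_radial_integral[of "\<lambda>z. ennreal \<bar>a \<bullet> z\<bar>" \<kappa>]
    by (simp add: nn_integral_abs_inner_heat_kernel T_def abs_mult ennreal_mult')
  then have "ennreal (1 / T) * (ennreal (2 * norm a * sqrt (1/4 / pi)) * (\<integral>\<^sup>+r. \<kappa> r * ennreal (r ^ ?d) \<partial>halfline)) = ennreal (1 / T) * (ennreal T * (\<integral>\<^sup>+z. ennreal \<bar>a \<bullet> z\<bar> * \<kappa> (norm z) \<partial>lborel))"
    by simp
  moreover have "ennreal (1 / T) * ennreal T = 1" using T by (simp add: ennreal_mult'[symmetric])
  moreover have "ennreal (1 / T) * ennreal (2 * norm a * sqrt (1/4 / pi)) = ennreal (norm a * sphere_moment ?d)"
  proof -
    have "1 / T * (2 * norm a * sqrt (1/4 / pi)) = norm a * sphere_moment ?d"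
    proof -
      have "sqrt (1/4 / pi) = 1 / (2 * sqrt pi)" by (simp add: real_sqrt_divide real_sqrt_mult)
      moreover have "pi powr ((real ?d - 1) / 2) = pi powr (real ?d / 2) / sqrt pi"
        by (simp add: diff_divide_distrib powr_diff powr_half_sqrt)
      moreover have "pi powr (- real ?d / 2) = 1 / pi powr (real ?d / 2)"
        by (simp add: powr_minus_divide)
      ultimately show ?thesis by (simp add: T_def sphere_moment_def mult.commute)
    qed
    then show ?thesis using T by (simp only: ennreal_mult'[symmetric] divide_nonneg_pos zero_le_one)
  qed
  ultimately show ?thesis by (simp only: mult.assoc[symmetric]) simp
qed

text \<open>The norm is at most the sum of the coordinates, so integrability against \<open>norm z\<close> follows from the
  formula for \<open>|a \<bullet> z|\<close>.\<close>

lemma nn_integral_norm_radial_finite: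
  fixes \<kappa> :: "real \<Rightarrow> ennreal"
  assumes [measurable]: "\<kappa> \<in> borel_measurable borel"
    and K: "(\<integral>\<^sup>+r. \<kappa> r * ennreal (r ^ CARD('n)) \<partial>halfline) < \<infinity>"
  shows "(\<integral>\<^sup>+z. ennreal (norm z) * \<kappa> (norm z) \<partial>(lborel :: (real ^ 'n) measure)) < \<infinity>"
proof -
  have "(\<integral>\<^sup>+z. ennreal (norm z) * \<kappa> (norm z) \<partial>(lborel :: (real^'n) measure))
     \<le> (\<integral>\<^sup>+z. (\<Sum>i\<in>UNIV. ennreal \<bar>axis i 1 \<bullet> z\<bar> * \<kappa> (norm z)) \<partial>(lborel :: (real^'n) measure))"
  proof (rule nn_integral_mono)
    fix z :: "real^'n"
    have "norm z \<le> (\<Sum>i\<in>UNIV. \<bar>axis i 1 \<bullet> z\<bar>)"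
      using norm_le_l1_cart[of z] by (simp add: inner_axis')
    then have "ennreal (norm z) \<le> (\<Sum>i\<in>UNIV. ennreal \<bar>axis i 1 \<bullet> z\<bar>)"
      by (simp add: ennreal_leI)
    then show "ennreal (norm z) * \<kappa> (norm z) \<le> (\<Sum>i\<in>UNIV. ennreal \<bar>axis i 1 \<bullet> z\<bar> * \<kappa> (norm z))"
      by (simp add: sum_distrib_right[symmetric] mult_right_mono)
  qed
  also have "\<dots> = (\<Sum>i\<in>(UNIV::'n set). ennreal (norm (axis i 1 :: real^'n) * sphere_moment CARD('n)) * (\<integral>\<^sup>+r. \<kappa> r * ennreal (r ^ CARD('n)) \<partial>halfline))"
    by (subst nn_integral_sum) (simp_all add: nn_integral_abs_inner_radial)
  also have "\<dots> < \<infinity>" using K by (simp add: ennreal_mult_less_top ennreal_of_nat_eq_real_of_nat)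
  finally show ?thesis .
qed

section \<open>Mollification\<close>
text \<open>A compactly supported kernel \<open>\<rho>\<close> with gradient \<open>D\<close>. A uniform quadratic bound on the Taylor remainder,
  rather than smoothness, is what makes convolutions with integrable functions differentiable at once,
  with an explicit error.\<close>

locale mollifier =
  fixes \<epsilon> C :: real and \<rho> :: "real ^ 'n \<Rightarrow> real" and D :: "real ^ 'n \<Rightarrow> real ^ 'n"
  assumes eps_pos: "0 < \<epsilon>"
    and cont_rho: "continuous_on UNIV \<rho>" and cont_D: "continuous_on UNIV D"
    and rho_nonneg: "0 \<le> \<rho> x"
    and rho_even: "\<rho> (- x) = \<rho> x" and D_odd: "D (- x) = - D x"
    and rho_support: "\<epsilon> < norm x \<Longrightarrow> \<rho> x = 0" and D_support: "\<epsilon> < norm x \<Longrightarrow> D x = 0"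
    and rho_integral: "(\<integral>x. \<rho> x \<partial>lborel) = 1"
    and taylor: "norm h \<le> \<epsilon> \<Longrightarrow> \<bar>\<rho> (x + h) - \<rho> x - D x \<bullet> h\<bar> \<le> C * (norm h)\<^sup>2"

lemma continuous_compact_support_bounded:
  fixes f :: "'a::euclidean_space \<Rightarrow> 'b::real_normed_vector"
  assumes cont: "continuous_on UNIV f" and supp: "\<And>x. R < norm x \<Longrightarrow> f x = 0"
  shows "\<exists>B>0. \<forall>x. norm (f x) \<le> B"
proof -
  have "compact (f ` cball 0 R)"
    by (rule compact_continuous_image[OF continuous_on_subset[OF cont]]) auto
  then obtain B where B: "\<And>y. y \<in> f ` cball 0 R \<Longrightarrow> norm y \<le> B"
    by (meson bounded_iff compact_imp_bounded)
  have "norm (f x) \<le> max 1 B" for x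
    using B[of "f x"] supp[of x] by (cases "norm x \<le> R") (auto simp: le_max_iff_disj)
  then show ?thesis by (intro exI[of _ "max 1 B"]) auto
qed

lemma integrable_bounded_support:
  fixes f :: "'a::euclidean_space \<Rightarrow> 'b::{banach, second_countable_topology}"
  assumes [measurable]: "f \<in> borel_measurable borel"
    and B: "\<And>x. norm (f x) \<le> B" and supp: "\<And>x. R < norm x \<Longrightarrow> f x = 0"
  shows "integrable lborel f"
proof -
  have i: "integrable lborel (\<lambda>x::'a. B * indicator (cball 0 R) x)"
    using emeasure_lborel_cball_finite[of "0::'a" R] by (intro integrable_mult_right integrable_real_indicator) auto
  show ?thesis
    by (rule Bochner_Integration.integrable_bound[OF i])
       (use supp in \<open>auto simp: indicator_def not_le intro!: AE_I2 order_trans[OF B abs_ge_self]\<close>)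
qed

lemma integrable_continuous_compact_support:
  fixes f :: "'a::euclidean_space \<Rightarrow> 'b::euclidean_space"
  assumes cont: "continuous_on UNIV f" and supp: "\<And>x. R < norm x \<Longrightarrow> f x = 0"
  shows "integrable lborel f"
proof -
  obtain B where B: "\<And>x. norm (f x) \<le> B" using continuous_compact_support_bounded[OF assms] by blast
  show ?thesis
    by (rule integrable_bounded_support[OF borel_measurable_continuous_onI[OF cont] B supp])
qed

context mollifier
begin

lemma measurable_rho [measurable]: "\<rho> \<in> borel_measurable borel"
  using cont_rho by (rule borel_measurable_continuous_onI)

lemma measurable_D [measurable]: "D \<in> borel_measurable borel"
  using cont_D by (rule borel_measurable_continuous_onI)

lemma rho_bounded: "\<exists>B>0. \<forall>x. \<bar>\<rho> x\<bar> \<le> B"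
  using continuous_compact_support_bounded[OF cont_rho rho_support] by simp

lemma D_bounded: "\<exists>B>0. \<forall>x. norm (D x) \<le> B"
  using continuous_compact_support_bounded[OF cont_D D_support] by simp

lemma integrable_rho: "integrable lborel \<rho>"
  using integrable_continuous_compact_support[OF cont_rho rho_support] by simp

lemma rho_has_derivative: "(\<rho> has_derivative (\<lambda>h. D x \<bullet> h)) (at x)"
proof (rule has_derivativeI_sandwich[OF eps_pos])
  show "bounded_linear ((\<bullet>) (D x))" by (rule bounded_linear_inner_right)
  show "norm (\<rho> y - \<rho> x - D x \<bullet> (y - x)) / norm (y - x) \<le> C * norm (y - x)" if "y \<noteq> x" "dist y x < \<epsilon>" for y
    using taylor[of "y - x" x] that by (simp add: dist_norm divide_simps power2_eq_square mult.assoc)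
  show "((\<lambda>y. C * norm (y - x)) \<longlongrightarrow> 0) (at x)"
    by (auto intro!: tendsto_eq_intros)
qed

definition conv :: "(real ^ 'n \<Rightarrow> real) \<Rightarrow> real ^ 'n \<Rightarrow> real" where
  "conv v x = (\<integral>y. v y * \<rho> (x - y) \<partial>lborel)"

definition grad_conv :: "(real ^ 'n \<Rightarrow> real) \<Rightarrow> real ^ 'n \<Rightarrow> real ^ 'n" where
  "grad_conv v x = (\<integral>y. v y *\<^sub>R D (x - y) \<partial>lborel)"

lemma integrable_conv_integrand:
  assumes v: "integrable lborel v"
  shows "integrable lborel (\<lambda>y. v y * \<rho> (x - y))"
proof -
  obtain B where B: "\<And>x. \<bar>\<rho> x\<bar> \<le> B" using rho_bounded by blast
  have [measurable]: "v \<in> borel_measurable borel" using v by (simp add: integrable_iff_bounded)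
  show ?thesis
    by (rule Bochner_Integration.integrable_bound[OF integrable_mult_left[OF v, of B]])
       (auto simp: abs_mult intro!: AE_I2 mult_left_mono order_trans[OF B abs_ge_self])
qed

lemma integrable_grad_conv_integrand:
  assumes v: "integrable lborel v"
  shows "integrable lborel (\<lambda>y. v y *\<^sub>R D (x - y))"
proof -
  obtain B where B: "\<And>x. norm (D x) \<le> B" using D_bounded by blast
  have [measurable]: "v \<in> borel_measurable borel" using v by (simp add: integrable_iff_bounded)
  show ?thesis
    by (rule Bochner_Integration.integrable_bound[OF integrable_mult_left[OF v, of B]])
       (auto simp: abs_mult intro!: AE_I2 mult_left_mono order_trans[OF B abs_ge_self])
qed

lemma measurable_conv [measurable]:
  assumes [measurable]: "v \<in> borel_measurable borel"
  shows "conv v \<in> borel_measurable borel"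
  unfolding conv_def[abs_def] by measurable

lemma measurable_grad_conv [measurable]:
  assumes [measurable]: "v \<in> borel_measurable borel"
  shows "grad_conv v \<in> borel_measurable borel"
  unfolding grad_conv_def[abs_def] by measurable

lemma grad_conv_inner:
  assumes v: "integrable lborel v"
  shows "grad_conv v x \<bullet> h = (\<integral>y. v y * (D (x - y) \<bullet> h) \<partial>lborel)"
  unfolding grad_conv_def
  by (subst integral_inner_left[symmetric]) (auto intro: integrable_grad_conv_integrand[OF v])

lemma conv_has_derivative:
  assumes v: "integrable lborel v"
  shows "(conv v has_derivative (\<lambda>h. grad_conv v x \<bullet> h)) (at x)"
proof (rule has_derivativeI_sandwich[OF eps_pos])
  let ?I = "\<integral>y. \<bar>v y\<bar> \<partial>lborel"
  show "bounded_linear ((\<bullet>) (grad_conv v x))" by (rule bounded_linear_inner_right)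
  show "norm (conv v z - conv v x - grad_conv v x \<bullet> (z - x)) / norm (z - x) \<le> (C * ?I) * norm (z - x)"
    if "z \<noteq> x" "dist z x < \<epsilon>" for z
  proof -
    have igi: "integrable lborel (\<lambda>y. v y * (D (x - y) \<bullet> (z - x)))"
      using integrable_inner_left[OF integrable_grad_conv_integrand[OF v, of x], of "z - x"] by simp
    have "conv v z - conv v x - grad_conv v x \<bullet> (z - x)
      = (\<integral>y. v y * \<rho> (z - y) - v y * \<rho> (x - y) - v y * (D (x - y) \<bullet> (z - x)) \<partial>lborel)"
      unfolding conv_def grad_conv_inner[OF v]
      by (simp add: integrable_conv_integrand[OF v] igi)
    also have "norm \<dots> \<le> (\<integral>y. (C * (norm (z - x))\<^sup>2) * \<bar>v y\<bar> \<partial>lborel)"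
    proof (rule Bochner_Integration.integral_norm_bound_integral)
      fix y
      have "\<bar>\<rho> ((x - y) + (z - x)) - \<rho> (x - y) - D (x - y) \<bullet> (z - x)\<bar> \<le> C * (norm (z - x))\<^sup>2"
        by (rule taylor) (use that in \<open>simp add: dist_norm\<close>)
      then have "\<bar>v y\<bar> * \<bar>\<rho> (z - y) - \<rho> (x - y) - D (x - y) \<bullet> (z - x)\<bar> \<le> \<bar>v y\<bar> * (C * (norm (z - x))\<^sup>2)"
        by (intro mult_left_mono) auto
      then show "norm (v y * \<rho> (z - y) - v y * \<rho> (x - y) - v y * (D (x - y) \<bullet> (z - x))) \<le> C * (norm (z - x))\<^sup>2 * \<bar>v y\<bar>"
        by (simp only: abs_mult[symmetric] real_norm_def right_diff_distrib mult.commute)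
    qed (use v in \<open>auto intro!: Bochner_Integration.integrable_diff integrable_conv_integrand igi\<close>)
    also have "\<dots> = (C * ?I) * (norm (z - x))\<^sup>2" by simp
    finally show ?thesis using that by (simp add: divide_simps power2_eq_square mult.assoc)
  qed
  show "((\<lambda>z. (C * ?I) * norm (z - x)) \<longlongrightarrow> 0) (at x)"
    by (auto intro!: tendsto_eq_intros)
qed

lemma continuous_grad_conv:
  assumes v: "integrable lborel v"
  shows "continuous_on UNIV (grad_conv v)"
proof -
  obtain B where B: "\<And>x. norm (D x) \<le> B" using D_bounded by blast
  have [measurable]: "v \<in> borel_measurable borel" using v by (simp add: integrable_iff_bounded)
  have "(\<lambda>n. grad_conv v (X n)) \<longlonglongrightarrow> grad_conv v x" if X: "X \<longlonglongrightarrow> x" for X x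
    unfolding grad_conv_def
  proof (rule integral_dominated_convergence[where w = "\<lambda>y. \<bar>v y\<bar> * B"])
    show "AE y in lborel. (\<lambda>n. v y *\<^sub>R D (X n - y)) \<longlonglongrightarrow> v y *\<^sub>R D (x - y)"
    proof (rule AE_I2)
      fix y
      have "isCont D (x - y)" using cont_D by (simp add: continuous_on_eq_continuous_at)
      moreover have "(\<lambda>n. X n - y) \<longlonglongrightarrow> x - y" by (intro tendsto_intros X)
      ultimately have "(\<lambda>n. D (X n - y)) \<longlonglongrightarrow> D (x - y)" by (rule isCont_tendsto_compose)
      then show "(\<lambda>n. v y *\<^sub>R D (X n - y)) \<longlonglongrightarrow> v y *\<^sub>R D (x - y)" by (intro tendsto_intros)
    qed
    show "AE y in lborel. norm (v y *\<^sub>R D (X n - y)) \<le> \<bar>v y\<bar> * B" for n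
      using B by (intro AE_I2) (auto intro!: mult_left_mono)
  qed (use v in auto)
  then show ?thesis
    by (auto simp: continuous_on_sequentially comp_def)
qed

end

text \<open>The square of the positive part is continuously differentiable with a Lipschitz derivative, so its
  first-order Taylor remainder is quadratic.\<close>

lemma max_square_taylor:
  fixes s t :: real
  shows "0 \<le> (max 0 t)\<^sup>2 - (max 0 s)\<^sup>2 - 2 * max 0 s * (t - s)"
    and "(max 0 t)\<^sup>2 - (max 0 s)\<^sup>2 - 2 * max 0 s * (t - s) \<le> (t - s)\<^sup>2"
proof -
  have eq: "b\<^sup>2 - a\<^sup>2 - 2 * a * (b - a) = (b - a)\<^sup>2" for a b :: real
    by (simp add: power2_eq_square algebra_simps)
  show "0 \<le> (max 0 t)\<^sup>2 - (max 0 s)\<^sup>2 - 2 * max 0 s * (t - s)"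
  proof (cases "0 \<le> t \<or> s \<le> 0")
    case True
    then show ?thesis using eq[of t s] by (cases "0 \<le> t"; cases "0 \<le> s") (auto simp: max_def)
  next
    case False
    then have "s * s \<le> s * (2 * (s - t))" by (intro mult_left_mono) auto
    then show ?thesis using False by (simp add: max_def power2_eq_square algebra_simps)
  qed
  show "(max 0 t)\<^sup>2 - (max 0 s)\<^sup>2 - 2 * max 0 s * (t - s) \<le> (t - s)\<^sup>2"
  proof (cases "0 \<le> t")
    case True
    show ?thesis
    proof (cases "0 \<le> s")
      case True then show ?thesis using \<open>0 \<le> t\<close> eq[of t s] by (simp add: max_def)
    next
      case False
      then have "t\<^sup>2 \<le> (t - s)\<^sup>2" using \<open>0 \<le> t\<close> by (intro power_mono) auto
      then show ?thesis using False \<open>0 \<le> t\<close> by (simp add: max_def)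
    qed
  next
    case False
    then have t: "max 0 t = 0" by simp
    show ?thesis
    proof (cases "0 \<le> s")
      case True
      have "(t - s)\<^sup>2 - (- s\<^sup>2 - 2 * s * (t - s)) = t\<^sup>2" by (simp add: power2_eq_square algebra_simps)
      then show ?thesis using True t by (simp add: max_def) (metis diff_ge_0_iff_ge zero_le_power2)
    qed (use t in \<open>simp add: max_def\<close>)
  qed
qed

text \<open>The kernel is the normalised square of the positive part of \<open>\<epsilon>\<^sup>2 - |x|\<^sup>2\<close>.\<close>

lemma mollifier_exists:
  assumes \<epsilon>: "0 < \<epsilon>"
  obtains C and \<rho> :: "real ^ 'n \<Rightarrow> real" and D where "mollifier \<epsilon> C \<rho> D"
proof -
  define m where "m = (\<lambda>x::real^'n. max 0 (\<epsilon>\<^sup>2 - (norm x)\<^sup>2))"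
  define I where "I = (\<integral>x. (m x)\<^sup>2 \<partial>lborel)"
  have cm: "continuous_on UNIV m" unfolding m_def by (intro continuous_intros)
  have m0: "m x = 0" if "\<epsilon> < norm x" for x
  proof -
    have "\<epsilon>\<^sup>2 \<le> (norm x)\<^sup>2" using that \<epsilon> by (intro power_mono) auto
    then show ?thesis by (simp add: m_def)
  qed
  have mnn: "0 \<le> m x" and mle: "m x \<le> \<epsilon>\<^sup>2" for x by (auto simp: m_def)
  have im: "integrable lborel (\<lambda>x. (m x)\<^sup>2)"
    by (rule integrable_continuous_compact_support[of _ \<epsilon>]) (use m0 in \<open>auto intro!: continuous_intros cm\<close>)
  have "I \<noteq> 0"
  proof
    assume "I = 0"
    then have "AE x in lborel. (m x)\<^sup>2 = 0"
      unfolding I_def using im by (subst (asm) integral_nonneg_eq_0_iff_AE) auto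
    moreover have "m x \<noteq> 0" if "x \<in> ball 0 \<epsilon>" for x
    proof -
      have "(norm x)\<^sup>2 < \<epsilon>\<^sup>2" using that \<epsilon> by (intro power_strict_mono) auto
      then show ?thesis by (simp add: m_def)
    qed
    ultimately have "AE x in lborel. x \<notin> ball (0::real^'n) \<epsilon>"
      by (auto elim!: eventually_mono)
    then have "emeasure lborel (ball (0::real^'n) \<epsilon>) = 0"
      by (subst (asm) AE_iff_measurable[of "ball 0 \<epsilon>"]) auto
    then show False using emeasure_lborel_ball_nonzero[OF \<epsilon>, of "0::real^'n"] by simp
  qed
  moreover have "0 \<le> I" unfolding I_def by simp
  ultimately have I: "0 < I" by simp
  let ?\<rho> = "\<lambda>x. (m x)\<^sup>2 / I" and ?D = "\<lambda>x. (- 4 * m x / I) *\<^sub>R x"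
  have "mollifier \<epsilon> (11 * \<epsilon>\<^sup>2 / I) ?\<rho> ?D"
  proof
    show "continuous_on UNIV ?\<rho>" "continuous_on UNIV ?D"
      using I by (auto intro!: continuous_intros cm)
    show "(\<integral>x. ?\<rho> x \<partial>lborel) = 1" using I by (simp add: I_def[symmetric])
    fix x h :: "real^'n" assume h: "norm h \<le> \<epsilon>"
    define s where "s = \<epsilon>\<^sup>2 - (norm x)\<^sup>2"
    define t where "t = \<epsilon>\<^sup>2 - (norm (x + h))\<^sup>2"
    have ms: "m x = max 0 s" "m (x + h) = max 0 t" by (simp_all add: m_def s_def t_def)
    have ts: "t - s = - 2 * (x \<bullet> h) - (norm h)\<^sup>2"
      by (simp add: s_def t_def power2_norm_eq_inner inner_add_left inner_add_right inner_commute)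
    define r where "r = (max 0 t)\<^sup>2 - (max 0 s)\<^sup>2 - 2 * max 0 s * (t - s)"
    have r_le: "r \<le> 9 * \<epsilon>\<^sup>2 * (norm h)\<^sup>2"
    proof (cases "s \<le> 0 \<and> t \<le> 0")
      case False
      have "norm x \<le> \<epsilon> \<or> norm (x + h) \<le> \<epsilon>"
      proof (rule ccontr)
        assume "\<not> ?thesis"
        then have "\<epsilon>\<^sup>2 \<le> (norm x)\<^sup>2" "\<epsilon>\<^sup>2 \<le> (norm (x + h))\<^sup>2" using \<epsilon> by (auto intro!: power_mono)
        then show False using False by (simp add: s_def t_def)
      qed
      then have sum: "norm (x + h) + norm x \<le> 3 * \<epsilon>"
        using norm_triangle_ineq[of x h] norm_triangle_ineq2[of x "- h"] h by auto
      have "\<bar>norm x - norm (x + h)\<bar> \<le> norm h"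
        using norm_triangle_ineq3[of x "x + h"] by simp
      then have "\<bar>norm x - norm (x + h)\<bar> * (norm (x + h) + norm x) \<le> norm h * (3 * \<epsilon>)"
        using sum by (intro mult_mono) auto
      moreover have "t - s = (norm x - norm (x + h)) * (norm (x + h) + norm x)"
        by (simp add: s_def t_def power2_eq_square algebra_simps)
      ultimately have "\<bar>t - s\<bar> \<le> norm h * (3 * \<epsilon>)" by (simp add: abs_mult)
      then have "\<bar>t - s\<bar>\<^sup>2 \<le> (norm h * (3 * \<epsilon>))\<^sup>2" by (intro power_mono) auto
      then show ?thesis using max_square_taylor(2)[of t s] by (simp add: r_def power_mult_distrib mult.commute)
    qed (auto simp: r_def max_def)
    have r0: "0 \<le> r" unfolding r_def by (rule max_square_taylor)
    \<comment> \<open>The constant \<open>11 = 9 + 2\<close>: the remainder \<open>r\<close> of the outer square contributes \<open>9 \<epsilon>\<^sup>2 |h|\<^sup>2\<close>, the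
      quadratic part of the inner function \<open>\<epsilon>\<^sup>2 - |x|\<^sup>2\<close> contributes \<open>2 \<epsilon>\<^sup>2 |h|\<^sup>2\<close>.\<close>
    have "?\<rho> (x + h) - ?\<rho> x - ?D x \<bullet> h = (r - 2 * max 0 s * (norm h)\<^sup>2) / I"
      unfolding ms r_def ts by (simp add: add_divide_distrib diff_divide_distrib algebra_simps)
    also have "\<bar>\<dots>\<bar> = \<bar>r - 2 * max 0 s * (norm h)\<^sup>2\<bar> / I" using I by simp
    also have "\<dots> \<le> (11 * \<epsilon>\<^sup>2 * (norm h)\<^sup>2) / I"
    proof (rule divide_right_mono)
      have "max 0 s \<le> \<epsilon>\<^sup>2" using mle[of x] ms by simp
      then have "2 * max 0 s * (norm h)\<^sup>2 \<le> 2 * \<epsilon>\<^sup>2 * (norm h)\<^sup>2" by (intro mult_right_mono) auto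
      moreover have "0 \<le> 2 * max 0 s * (norm h)\<^sup>2" by simp
      ultimately show "\<bar>r - 2 * max 0 s * (norm h)\<^sup>2\<bar> \<le> 11 * \<epsilon>\<^sup>2 * (norm h)\<^sup>2"
        using r0 r_le by linarith
    qed (use I in simp)
    finally show "\<bar>?\<rho> (x + h) - ?\<rho> x - ?D x \<bullet> h\<bar> \<le> 11 * \<epsilon>\<^sup>2 / I * (norm h)\<^sup>2" by simp
  qed (use \<epsilon> I m0 in \<open>auto simp: m_def\<close>)
  then show ?thesis by (rule that)
qed

section \<open>Mollified gradients are bounded by the perimeter\<close>
lemma has_derivative_zero_outside_ball:
  fixes f :: "'a::real_normed_vector \<Rightarrow> 'b::real_normed_vector"
  assumes der: "(f has_derivative f') (at x)" and supp: "\<And>x. R < norm x \<Longrightarrow> f x = 0" and x: "R < norm x"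
  shows "f' = (\<lambda>h. 0)"
proof -
  have "open {x::'a. R < norm x}" by (rule open_Collect_less) (intro continuous_intros)+
  then have "((\<lambda>x. 0) has_derivative f') (at x)"
    by (rule has_derivative_transform_within_open[OF der]) (use x supp in auto)
  from has_derivative_unique[OF this has_derivative_const] show ?thesis .
qed

lemma has_real_derivative_along_line:
  fixes F :: "'a::real_normed_vector \<Rightarrow> real"
  assumes der: "(F has_derivative F') (at (x + u *\<^sub>R e))"
  shows "((\<lambda>u. F (x + u *\<^sub>R e)) has_real_derivative F' e) (at u)"
proof -
  have "((\<lambda>u. F (x + u *\<^sub>R e)) has_derivative (\<lambda>h. F' (h *\<^sub>R e))) (at u)"
    by (rule has_derivative_compose[where f = "\<lambda>u. x + u *\<^sub>R e" and g = F and g' = F', OF _ der]) (auto intro!: derivative_eq_intros)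
  moreover have "F' (h *\<^sub>R e) = h * F' e" for h
    using has_derivative_bounded_linear[OF der] by (simp add: linear_simps)
  ultimately show ?thesis by (simp add: has_field_derivative_def mult_commute_abs)
qed

lemma difference_quotient_tendsto:
  fixes F :: "'a::real_normed_vector \<Rightarrow> real"
  assumes der: "(F has_derivative F') (at x)" and t: "t \<longlonglongrightarrow> 0" "\<And>n. 0 < t n"
  shows "(\<lambda>n. (F (x + t n *\<^sub>R e) - F x) / t n) \<longlonglongrightarrow> F' e"
proof -
  have "((\<lambda>h. (F (x + h *\<^sub>R e) - F x) / h) \<longlongrightarrow> F' e) (at 0)"
    using has_real_derivative_along_line[of F F' x 0 e] der by (simp add: DERIV_def)
  moreover have "filterlim t (at 0) sequentially"
    using t by (auto simp: filterlim_at intro!: always_eventually less_imp_neq[symmetric])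
  ultimately show ?thesis by (rule filterlim_compose)
qed

text \<open>The difference quotients of \<open>F\<close> have integral zero by translation invariance, and they converge
  dominatedly by the mean value theorem.\<close>

lemma integral_directional_derivative_eq_0:
  fixes F :: "'a::euclidean_space \<Rightarrow> real"
  assumes der: "\<And>x. (F has_derivative F' x) (at x)"
    and cont: "continuous_on UNIV (\<lambda>x. F' x e)"
    and supp: "\<And>x. R < norm x \<Longrightarrow> F x = 0"
  shows "(\<integral>x. F' x e \<partial>lborel) = 0"
proof -
  have contF: "continuous_on UNIV F"
    using der by (auto intro!: continuous_at_imp_continuous_on has_derivative_continuous)
  have supp': "F' x e = 0" if "R < norm x" for x
    using has_derivative_zero_outside_ball[OF der supp that] by simp
  obtain B where B: "0 < B" "\<And>x. norm (F' x e) \<le> B"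
    using continuous_compact_support_bounded[OF cont supp'] by blast
  have [measurable]: "F \<in> borel_measurable borel" "(\<lambda>x. F' x e) \<in> borel_measurable borel"
    using contF cont by (auto intro: borel_measurable_continuous_onI)
  have iF: "integrable lborel F" by (rule integrable_continuous_compact_support[OF contF supp])
  define t where "t n = 1 / real (Suc n)" for n
  have t: "0 < t n" "t n \<le> 1" for n by (simp_all add: t_def)
  have t0: "t \<longlonglongrightarrow> 0" unfolding t_def by (rule LIMSEQ_Suc[OF lim_1_over_n])
  define q where "q n x = (F (x + t n *\<^sub>R e) - F x) / t n" for n x
  have bound: "\<bar>F (x + s *\<^sub>R e) - F x\<bar> \<le> s * B" if s: "0 < s" for x s
  proof -
    have d: "((\<lambda>u. F (x + u *\<^sub>R e)) has_real_derivative F' (x + u *\<^sub>R e) e) (at u)" for u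
      by (rule has_real_derivative_along_line[OF der])
    have "\<exists>z. 0 < z \<and> z < s \<and> F (x + s *\<^sub>R e) - F (x + 0 *\<^sub>R e) = (s - 0) * F' (x + z *\<^sub>R e) e"
      using s d by (intro MVT2) auto
    then obtain z where "F (x + s *\<^sub>R e) - F x = s * F' (x + z *\<^sub>R e) e" by auto
    then show ?thesis using B(2)[of "x + z *\<^sub>R e"] s by (simp add: abs_mult)
  qed
  have "(\<lambda>n. \<integral>x. q n x \<partial>lborel) \<longlonglongrightarrow> (\<integral>x. F' x e \<partial>lborel)"
  proof (rule integral_dominated_convergence[where w = "\<lambda>x::'a. B * indicator (cball 0 (R + norm e)) x"])
    show "integrable lborel (\<lambda>x::'a. B * indicator (cball 0 (R + norm e)) x)"
      using emeasure_lborel_cball_finite[of "0::'a" "R + norm e"] by (intro integrable_mult_right integrable_real_indicator) auto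
    show "AE x in lborel. (\<lambda>n. q n x) \<longlonglongrightarrow> F' x e"
      unfolding q_def by (intro AE_I2 difference_quotient_tendsto[OF der t0 t(1)])
    show "AE x in lborel. norm (q n x) \<le> B * indicator (cball 0 (R + norm e)) x" for n
    proof (rule AE_I2)
      fix x
      show "norm (q n x) \<le> B * indicator (cball 0 (R + norm e)) x"
      proof (cases "norm x \<le> R + norm e")
        case True
        then show ?thesis using bound[OF t(1), of x n] t(1)[of n]
          by (simp add: q_def divide_le_eq mult.commute)
      next
        case False
        have "t n * norm e \<le> norm e" using t[of n] by (simp add: mult_left_le_one_le)
        moreover have "norm (t n *\<^sub>R e) = t n * norm e" using t(1)[of n] by simp
        ultimately have "R < norm (x + t n *\<^sub>R e)"
          using False norm_triangle_ineq2[of x "- (t n *\<^sub>R e)"] by auto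
        moreover have "R < norm x" using False norm_ge_zero[of e] by linarith
        ultimately have "R < norm (x + t n *\<^sub>R e)" "R < norm x" .
        then show ?thesis using B(1) by (simp add: q_def supp)
      qed
    qed
  qed (auto simp: q_def[abs_def])
  moreover have "(\<integral>x. q n x \<partial>lborel) = 0" for n
  proof -
    have "integrable lborel (\<lambda>x. F (t n *\<^sub>R e + 1 *\<^sub>R x))" "(\<integral>x. F x \<partial>lborel) = (\<integral>x. F (t n *\<^sub>R e + 1 *\<^sub>R x) \<partial>lborel)"
      using lborel_integrable_affine_euclidean[OF iF, of 1] lborel_integral_affine_euclidean[of F 1] by auto
    then show ?thesis using iF by (simp add: q_def add.commute)
  qed
  ultimately show ?thesis using LIMSEQ_unique[of "\<lambda>_. 0::real"] by auto
qed

context mollifier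
begin

lemma integral_rho_shift: "(\<integral>x. \<rho> (y - x) \<partial>lborel) = 1" and integrable_rho_shift: "integrable lborel (\<lambda>x. \<rho> (y - x))"
proof -
  have e: "\<rho> (- y + 1 *\<^sub>R x) = \<rho> (y - x)" for x using rho_even[of "y - x"] by simp
  show "integrable lborel (\<lambda>x. \<rho> (y - x))"
    using lborel_integrable_affine_euclidean[OF integrable_rho, of 1 "- y"] unfolding e by simp
  show "(\<integral>x. \<rho> (y - x) \<partial>lborel) = 1"
    using lborel_integral_affine_euclidean[of \<rho> 1 "- y"] unfolding e by (simp add: rho_integral)
qed

context
  fixes \<phi> :: "real ^ 'n \<Rightarrow> real ^ 'n" and R :: real
  assumes \<phi>_meas: "\<phi> \<in> borel_measurable borel" and \<phi>_le: "norm (\<phi> x) \<le> 1" and \<phi>_supp: "R < norm x \<Longrightarrow> \<phi> x = 0"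
begin

definition "mollified_field y = (\<integral>x. \<rho> (y - x) *\<^sub>R \<phi> x \<partial>lborel)"

lemma integrable_field: "integrable lborel \<phi>"
  by (rule integrable_bounded_support[OF \<phi>_meas \<phi>_le \<phi>_supp])

lemma integrable_field_component: "integrable lborel (\<lambda>x. \<phi> x $ i)"
  by (rule integrable_bounded_linear[OF bounded_linear_vec_nth integrable_field])

lemma integrable_mollified_field_integrand: "integrable lborel (\<lambda>x. \<rho> (y - x) *\<^sub>R \<phi> x)"
proof -
  note \<phi>_meas [measurable]
  obtain B where B: "\<And>x. \<bar>\<rho> x\<bar> \<le> B" using rho_bounded by blast
  have "norm (\<rho> (y - x) *\<^sub>R \<phi> x) \<le> B * 1" for x
    using B[of "y - x"] \<phi>_le[of x] unfolding norm_scaleR by (intro mult_mono) auto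
  then show ?thesis
    by (rule integrable_bounded_support[rotated]) (use \<phi>_supp in auto)
qed

lemma mollified_field_nth: "mollified_field y $ i = conv (\<lambda>x. \<phi> x $ i) y"
proof -
  have "mollified_field y $ i = (\<integral>x. (\<rho> (y - x) *\<^sub>R \<phi> x) $ i \<partial>lborel)"
    unfolding mollified_field_def
    by (rule integral_bounded_linear[OF bounded_linear_vec_nth integrable_mollified_field_integrand, symmetric])
  then show ?thesis by (simp add: conv_def mult.commute)
qed

lemma mollified_field_has_derivative:
  "(mollified_field has_derivative (\<lambda>h. \<chi> i. grad_conv (\<lambda>x. \<phi> x $ i) y \<bullet> h)) (at y)"
  by (subst has_derivative_componentwise_within)
     (auto simp: Basis_vec_def inner_axis mollified_field_nth intro!: conv_has_derivative integrable_field_component)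

lemma divergence_mollified_field:
  "divergence mollified_field y = (\<integral>x. D (y - x) \<bullet> \<phi> x \<partial>lborel)"
proof -
  have ii: "integrable lborel (\<lambda>x. \<phi> x $ i * (D (y - x) \<bullet> axis i 1))" for i
    using integrable_inner_left[OF integrable_grad_conv_integrand[OF integrable_field_component, of i y], of "axis i 1"] by simp
  have "divergence mollified_field y = (\<Sum>i\<in>UNIV. grad_conv (\<lambda>x. \<phi> x $ i) y \<bullet> axis i 1)"
    unfolding divergence_def frechet_derivative_at[OF mollified_field_has_derivative, symmetric] by simp
  also have "\<dots> = (\<Sum>i\<in>UNIV. \<integral>x. \<phi> x $ i * (D (y - x) \<bullet> axis i 1) \<partial>lborel)"
    by (simp add: grad_conv_inner[OF integrable_field_component])
  also have "\<dots> = (\<integral>x. (\<Sum>i\<in>UNIV. \<phi> x $ i * (D (y - x) \<bullet> axis i 1)) \<partial>lborel)"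
    by (rule Bochner_Integration.integral_sum[symmetric]) (rule ii)
  also have "\<dots> = (\<integral>x. D (y - x) \<bullet> \<phi> x \<partial>lborel)"
    by (simp add: inner_axis inner_vec_def[of "D _"] mult.commute)
  finally show ?thesis .
qed

lemma norm_mollified_field_le: "norm (mollified_field y) \<le> 1"
proof -
  have "norm (mollified_field y) \<le> (\<integral>x. \<rho> (y - x) \<partial>lborel)"
    unfolding mollified_field_def
  proof (rule Bochner_Integration.integral_norm_bound_integral[OF integrable_mollified_field_integrand integrable_rho_shift])
    fix x
    have "\<rho> (y - x) * norm (\<phi> x) \<le> \<rho> (y - x) * 1" by (rule mult_left_mono[OF \<phi>_le rho_nonneg])
    then show "norm (\<rho> (y - x) *\<^sub>R \<phi> x) \<le> \<rho> (y - x)" using rho_nonneg[of "y - x"] by simp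
  qed
  then show ?thesis by (simp add: integral_rho_shift)
qed

lemma C1_mollified_field: "C1_compact_support mollified_field"
  unfolding C1_compact_support_def
proof (intro conjI exI allI)
  let ?L = "\<lambda>y h. \<chi> i. grad_conv (\<lambda>x. \<phi> x $ i) y \<bullet> h"
  have bl: "bounded_linear (?L y)" for y by (rule has_derivative_bounded_linear[OF mollified_field_has_derivative])
  show "(mollified_field has_derivative blinfun_apply (Blinfun (?L y))) (at y)" for y
    unfolding bounded_linear_Blinfun_apply[OF bl] by (rule mollified_field_has_derivative)
  show "continuous_on UNIV (\<lambda>y. Blinfun (?L y))"
    by (rule continuous_on_blinfun_componentwise)
       (auto simp: bounded_linear_Blinfun_apply[OF bl] intro!: continuous_intros continuous_grad_conv integrable_field_component)
  have "mollified_field y = 0" if "R + \<epsilon> < norm y" for y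
  proof -
    have "\<rho> (y - x) *\<^sub>R \<phi> x = 0" for x
    proof (cases "R < norm x")
      case False
      then have "\<epsilon> < norm (y - x)" using that norm_triangle_ineq2[of y x] by linarith
      then show ?thesis by (simp add: rho_support)
    qed (simp add: \<phi>_supp)
    then have "(\<lambda>x. \<rho> (y - x) *\<^sub>R \<phi> x) = (\<lambda>x. 0)" by (rule ext)
    then show ?thesis by (simp only: mollified_field_def) simp
  qed
  then have "{y. mollified_field y \<noteq> 0} \<subseteq> cball 0 (R + \<epsilon>)"
    by (metis (mono_tags, lifting) mem_Collect_eq mem_cball_0 not_le subsetI)
  then show "compact (closure {y. mollified_field y \<noteq> 0})"
    by (meson bounded_cball bounded_subset compact_closure)
qed

text \<open>Since \<open>D\<close> is odd, moving the mollifier from the field to the indicator changes the sign.\<close>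

lemma flux_mollified_field:
  assumes \<Omega>: "\<Omega> \<in> sets borel" "emeasure lborel \<Omega> < \<infinity>"
  shows "(LINT y:\<Omega>|lborel. divergence mollified_field y) = - (\<integral>x. \<phi> x \<bullet> grad_conv (indicator \<Omega>) x \<partial>lborel)"
proof -
  note \<phi>_meas [measurable] \<Omega>(1) [measurable]
  obtain B where B: "0 < B" "\<And>x. norm (D x) \<le> B" using D_bounded by blast
  have i\<Omega>: "integrable lborel (indicator \<Omega> :: real^'n \<Rightarrow> real)"
    using \<Omega> by (simp add: integrable_indicator_iff)
  let ?g = "\<lambda>y x. indicator \<Omega> y * (D (y - x) \<bullet> \<phi> x)"
  have int: "integrable (lborel \<Otimes>\<^sub>M lborel) (\<lambda>(y, x). ?g y x)"
  proof (rule lborel_pair.integrable_product_bounded[OF i\<Omega> integrable_mult_right[OF integrable_norm[OF integrable_field], of B]])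
    fix y x
    have "\<bar>D (y - x) \<bullet> \<phi> x\<bar> \<le> norm (D (y - x)) * norm (\<phi> x)" by (rule Cauchy_Schwarz_ineq2)
    also have "\<dots> \<le> B * norm (\<phi> x)" by (intro mult_right_mono B) auto
    finally show "norm (case (y, x) of (y, x) \<Rightarrow> ?g y x) \<le> \<bar>indicator \<Omega> y\<bar> * \<bar>B * norm (\<phi> x)\<bar>"
      using B(1) by (auto simp: abs_mult indicator_def)
  qed measurable
  have "(LINT y:\<Omega>|lborel. divergence mollified_field y) = (\<integral>y. \<integral>x. ?g y x \<partial>lborel \<partial>lborel)"
    by (simp add: set_lebesgue_integral_def divergence_mollified_field)
  also have "\<dots> = (\<integral>x. \<integral>y. ?g y x \<partial>lborel \<partial>lborel)"
    by (rule lborel_pair.Fubini_integral[OF int, symmetric])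
  also have "\<dots> = (\<integral>x. - (\<phi> x \<bullet> grad_conv (indicator \<Omega>) x) \<partial>lborel)"
  proof (intro Bochner_Integration.integral_cong refl)
    fix x
    have "(\<integral>y. ?g y x \<partial>lborel) = (\<integral>y. - (indicator \<Omega> y * (D (x - y) \<bullet> \<phi> x)) \<partial>lborel)"
    proof (intro Bochner_Integration.integral_cong refl)
      fix y
      have "D (y - x) = - D (x - y)" using D_odd[of "x - y"] by simp
      then show "?g y x = - (indicator \<Omega> y * (D (x - y) \<bullet> \<phi> x))" by simp
    qed
    also have "\<dots> = - (grad_conv (indicator \<Omega>) x \<bullet> \<phi> x)" by (simp add: grad_conv_inner[OF i\<Omega>])
    finally show "(\<integral>y. ?g y x \<partial>lborel) = - (\<phi> x \<bullet> grad_conv (indicator \<Omega>) x)" by (simp add: inner_commute)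
  qed
  finally show ?thesis by simp
qed

end

text \<open>The perimeter is tested with a mollification of minus the normalised gradient of the mollified
  indicator. That field is bounded by one, and its flux is the integral of the norm of the gradient.
  Cutting off outside a ball gives compact support, and the radius tends to infinity.\<close>

lemma nn_integral_grad_conv_le_perimeter:
  assumes \<Omega>: "\<Omega> \<in> sets borel" "emeasure lborel \<Omega> < \<infinity>" and P: "perimeter \<Omega> \<le> ereal P"
  shows "(\<integral>\<^sup>+x. ennreal (norm (grad_conv (indicator \<Omega>) x)) \<partial>lborel) \<le> ennreal P"
proof -
  let ?G = "grad_conv (indicator \<Omega>)"
  note \<Omega>(1) [measurable]
  have i\<Omega>: "integrable lborel (indicator \<Omega> :: real^'n \<Rightarrow> real)"
    using \<Omega> by (simp add: integrable_indicator_iff)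
  have Gm [measurable]: "?G \<in> borel_measurable borel" by measurable
  have bm [measurable]: "ball (0::real^'n) r \<in> sets borel" for r by simp
  have ball: "(\<integral>\<^sup>+x. ennreal (norm (?G x)) * indicator (ball 0 (real R)) x \<partial>lborel) \<le> ennreal P" for R :: nat
  proof -
    define \<phi> where "\<phi> x = - (indicator (ball 0 (real R)) x *\<^sub>R sgn (?G x))" for x
    have m: "\<phi> \<in> borel_measurable borel" unfolding \<phi>_def[abs_def] sgn_div_norm by measurable
    have le: "norm (\<phi> x) \<le> 1" for x by (simp add: \<phi>_def norm_sgn indicator_def)
    have supp: "\<phi> x = 0" if "real R < norm x" for x using that by (simp add: \<phi>_def)
    have G: "- (\<phi> x \<bullet> ?G x) = norm (?G x) * indicator (ball 0 (real R)) x" for x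
      by (cases "?G x = 0") (simp_all add: \<phi>_def sgn_div_norm dot_square_norm power2_eq_square)
    have "ereal (LINT y:\<Omega>|lborel. divergence (mollified_field \<phi>) y) \<le> perimeter \<Omega>"
      unfolding perimeter_def
      by (rule SUP_upper) (use C1_mollified_field[OF m le supp] norm_mollified_field_le[OF m le supp] in auto)
    also note P
    finally have "(LINT y:\<Omega>|lborel. divergence (mollified_field \<phi>) y) \<le> P" by simp
    also have "(LINT y:\<Omega>|lborel. divergence (mollified_field \<phi>) y) = (\<integral>x. - (\<phi> x \<bullet> ?G x) \<partial>lborel)"
      by (simp only: flux_mollified_field[OF m le supp \<Omega>] integral_minus)
    finally have leP: "(\<integral>x. norm (?G x) * indicator (ball 0 (real R)) x \<partial>lborel) \<le> P"
      by (simp only: G)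
    have "integrable lborel (\<lambda>x. norm (?G x) * indicator (ball 0 (real R)) x)"
    proof -
      have "compact (cball (0::real^'n) (real R))" by simp
      then have "compact (?G ` cball 0 (real R))"
        by (rule compact_continuous_image[OF continuous_on_subset[OF continuous_grad_conv[OF i\<Omega>] subset_UNIV]])
      then obtain B where B: "\<And>y. y \<in> ?G ` cball 0 (real R) \<Longrightarrow> norm y \<le> B"
        by (meson bounded_iff compact_imp_bounded)
      have "norm (norm (?G x) * indicator (ball 0 (real R)) x) \<le> max 0 B" for x
        using B[of "?G x"] by (auto simp: indicator_def le_max_iff_disj)
      then show ?thesis
        by (rule integrable_bounded_support[rotated, of _ _ "real R"]) auto
    qed
    then have "(\<integral>\<^sup>+x. ennreal (norm (?G x) * indicator (ball 0 (real R)) x) \<partial>lborel) = ennreal (\<integral>x. norm (?G x) * indicator (ball 0 (real R)) x \<partial>lborel)"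
      by (rule nn_integral_eq_integral) simp
    also have "\<dots> \<le> ennreal P" by (rule ennreal_leI[OF leP])
    finally show ?thesis by (simp only: ennreal_mult' norm_ge_zero ennreal_indicator)
  qed
  have "(\<integral>\<^sup>+x. ennreal (norm (?G x)) \<partial>lborel) = (\<integral>\<^sup>+x. (SUP R::nat. ennreal (norm (?G x)) * indicator (ball 0 (real R)) x) \<partial>lborel)"
  proof (rule nn_integral_cong)
    fix x :: "real^'n"
    show "ennreal (norm (?G x)) = (SUP R::nat. ennreal (norm (?G x)) * indicator (ball 0 (real R)) x)"
    proof (rule antisym)
      obtain R :: nat where "norm x < real R" using reals_Archimedean2 by blast
      then show "ennreal (norm (?G x)) \<le> (SUP R::nat. ennreal (norm (?G x)) * indicator (ball 0 (real R)) x)"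
        by (intro SUP_upper2[of R]) auto
    qed (auto intro!: SUP_least simp: indicator_def)
  qed
  also have "\<dots> = (SUP R::nat. \<integral>\<^sup>+x. ennreal (norm (?G x)) * indicator (ball 0 (real R)) x \<partial>lborel)"
    by (rule nn_integral_monotone_convergence_SUP) (auto simp: incseq_def le_fun_def indicator_def intro!: mult_left_mono)
  also have "\<dots> \<le> ennreal P" using ball by (intro SUP_least)
  finally show ?thesis .
qed

end

section \<open>Mollified gradients recover the perimeter\<close>
lemma C1_compact_support_divergence:
  fixes \<phi> :: "real ^ 'n \<Rightarrow> real ^ 'n"
  assumes "C1_compact_support \<phi>"
  obtains \<phi>' R where "continuous_on UNIV \<phi>'" "\<And>x. (\<phi> has_derivative blinfun_apply (\<phi>' x)) (at x)"
    "\<And>x. R < norm x \<Longrightarrow> \<phi> x = 0" "continuous_on UNIV \<phi>"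
    "continuous_on UNIV (divergence \<phi>)" "\<And>x. R < norm x \<Longrightarrow> divergence \<phi> x = 0"
proof -
  obtain \<phi>' where cont: "continuous_on UNIV \<phi>'" and der: "\<And>x. (\<phi> has_derivative blinfun_apply (\<phi>' x)) (at x)"
    and cpt: "compact (closure {x. \<phi> x \<noteq> 0})"
    using assms by (auto simp: C1_compact_support_def)
  obtain R where R: "\<And>x. \<phi> x \<noteq> 0 \<Longrightarrow> norm x \<le> R"
    using compact_imp_bounded[OF cpt] closure_subset[of "{x. \<phi> x \<noteq> 0}"] by (auto simp: bounded_iff)
  then have supp: "\<phi> x = 0" if "R < norm x" for x using that by (meson not_le)
  have div: "divergence \<phi> x = (\<Sum>i\<in>UNIV. blinfun_apply (\<phi>' x) (axis i 1) $ i)" for x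
    unfolding divergence_def frechet_derivative_at[OF der, symmetric] ..
  show ?thesis
  proof (rule that[OF cont der supp])
    show "continuous_on UNIV \<phi>"
      using der by (auto intro!: continuous_at_imp_continuous_on has_derivative_continuous)
    show "continuous_on UNIV (divergence \<phi>)"
      unfolding div[abs_def] by (intro continuous_intros cont)
    show "divergence \<phi> x = 0" if "R < norm x" for x
    proof -
      have "blinfun_apply (\<phi>' x) h = 0" for h
        using has_derivative_zero_outside_ball[OF der supp that] by simp
      then show ?thesis by (simp add: div)
    qed
  qed
qed

context mollifier
begin

lemma mollified_divergence_by_parts:
  assumes der: "\<And>x. (\<phi> has_derivative blinfun_apply (\<phi>' x)) (at x)" and cont: "continuous_on UNIV \<phi>'"
    and supp: "\<And>x. R < norm x \<Longrightarrow> \<phi> x = 0"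
  shows "(\<integral>x. \<rho> (y - x) * divergence \<phi> x \<partial>lborel) = (\<integral>x. D (y - x) \<bullet> \<phi> x \<partial>lborel)"
    and "integrable lborel (\<lambda>x. \<rho> (y - x) * divergence \<phi> x)"
proof -
  have div: "divergence \<phi> x = (\<Sum>i\<in>UNIV. blinfun_apply (\<phi>' x) (axis i 1) $ i)" for x
    unfolding divergence_def frechet_derivative_at[OF der, symmetric] ..
  have c\<phi>: "continuous_on UNIV \<phi>"
    using der by (auto intro!: continuous_at_imp_continuous_on has_derivative_continuous)
  have c\<rho>: "continuous_on UNIV (\<lambda>x. \<rho> (y - x))"
    by (rule continuous_on_compose2[OF cont_rho]) (auto intro!: continuous_intros)
  have cD: "continuous_on UNIV (\<lambda>x. D (y - x))"
    by (rule continuous_on_compose2[OF cont_D]) (auto intro!: continuous_intros)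
  have far: "\<epsilon> < norm (y - x)" if "norm y + \<epsilon> < norm x" for x
    using that norm_triangle_ineq2[of x y] by (simp add: norm_minus_commute)
  have i1: "integrable lborel (\<lambda>x. \<rho> (y - x) * blinfun_apply (\<phi>' x) (axis i 1) $ i)" for i
    by (rule integrable_continuous_compact_support[where R = "norm y + \<epsilon>"])
       (auto intro!: continuous_intros c\<rho> cont simp: rho_support far)
  have i2: "integrable lborel (\<lambda>x. (D (y - x) \<bullet> axis i 1) * \<phi> x $ i)" for i
    by (rule integrable_continuous_compact_support[where R = "norm y + \<epsilon>"])
       (auto intro!: continuous_intros cD c\<phi> simp: D_support far)
  have parts: "(\<integral>x. \<rho> (y - x) * blinfun_apply (\<phi>' x) (axis i 1) $ i \<partial>lborel) = (\<integral>x. (D (y - x) \<bullet> axis i 1) * \<phi> x $ i \<partial>lborel)" for i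
  proof -
    let ?F' = "\<lambda>x h. \<rho> (y - x) * blinfun_apply (\<phi>' x) h $ i + (D (y - x) \<bullet> (- h)) * \<phi> x $ i"
    have "(\<integral>x. ?F' x (axis i 1) \<partial>lborel) = 0"
    proof (rule integral_directional_derivative_eq_0[where F = "\<lambda>x. \<rho> (y - x) * \<phi> x $ i" and F' = ?F' and R = R])
      fix x
      have a: "((\<lambda>x. \<rho> (y - x)) has_derivative (\<lambda>h. D (y - x) \<bullet> (- h))) (at x)"
        by (rule has_derivative_compose[OF _ rho_has_derivative, of "\<lambda>x. y - x"]) (auto intro!: derivative_eq_intros)
      have b: "((\<lambda>x. \<phi> x $ i) has_derivative (\<lambda>h. blinfun_apply (\<phi>' x) h $ i)) (at x)"
        by (rule bounded_linear.has_derivative[OF bounded_linear_vec_nth der])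
      show "((\<lambda>x. \<rho> (y - x) * \<phi> x $ i) has_derivative ?F' x) (at x)"
        by (rule has_derivative_mult[OF a b])
    qed (auto intro!: continuous_intros c\<rho> cD c\<phi> cont simp: supp)
    then show ?thesis using i1[of i] i2[of i] by simp
  qed
  show "integrable lborel (\<lambda>x. \<rho> (y - x) * divergence \<phi> x)"
    unfolding div sum_distrib_left by (intro Bochner_Integration.integrable_sum i1)
  have "(\<integral>x. \<rho> (y - x) * divergence \<phi> x \<partial>lborel) = (\<Sum>i\<in>UNIV. \<integral>x. \<rho> (y - x) * blinfun_apply (\<phi>' x) (axis i 1) $ i \<partial>lborel)"
    unfolding div sum_distrib_left by (rule Bochner_Integration.integral_sum) (rule i1)
  also have "\<dots> = (\<integral>x. (\<Sum>i\<in>UNIV. (D (y - x) \<bullet> axis i 1) * \<phi> x $ i) \<partial>lborel)"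
    unfolding parts by (rule Bochner_Integration.integral_sum[symmetric]) (rule i2)
  also have "\<dots> = (\<integral>x. D (y - x) \<bullet> \<phi> x \<partial>lborel)"
    by (simp add: inner_axis inner_vec_def[of "D _"])
  finally show "(\<integral>x. \<rho> (y - x) * divergence \<phi> x \<partial>lborel) = (\<integral>x. D (y - x) \<bullet> \<phi> x \<partial>lborel)" .
qed

text \<open>Mollifying a test field changes its divergence by at most \<open>\<omega>\<close>, and the flux of the mollified field is
  an integral against the gradient of the mollified indicator.\<close>

lemma flux_le_grad_conv:
  assumes \<Omega>: "\<Omega> \<in> sets borel" "emeasure lborel \<Omega> < \<infinity>"
    and C1: "C1_compact_support \<phi>" and le: "\<And>x. norm (\<phi> x) \<le> 1"
    and \<omega>: "\<And>x h. norm h \<le> \<epsilon> \<Longrightarrow> \<bar>divergence \<phi> (x + h) - divergence \<phi> x\<bar> \<le> \<omega>"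
    and intG: "integrable lborel (grad_conv (indicator \<Omega>))"
  shows "(LINT y:\<Omega>|lborel. divergence \<phi> y) \<le> (\<integral>x. norm (grad_conv (indicator \<Omega>) x) \<partial>lborel) + \<omega> * measure lborel \<Omega>"
proof -
  let ?G = "grad_conv (indicator \<Omega>)"
  note \<Omega>(1) [measurable]
  obtain \<phi>' R where cont: "continuous_on UNIV \<phi>'" and der: "\<And>x. (\<phi> has_derivative blinfun_apply (\<phi>' x)) (at x)"
    and supp: "\<And>x. R < norm x \<Longrightarrow> \<phi> x = 0" and c\<phi>: "continuous_on UNIV \<phi>"
    and cdiv: "continuous_on UNIV (divergence \<phi>)" and suppd: "\<And>x. R < norm x \<Longrightarrow> divergence \<phi> x = 0"
    by (rule C1_compact_support_divergence[OF C1]) (rule that)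
  have m [measurable]: "\<phi> \<in> borel_measurable borel" "divergence \<phi> \<in> borel_measurable borel"
    using c\<phi> cdiv by (auto intro: borel_measurable_continuous_onI)
  note moll = m(1) le supp
  have close: "\<bar>divergence (mollified_field \<phi>) y - divergence \<phi> y\<bar> \<le> \<omega>" for y
  proof -
    have "divergence (mollified_field \<phi>) y - divergence \<phi> y
      = (\<integral>x. \<rho> (y - x) * divergence \<phi> x \<partial>lborel) - (\<integral>x. \<rho> (y - x) * divergence \<phi> y \<partial>lborel)"
      by (simp add: divergence_mollified_field[OF moll] mollified_divergence_by_parts(1)[OF der cont supp] integral_rho_shift)
    also have "\<dots> = (\<integral>x. \<rho> (y - x) * divergence \<phi> x - \<rho> (y - x) * divergence \<phi> y \<partial>lborel)"
      by (rule Bochner_Integration.integral_diff[symmetric])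
         (auto intro!: mollified_divergence_by_parts(2)[OF der cont supp] integrable_rho_shift)
    also have "norm \<dots> \<le> (\<integral>x. \<rho> (y - x) * \<omega> \<partial>lborel)"
    proof (rule Bochner_Integration.integral_norm_bound_integral)
      fix x
      show "norm (\<rho> (y - x) * divergence \<phi> x - \<rho> (y - x) * divergence \<phi> y) \<le> \<rho> (y - x) * \<omega>"
      proof (cases "norm (x - y) \<le> \<epsilon>")
        case True
        have "\<rho> (y - x) * \<bar>divergence \<phi> x - divergence \<phi> y\<bar> \<le> \<rho> (y - x) * \<omega>"
          using \<omega>[OF True, of y] by (intro mult_left_mono rho_nonneg) auto
        then show ?thesis using rho_nonneg[of "y - x"] by (simp add: right_diff_distrib[symmetric] abs_mult)
      next
        case False
        then show ?thesis by (simp add: rho_support norm_minus_commute)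
      qed
    qed (auto intro!: Bochner_Integration.integrable_diff mollified_divergence_by_parts(2)[OF der cont supp] integrable_rho_shift)
    also have "\<dots> = \<omega>" by (simp add: integral_rho_shift)
    finally show ?thesis by simp
  qed
  have i\<Omega>: "integrable lborel (indicator \<Omega> :: real^'n \<Rightarrow> real)"
    using \<Omega> by (simp add: integrable_indicator_iff)
  have cdivm: "divergence (mollified_field \<phi>) \<in> borel_measurable borel"
  proof -
    have "divergence (mollified_field \<phi>) = (\<lambda>y. \<integral>x. D (y - x) \<bullet> \<phi> x \<partial>lborel)"
      by (rule ext) (rule divergence_mollified_field[OF moll])
    then show ?thesis by simp
  qed
  obtain B where B: "\<And>x. norm (divergence \<phi> x) \<le> B"
    using continuous_compact_support_bounded[OF cdiv suppd] by blast
  have s1: "set_integrable lborel \<Omega> (divergence \<phi>)"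
    unfolding set_integrable_def
    by (rule Bochner_Integration.integrable_bound[OF integrable_mult_left[OF i\<Omega>, of B]])
       (auto simp: indicator_def intro!: AE_I2 order_trans[OF B[simplified] abs_ge_self])
  have "\<bar>divergence (mollified_field \<phi>) x\<bar> \<le> \<bar>B + \<omega>\<bar>" for x
    using B[of x] close[of x] by simp
  then have s2: "set_integrable lborel \<Omega> (divergence (mollified_field \<phi>))"
    unfolding set_integrable_def using cdivm
    by (intro Bochner_Integration.integrable_bound[OF integrable_mult_left[OF i\<Omega>, of "B + \<omega>"]])
       (auto simp: indicator_def intro!: AE_I2)
  have "(LINT y:\<Omega>|lborel. divergence \<phi> y) \<le> (LINT y:\<Omega>|lborel. divergence (mollified_field \<phi>) y + \<omega>)"
  proof (rule set_integral_mono[OF s1])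
    show "set_integrable lborel \<Omega> (\<lambda>y. divergence (mollified_field \<phi>) y + \<omega>)"
      using s2 integrable_mult_left[OF i\<Omega>, of \<omega>] by (intro set_integral_add) (simp_all add: set_integrable_def)
    show "divergence \<phi> y \<le> divergence (mollified_field \<phi>) y + \<omega>" for y using close[of y] by linarith
  qed
  also have "\<dots> = (LINT y:\<Omega>|lborel. divergence (mollified_field \<phi>) y) + (LINT y:\<Omega>|lborel. \<omega>)"
    using s2 integrable_mult_left[OF i\<Omega>, of \<omega>] by (intro set_integral_add) (simp_all add: set_integrable_def)
  also have "(LINT y:\<Omega>|lborel. \<omega>) = \<omega> * measure lborel \<Omega>"
    using \<Omega> by (simp add: set_lebesgue_integral_def)
  also have "(LINT y:\<Omega>|lborel. divergence (mollified_field \<phi>) y) = (\<integral>x. - (\<phi> x \<bullet> ?G x) \<partial>lborel)"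
    by (simp only: flux_mollified_field[OF moll \<Omega>] integral_minus)
  also have "\<dots> \<le> (\<integral>x. norm (?G x) \<partial>lborel)"
  proof (rule integral_mono)
    have b: "\<bar>\<phi> x \<bullet> ?G x\<bar> \<le> norm (?G x)" for x
    proof -
      have "\<bar>\<phi> x \<bullet> ?G x\<bar> \<le> norm (\<phi> x) * norm (?G x)" by (rule Cauchy_Schwarz_ineq2)
      also have "\<dots> \<le> 1 * norm (?G x)" by (intro mult_right_mono le) auto
      finally show ?thesis by simp
    qed
    then show "- (\<phi> x \<bullet> ?G x) \<le> norm (?G x)" for x by (meson abs_le_D2)
    have "grad_conv (indicator \<Omega>) \<in> borel_measurable borel" by measurable
    then show "integrable lborel (\<lambda>x. - (\<phi> x \<bullet> ?G x))"
      by (intro Bochner_Integration.integrable_bound[OF integrable_norm[OF intG]]) (use b in auto)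
  qed (use intG in auto)
  finally show ?thesis by simp
qed

end

lemma divergence_modulus:
  fixes \<phi> :: "real ^ 'n \<Rightarrow> real ^ 'n"
  assumes C1: "C1_compact_support \<phi>" and e: "0 < e"
  obtains \<delta> where "0 < \<delta>" "\<And>x h. norm h \<le> \<delta> \<Longrightarrow> \<bar>divergence \<phi> (x + h) - divergence \<phi> x\<bar> \<le> e"
proof -
  obtain R where cdiv: "continuous_on UNIV (divergence \<phi>)"
    and suppd: "\<And>x. R < norm x \<Longrightarrow> divergence \<phi> x = 0"
    using C1_compact_support_divergence[OF C1] by metis
  have "uniformly_continuous_on (cball 0 (R + 1)) (divergence \<phi>)"
    by (rule compact_uniformly_continuous[OF continuous_on_subset[OF cdiv]]) auto
  then obtain d where d: "0 < d" "\<And>x x'. x \<in> cball 0 (R + 1) \<Longrightarrow> x' \<in> cball 0 (R + 1) \<Longrightarrow> dist x' x < d \<Longrightarrow> dist (divergence \<phi> x') (divergence \<phi> x) < e"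
    unfolding uniformly_continuous_on_def using e by metis
  show ?thesis
  proof (rule that[of "min 1 (d / 2)"])
    fix x h :: "real^'n" assume h: "norm h \<le> min 1 (d / 2)"
    show "\<bar>divergence \<phi> (x + h) - divergence \<phi> x\<bar> \<le> e"
    proof (cases "R < norm x \<and> R < norm (x + h)")
      case True
      then show ?thesis using e by (simp add: suppd)
    next
      case False
      then have "norm x \<le> R + 1" "norm (x + h) \<le> R + 1"
        using h norm_triangle_ineq[of x h] norm_triangle_ineq2[of x "- h"] by auto
      then have "dist (divergence \<phi> (x + h)) (divergence \<phi> x) < e"
        using h d(1) by (intro d(2)) (simp_all only: mem_cball_0, simp add: dist_norm)
      then show ?thesis by (simp add: dist_real_def)
    qed
  qed (use d in auto)
qed

section \<open>Translation defects and directional derivatives\<close>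
text \<open>The \<open>L\<^sup>1\<close> distance between the indicator of \<open>\<Omega>\<close> and its translate by \<open>w\<close>.\<close>

definition translation_defect :: "'a::euclidean_space set \<Rightarrow> 'a \<Rightarrow> ennreal" where
  "translation_defect \<Omega> w = (\<integral>\<^sup>+x. ennreal \<bar>indicator \<Omega> (x + w) - indicator \<Omega> x\<bar> \<partial>lborel)"

lemma nn_integral_translate:
  fixes f :: "'a::euclidean_space \<Rightarrow> ennreal"
  assumes "f \<in> borel_measurable borel"
  shows "(\<integral>\<^sup>+x. f (x + w) \<partial>lborel) = (\<integral>\<^sup>+x. f x \<partial>lborel)"
  using lborel_nn_integral_affine_euclidean[OF assms, of 1 w] by (simp add: add.commute)

text \<open>The two halves of the symmetric difference of \<open>\<Omega>\<close> and its translate have the same measure, because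
  both sets have the same finite measure.\<close>

lemma translation_defect_eq:
  assumes \<Omega>: "\<Omega> \<in> sets borel" "emeasure lborel \<Omega> < \<infinity>"
  shows "translation_defect \<Omega> w = 2 * emeasure lborel {x \<in> \<Omega>. x + w \<notin> \<Omega>}"
proof -
  note \<Omega>(1) [measurable]
  let ?A = "{x \<in> \<Omega>. x + w \<notin> \<Omega>}" and ?B = "{x. x \<notin> \<Omega> \<and> x + w \<in> \<Omega>}" and ?I = "{x \<in> \<Omega>. x + w \<in> \<Omega>}"
  have "Measurable.pred borel (\<lambda>x. x \<in> \<Omega> \<and> x + w \<notin> \<Omega>)" "Measurable.pred borel (\<lambda>x. x \<notin> \<Omega> \<and> x + w \<in> \<Omega>)"
     "Measurable.pred borel (\<lambda>x. x \<in> \<Omega> \<and> x + w \<in> \<Omega>)"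
    by measurable
  then have m [measurable]: "?A \<in> sets borel" "?B \<in> sets borel" "?I \<in> sets borel" by (simp_all add: pred_def)
  have fin: "emeasure lborel ?I < \<infinity>"
    using emeasure_mono[of ?I \<Omega> lborel] \<Omega> by auto
  have "emeasure lborel ?A + emeasure lborel ?I = emeasure lborel \<Omega>"
    by (subst plus_emeasure) (auto intro!: arg_cong[where f = "emeasure lborel"])
  moreover have "emeasure lborel ?B + emeasure lborel ?I = emeasure lborel \<Omega>"
  proof -
    have "emeasure lborel ?B + emeasure lborel ?I = (\<integral>\<^sup>+x. indicator ?B x + indicator ?I x \<partial>lborel)"
      by (subst nn_integral_add) simp_all
    also have "\<dots> = (\<integral>\<^sup>+x. indicator \<Omega> (x + w) \<partial>lborel)"
      by (intro nn_integral_cong) (simp add: indicator_def)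
    also have "\<dots> = emeasure lborel \<Omega>"
      by (subst nn_integral_translate) auto
    finally show ?thesis .
  qed
  ultimately have AB: "emeasure lborel ?A = emeasure lborel ?B"
  proof -
    assume "emeasure lborel ?A + emeasure lborel ?I = emeasure lborel \<Omega>"
      and "emeasure lborel ?B + emeasure lborel ?I = emeasure lborel \<Omega>"
    then have "emeasure lborel ?I + emeasure lborel ?A = emeasure lborel ?I + emeasure lborel ?B"
      by (simp only: add.commute)
    then show ?thesis unfolding ennreal_add_left_cancel using fin by auto
  qed
  have "translation_defect \<Omega> w = (\<integral>\<^sup>+x. indicator ?A x + indicator ?B x \<partial>lborel)"
    unfolding translation_defect_def by (intro nn_integral_cong) (simp add: indicator_def)
  also have "\<dots> = emeasure lborel ?A + emeasure lborel ?B"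
    by (subst nn_integral_add) auto
  finally show ?thesis using AB by (simp add: mult_2)
qed

text \<open>Continuity of translation in \<open>L\<^sup>1\<close>. A compact subset of \<open>\<Omega>\<close> carrying almost all of its measure stays
  inside the open set \<open>\<Omega>\<close> under small translations.\<close>

lemma translation_defect_small:
  fixes \<Omega> :: "'a::euclidean_space set"
  assumes \<Omega>: "open \<Omega>" "emeasure lborel \<Omega> < \<infinity>" and e: "0 < e"
  shows "\<exists>\<delta>>0. \<forall>w. norm w \<le> \<delta> \<longrightarrow> translation_defect \<Omega> w \<le> ennreal e"
proof -
  have \<Omega>b [measurable]: "\<Omega> \<in> sets borel" using \<Omega> by simp
  have "\<exists>K. K \<subseteq> \<Omega> \<and> compact K \<and> emeasure lborel \<Omega> \<le> emeasure lborel K + ennreal (e / 2)"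
  proof (cases "emeasure lborel \<Omega> = 0")
    case False
    let ?m = "measure lborel \<Omega>" and ?M = "density lborel (indicator \<Omega>)"
    have em: "emeasure lborel \<Omega> = ennreal ?m" using \<Omega> by (simp add: emeasure_eq_ennreal_measure)
    have M: "emeasure ?M A = emeasure lborel A" if "A \<subseteq> \<Omega>" "A \<in> sets borel" for A
      using that by (simp add: emeasure_density Int_absorb1 flip: indicator_inter_arith)
    have Mfin: "emeasure ?M (space ?M) \<noteq> \<infinity>"
      using \<Omega> by (simp add: emeasure_density)
    have "0 < ?m" using False em by (cases "?m = 0") (auto simp: less_le)
    then have "ennreal (?m - e / 2) < emeasure ?M \<Omega>" unfolding M[OF order_refl \<Omega>b] em using e by (intro ennreal_lessI) auto
    also have "emeasure ?M \<Omega> = (SUP K\<in>{K. K \<subseteq> \<Omega> \<and> compact K}. emeasure ?M K)"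
      by (rule inner_regular[OF _ Mfin]) auto
    finally obtain K where K: "K \<subseteq> \<Omega>" "compact K" "ennreal (?m - e / 2) < emeasure ?M K"
      by (auto simp: less_SUP_iff)
    have "emeasure lborel \<Omega> \<le> ennreal (?m - e / 2) + ennreal (e / 2)"
      unfolding em using e by (cases "0 \<le> ?m - e / 2") (auto simp: ennreal_plus[symmetric] ennreal_neg simp del: ennreal_plus intro!: ennreal_leI)
    also have "\<dots> \<le> emeasure lborel K + ennreal (e / 2)"
      using K(3) M[OF K(1)] K(2) by (intro add_right_mono) (simp add: borel_compact)
    finally show ?thesis using K by blast
  qed (use e in \<open>auto intro!: exI[of _ "{}"]\<close>)
  then obtain K where K: "K \<subseteq> \<Omega>" "compact K" "emeasure lborel \<Omega> \<le> emeasure lborel K + ennreal (e / 2)" by blast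
  have Kb [measurable]: "K \<in> sets borel" using K by (simp add: borel_compact)
  obtain d where d: "0 < d" "(\<Union>x\<in>K. ball x d) \<subseteq> \<Omega>"
    using compact_subset_open_imp_ball_epsilon_subset[OF K(2) \<Omega>(1) K(1)] by blast
  define \<delta> where "\<delta> = d / 2"
  have \<delta>: "0 < \<delta>" "\<And>x w. x \<in> K \<Longrightarrow> norm w \<le> \<delta> \<Longrightarrow> x + w \<in> \<Omega>"
  proof -
    show "0 < \<delta>" using d by (simp add: \<delta>_def)
    fix x w :: 'a assume "x \<in> K" "norm w \<le> \<delta>"
    then have "x + w \<in> ball x d" using d(1) by (simp add: \<delta>_def dist_norm)
    then show "x + w \<in> \<Omega>" using d(2) \<open>x \<in> K\<close> by blast
  qed
  have "translation_defect \<Omega> w \<le> ennreal e" if w: "norm w \<le> \<delta>" for w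
  proof -
    have eq: "translation_defect \<Omega> w = 2 * emeasure lborel {x \<in> \<Omega>. x + w \<notin> \<Omega>}"
      using \<Omega> by (intro translation_defect_eq) auto
    have "emeasure lborel {x \<in> \<Omega>. x + w \<notin> \<Omega>} \<le> emeasure lborel (\<Omega> - K)"
      using \<delta>(2) w by (intro emeasure_mono) auto
    also have "\<dots> = emeasure lborel \<Omega> - emeasure lborel K"
      using K \<Omega> emeasure_compact_finite[OF K(2)] by (intro emeasure_Diff) auto
    also have "\<dots> \<le> ennreal (e / 2)"
      using K(3) emeasure_compact_finite[OF K(2)] by (subst ennreal_minus_le_iff) (auto simp: add.commute)
    finally have "translation_defect \<Omega> w \<le> 2 * ennreal (e / 2)"
      unfolding eq by (rule mult_left_mono) simp
    also have "2 * ennreal (e / 2) = ennreal e"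
      using e by (metis ennreal_mult' ennreal_numeral field_sum_of_halves mult_2 zero_le_numeral)
    finally show ?thesis .
  qed
  then show ?thesis using \<delta>(1) by blast
qed

lemma norm_integral_le_nn_integral:
  fixes f :: "'a \<Rightarrow> 'b::{banach, second_countable_topology}"
  shows "ennreal (norm (integral\<^sup>L M f)) \<le> (\<integral>\<^sup>+x. ennreal (norm (f x)) \<partial>M)"
  by (cases "integrable M f") (auto intro: integral_norm_bound_ennreal simp: not_integrable_integral_eq)

context mollifier
begin

lemma conv_shift:
  assumes v: "integrable lborel v"
  shows "conv v x = (\<integral>z. v (x + z) * \<rho> z \<partial>lborel)" and "integrable lborel (\<lambda>z. v (x + z) * \<rho> z)"
proof -
  have [measurable]: "v \<in> borel_measurable borel" using v by (simp add: integrable_iff_bounded)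
  have e: "\<rho> (x - (x + 1 *\<^sub>R z)) = \<rho> z" for z using rho_even[of z] by simp
  show "conv v x = (\<integral>z. v (x + z) * \<rho> z \<partial>lborel)"
    unfolding conv_def using lborel_integral_affine_euclidean[of "\<lambda>y. v y * \<rho> (x - y)" 1 x] unfolding e by simp
  show "integrable lborel (\<lambda>z. v (x + z) * \<rho> z)"
    using lborel_integrable_affine_euclidean[OF integrable_conv_integrand[OF v, of x], of 1 x] unfolding e by simp
qed

text \<open>Averaging in \<open>z\<close> with the weight \<open>\<rho>\<close> does not increase \<open>L\<^sup>1\<close> norms.\<close>

lemma nn_integral_mollified_average_le:
  assumes k: "(\<lambda>(x, z). k x z) \<in> borel_measurable (borel \<Otimes>\<^sub>M borel)"
    and bound: "\<And>z. norm z \<le> \<epsilon> \<Longrightarrow> (\<integral>\<^sup>+x. ennreal \<bar>k x z\<bar> \<partial>(lborel :: (real^'n) measure)) \<le> N"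
  shows "(\<integral>\<^sup>+x. ennreal \<bar>\<integral>z. k x z * \<rho> z \<partial>lborel\<bar> \<partial>lborel) \<le> N"
proof -
  note k [measurable]
  have "(\<integral>\<^sup>+x. ennreal \<bar>\<integral>z. k x z * \<rho> z \<partial>lborel\<bar> \<partial>lborel) \<le> (\<integral>\<^sup>+x. \<integral>\<^sup>+z. ennreal \<bar>k x z\<bar> * ennreal (\<rho> z) \<partial>lborel \<partial>lborel)"
  proof (rule nn_integral_mono)
    fix x
    show "ennreal \<bar>\<integral>z. k x z * \<rho> z \<partial>lborel\<bar> \<le> (\<integral>\<^sup>+z. ennreal \<bar>k x z\<bar> * ennreal (\<rho> z) \<partial>lborel)"
      using norm_integral_le_nn_integral[of lborel "\<lambda>z. k x z * \<rho> z"]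
      by (simp add: abs_mult rho_nonneg ennreal_mult')
  qed
  also have "\<dots> = (\<integral>\<^sup>+z. \<integral>\<^sup>+x. ennreal \<bar>k x z\<bar> * ennreal (\<rho> z) \<partial>lborel \<partial>lborel)"
    by (rule lborel_pair.Fubini'[symmetric]) simp
  also have "\<dots> = (\<integral>\<^sup>+z. (\<integral>\<^sup>+x. ennreal \<bar>k x z\<bar> \<partial>lborel) * ennreal (\<rho> z) \<partial>lborel)"
    by (intro nn_integral_cong nn_integral_multc) simp
  also have "\<dots> \<le> (\<integral>\<^sup>+z. N * ennreal (\<rho> z) \<partial>lborel)"
  proof (rule nn_integral_mono)
    fix z :: "real^'n"
    show "(\<integral>\<^sup>+x. ennreal \<bar>k x z\<bar> \<partial>lborel) * ennreal (\<rho> z) \<le> N * ennreal (\<rho> z)"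
      using bound[of z] rho_support[of z] by (cases "norm z \<le> \<epsilon>") (auto intro!: mult_right_mono simp: not_le)
  qed
  also have "\<dots> = N"
    using rho_nonneg by (simp add: nn_integral_cmult nn_integral_eq_integral integrable_rho rho_integral)
  finally show ?thesis .
qed

context
  fixes \<Omega> :: "(real ^ 'n) set"
  assumes \<Omega>_borel [measurable]: "\<Omega> \<in> sets borel" and \<Omega>_finite: "emeasure lborel \<Omega> < \<infinity>"
begin

lemma integrable_indicator_\<Omega>: "integrable lborel (indicator \<Omega> :: real^'n \<Rightarrow> real)"
  using \<Omega>_finite by (simp add: integrable_indicator_iff)

lemma conv_increment_le_defect:
  "(\<integral>\<^sup>+x. ennreal \<bar>conv (indicator \<Omega>) (x + w) - conv (indicator \<Omega>) x\<bar> \<partial>lborel) \<le> translation_defect \<Omega> w"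
proof -
  have "conv (indicator \<Omega>) (x + w) - conv (indicator \<Omega>) x = (\<integral>z. (indicator \<Omega> (x + w + z) - indicator \<Omega> (x + z)) * \<rho> z \<partial>lborel)" for x
    unfolding conv_shift[OF integrable_indicator_\<Omega>] left_diff_distrib
    by (rule Bochner_Integration.integral_diff[symmetric]) (intro conv_shift integrable_indicator_\<Omega>)+
  moreover have "(\<integral>\<^sup>+x. ennreal \<bar>\<integral>z. (indicator \<Omega> (x + w + z) - indicator \<Omega> (x + z)) * \<rho> z \<partial>lborel\<bar> \<partial>lborel) \<le> translation_defect \<Omega> w"
  proof (rule nn_integral_mollified_average_le)
    fix z
    show "(\<integral>\<^sup>+x. ennreal \<bar>indicator \<Omega> (x + w + z) - indicator \<Omega> (x + z)\<bar> \<partial>lborel) \<le> translation_defect \<Omega> w"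
      using nn_integral_translate[of "\<lambda>x. ennreal \<bar>indicator \<Omega> (x + w) - indicator \<Omega> x\<bar>" z]
      by (simp add: translation_defect_def ac_simps)
  qed measurable
  ultimately show ?thesis by simp
qed

lemma conv_approximation:
  assumes "\<And>z. norm z \<le> \<epsilon> \<Longrightarrow> translation_defect \<Omega> z \<le> N"
  shows "(\<integral>\<^sup>+x. ennreal \<bar>conv (indicator \<Omega>) x - indicator \<Omega> x\<bar> \<partial>lborel) \<le> N"
proof -
  have "conv (indicator \<Omega>) x - indicator \<Omega> x = (\<integral>z. (indicator \<Omega> (x + z) - indicator \<Omega> x) * \<rho> z \<partial>lborel)" for x
  proof -
    have "(\<integral>z. (indicator \<Omega> (x + z) - indicator \<Omega> x) * \<rho> z \<partial>lborel) = (\<integral>z. indicator \<Omega> (x + z) * \<rho> z \<partial>lborel) - (\<integral>z. indicator \<Omega> x * \<rho> z \<partial>lborel)"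
      unfolding left_diff_distrib
      by (rule Bochner_Integration.integral_diff) (auto intro!: conv_shift integrable_indicator_\<Omega> integrable_rho)
    then show ?thesis by (simp add: conv_shift[OF integrable_indicator_\<Omega>] rho_integral)
  qed
  moreover have "(\<integral>\<^sup>+x. ennreal \<bar>\<integral>z. (indicator \<Omega> (x + z) - indicator \<Omega> x) * \<rho> z \<partial>lborel\<bar> \<partial>lborel) \<le> N"
    by (rule nn_integral_mollified_average_le) (use assms in \<open>auto simp: translation_defect_def\<close>)
  ultimately show ?thesis by simp
qed

text \<open>Fatou's lemma, applied to the difference quotients of the mollified indicator; these are no larger
  in \<open>L\<^sup>1\<close> than the ones of the indicator itself.\<close>

lemma directional_derivative_le_liminf:
  assumes t: "t \<longlonglongrightarrow> 0" "\<And>j. 0 < t j"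
  shows "(\<integral>\<^sup>+x. ennreal \<bar>grad_conv (indicator \<Omega>) x \<bullet> w\<bar> \<partial>lborel)
    \<le> liminf (\<lambda>j. ennreal (1 / t j) * translation_defect \<Omega> (t j *\<^sub>R w))"
proof -
  let ?u = "conv (indicator \<Omega>)" and ?G = "grad_conv (indicator \<Omega>)"
  have lim: "(\<lambda>j. ennreal (1 / t j) * ennreal \<bar>?u (x + t j *\<^sub>R w) - ?u x\<bar>) \<longlonglongrightarrow> ennreal \<bar>?G x \<bullet> w\<bar>" for x
  proof -
    have "(\<lambda>j. (?u (x + t j *\<^sub>R w) - ?u x) / t j) \<longlonglongrightarrow> ?G x \<bullet> w"
      by (rule difference_quotient_tendsto[OF conv_has_derivative[OF integrable_indicator_\<Omega>] t])
    then have "(\<lambda>j. ennreal \<bar>(?u (x + t j *\<^sub>R w) - ?u x) / t j\<bar>) \<longlonglongrightarrow> ennreal \<bar>?G x \<bullet> w\<bar>"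
      by (intro tendsto_ennrealI tendsto_rabs)
    moreover have "ennreal \<bar>(?u (x + t j *\<^sub>R w) - ?u x) / t j\<bar> = ennreal (1 / t j) * ennreal \<bar>?u (x + t j *\<^sub>R w) - ?u x\<bar>" for j
      using t(2)[of j] by (simp add: ennreal_mult'[symmetric])
    ultimately show ?thesis by (simp only:)
  qed
  have mu [measurable]: "?u \<in> borel_measurable borel" by measurable
  have "(\<integral>\<^sup>+x. ennreal \<bar>?G x \<bullet> w\<bar> \<partial>lborel)
     = (\<integral>\<^sup>+x. liminf (\<lambda>j. ennreal (1 / t j) * ennreal \<bar>?u (x + t j *\<^sub>R w) - ?u x\<bar>) \<partial>lborel)"
    by (intro nn_integral_cong lim_imp_Liminf[symmetric] lim) simp
  also have "\<dots> \<le> liminf (\<lambda>j. \<integral>\<^sup>+x. ennreal (1 / t j) * ennreal \<bar>?u (x + t j *\<^sub>R w) - ?u x\<bar> \<partial>lborel)"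
    by (rule nn_integral_liminf) simp
  also have "\<dots> \<le> liminf (\<lambda>j. ennreal (1 / t j) * translation_defect \<Omega> (t j *\<^sub>R w))"
    by (intro Liminf_mono always_eventually allI)
       (simp add: nn_integral_cmult mult_left_mono conv_increment_le_defect)
  finally show ?thesis .
qed

text \<open>The increment is the integral of the derivative along a segment, and every point of the segment
  contributes the same amount by translation invariance.\<close>

lemma conv_increment_le_directional_derivative:
  "(\<integral>\<^sup>+x. ennreal \<bar>conv (indicator \<Omega>) (x + w) - conv (indicator \<Omega>) x\<bar> \<partial>lborel)
     \<le> (\<integral>\<^sup>+x. ennreal \<bar>grad_conv (indicator \<Omega>) x \<bullet> w\<bar> \<partial>lborel)"
proof -
  let ?u = "conv (indicator \<Omega>)" and ?G = "grad_conv (indicator \<Omega>)"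
  have mG [measurable]: "?G \<in> borel_measurable borel" by measurable
  have "ennreal \<bar>?u (x + w) - ?u x\<bar> \<le> (\<integral>\<^sup>+s. indicator {0..1} s * ennreal \<bar>?G (x + s *\<^sub>R w) \<bullet> w\<bar> \<partial>lborel)" for x
  proof -
    have "(\<integral>s. indicator {0..1} s *\<^sub>R (?G (x + s *\<^sub>R w) \<bullet> w) \<partial>lborel) = ?u (x + 1 *\<^sub>R w) - ?u (x + 0 *\<^sub>R w)"
    proof (rule integral_FTC_Icc)
      fix s :: real
      have "((\<lambda>h. ?u (x + h *\<^sub>R w)) has_derivative (\<lambda>h. ?G (x + s *\<^sub>R w) \<bullet> (h *\<^sub>R w))) (at s)"
        by (rule has_derivative_compose[OF _ conv_has_derivative[OF integrable_indicator_\<Omega>], of "\<lambda>h. x + h *\<^sub>R w"])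
           (auto intro!: derivative_eq_intros)
      then show "((\<lambda>s. ?u (x + s *\<^sub>R w)) has_vector_derivative (?G (x + s *\<^sub>R w) \<bullet> w)) (at s within {0..1})"
        by (simp add: has_vector_derivative_def has_derivative_at_withinI)
      show "continuous_on {0..1} (\<lambda>s. ?G (x + s *\<^sub>R w) \<bullet> w)"
        by (intro continuous_intros continuous_on_compose2[OF continuous_grad_conv[OF integrable_indicator_\<Omega>]]) auto
    qed simp
    then show ?thesis
      using norm_integral_le_nn_integral[of lborel "\<lambda>s. indicator {0..1} s *\<^sub>R (?G (x + s *\<^sub>R w) \<bullet> w)"]
      by (simp add: abs_mult ennreal_mult' ennreal_indicator)
  qed
  then have "(\<integral>\<^sup>+x. ennreal \<bar>?u (x + w) - ?u x\<bar> \<partial>lborel)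
    \<le> (\<integral>\<^sup>+x. \<integral>\<^sup>+s. indicator {0..1} s * ennreal \<bar>?G (x + s *\<^sub>R w) \<bullet> w\<bar> \<partial>lborel \<partial>lborel)"
    by (rule nn_integral_mono)
  also have "\<dots> = (\<integral>\<^sup>+s. \<integral>\<^sup>+x. indicator {0..1} s * ennreal \<bar>?G (x + s *\<^sub>R w) \<bullet> w\<bar> \<partial>lborel \<partial>(lborel :: real measure))"
    by (rule lborel_pair.Fubini'[symmetric]) simp
  also have "\<dots> = (\<integral>\<^sup>+s. indicator {0..1} s * (\<integral>\<^sup>+x. ennreal \<bar>?G x \<bullet> w\<bar> \<partial>lborel) \<partial>(lborel :: real measure))"
    using nn_integral_translate[of "\<lambda>x. ennreal \<bar>?G x \<bullet> w\<bar>"] by (simp add: nn_integral_cmult)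
  also have "\<dots> = (\<integral>\<^sup>+x. ennreal \<bar>?G x \<bullet> w\<bar> \<partial>lborel)"
    by (simp add: nn_integral_multc)
  finally show ?thesis .
qed

text \<open>Passing from the indicator to its mollification, once at \<open>x\<close> and once at \<open>x + w\<close>, costs \<open>2 N\<close>.\<close>

lemma translation_defect_le_directional_derivative:
  assumes "\<And>z. norm z \<le> \<epsilon> \<Longrightarrow> translation_defect \<Omega> z \<le> N"
  shows "translation_defect \<Omega> w \<le> (\<integral>\<^sup>+x. ennreal \<bar>grad_conv (indicator \<Omega>) x \<bullet> w\<bar> \<partial>lborel) + 2 * N"
proof -
  let ?u = "conv (indicator \<Omega>)"
  have mu [measurable]: "?u \<in> borel_measurable borel" by measurable
  let ?d = "\<lambda>x. ennreal \<bar>?u x - indicator \<Omega> x\<bar>"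
  have "translation_defect \<Omega> w \<le> (\<integral>\<^sup>+x. ennreal \<bar>?u (x + w) - ?u x\<bar> + (?d (x + w) + ?d x) \<partial>lborel)"
    unfolding translation_defect_def
  proof (rule nn_integral_mono)
    fix x
    have "\<bar>indicator \<Omega> (x + w) - indicator \<Omega> x\<bar> \<le> \<bar>?u (x + w) - ?u x\<bar> + (\<bar>?u (x + w) - indicator \<Omega> (x + w)\<bar> + \<bar>?u x - indicator \<Omega> x\<bar>)"
      by linarith
    then show "ennreal \<bar>indicator \<Omega> (x + w) - indicator \<Omega> x\<bar> \<le> ennreal \<bar>?u (x + w) - ?u x\<bar> + (?d (x + w) + ?d x)"
      by (simp add: ennreal_plus[symmetric] ennreal_leI del: ennreal_plus)
  qed
  also have "\<dots> = (\<integral>\<^sup>+x. ennreal \<bar>?u (x + w) - ?u x\<bar> \<partial>lborel) + ((\<integral>\<^sup>+x. ?d (x + w) \<partial>lborel) + (\<integral>\<^sup>+x. ?d x \<partial>lborel))"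
    by (simp add: nn_integral_add)
  also have "(\<integral>\<^sup>+x. ?d (x + w) \<partial>lborel) = (\<integral>\<^sup>+x. ?d x \<partial>lborel)"
    by (rule nn_integral_translate) simp
  also have "(\<integral>\<^sup>+x. ennreal \<bar>?u (x + w) - ?u x\<bar> \<partial>lborel) + ((\<integral>\<^sup>+x. ?d x \<partial>lborel) + (\<integral>\<^sup>+x. ?d x \<partial>lborel))
    \<le> (\<integral>\<^sup>+x. ennreal \<bar>grad_conv (indicator \<Omega>) x \<bullet> w\<bar> \<partial>lborel) + (N + N)"
    by (intro add_mono conv_increment_le_directional_derivative conv_approximation assms)
  finally show ?thesis by (simp add: mult_2)
qed

end

end

section \<open>The directional variation of a set of finite perimeter\<close>
lemma perimeter_nonneg:
  fixes \<Omega> :: "(real ^ 'n) set"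
  shows "0 \<le> perimeter \<Omega>"
proof -
  let ?z = "\<lambda>x::real^'n. 0 :: real^'n"
  have d: "(?z has_derivative blinfun_apply 0) (at x)" for x
    by (simp add: zero_blinfun.rep_eq)
  have "C1_compact_support ?z"
    unfolding C1_compact_support_def by (intro conjI exI[of _ "\<lambda>_. 0"] allI d) auto
  then have "ereal (LINT x:\<Omega>|lborel. divergence ?z x) \<le> perimeter \<Omega>"
    unfolding perimeter_def by (intro SUP_upper) simp
  moreover have "divergence ?z x = 0" for x
    unfolding divergence_def frechet_derivative_at[OF d, symmetric] by simp
  ultimately show ?thesis by (simp add: set_lebesgue_integral_def zero_ereal_def[symmetric])
qed

lemma perimeter_eq_ereal:
  assumes "perimeter \<Omega> < \<infinity>"
  shows "perimeter \<Omega> = ereal (real_of_ereal (perimeter \<Omega>))" "0 \<le> real_of_ereal (perimeter \<Omega>)"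
  using assms perimeter_nonneg[of \<Omega>] by (auto simp: ereal_real real_of_ereal_pos)

text \<open>The properties of the gradient \<open>G\<close> of the indicator of \<open>\<Omega>\<close> mollified at scale \<open>\<epsilon>\<close> that survive
  when the mollifier is forgotten, which allows \<open>\<epsilon>\<close> to run through a sequence: the mass is at most \<open>P\<close>; the
  variation in a direction is at most the lower limit of the difference quotients of \<open>\<Omega>\<close>, and it
  bounds the translation defect up to the error of mollification; the mass nearly dominates the flux of
  every test field whose divergence oscillates by at most \<open>\<omega>\<close> at scale \<open>\<epsilon>\<close>.\<close>

definition regularized_gradient :: "(real ^ 'n) set \<Rightarrow> real \<Rightarrow> real \<Rightarrow> (real ^ 'n \<Rightarrow> real ^ 'n) \<Rightarrow> bool" where
  "regularized_gradient \<Omega> P \<epsilon> G \<longleftrightarrow> G \<in> borel_measurable borel \<and> integrable lborel G \<and>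
     (\<integral>x. norm (G x) \<partial>lborel) \<le> P \<and>
     (\<forall>t w. t \<longlonglongrightarrow> 0 \<longrightarrow> (\<forall>j. 0 < t j) \<longrightarrow>
        (\<integral>\<^sup>+x. ennreal \<bar>G x \<bullet> w\<bar> \<partial>lborel) \<le> liminf (\<lambda>j. ennreal (1 / t j) * translation_defect \<Omega> (t j *\<^sub>R w))) \<and>
     (\<forall>w N. (\<forall>z. norm z \<le> \<epsilon> \<longrightarrow> translation_defect \<Omega> z \<le> N) \<longrightarrow>
        translation_defect \<Omega> w \<le> (\<integral>\<^sup>+x. ennreal \<bar>G x \<bullet> w\<bar> \<partial>lborel) + 2 * N) \<and>
     (\<forall>\<phi> \<omega>. C1_compact_support \<phi> \<longrightarrow> (\<forall>x. norm (\<phi> x) \<le> 1) \<longrightarrow>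
        (\<forall>x h. norm h \<le> \<epsilon> \<longrightarrow> \<bar>divergence \<phi> (x + h) - divergence \<phi> x\<bar> \<le> \<omega>) \<longrightarrow>
        (LINT y:\<Omega>|lborel. divergence \<phi> y) \<le> (\<integral>x. norm (G x) \<partial>lborel) + \<omega> * measure lborel \<Omega>)"

lemma regularized_gradient_exists:
  fixes \<Omega> :: "(real ^ 'n) set"
  assumes \<Omega>: "\<Omega> \<in> sets borel" "emeasure lborel \<Omega> < \<infinity>" and P: "perimeter \<Omega> = ereal P" and \<epsilon>: "0 < \<epsilon>"
  shows "\<exists>G. regularized_gradient \<Omega> P \<epsilon> G"
proof -
  obtain C \<rho> D where "mollifier \<epsilon> C (\<rho> :: real^'n \<Rightarrow> real) D" using mollifier_exists[OF \<epsilon>] by blast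
  then interpret mollifier \<epsilon> C \<rho> D .
  note \<Omega>(1) [measurable]
  let ?G = "grad_conv (indicator \<Omega>)"
  have P0: "0 \<le> P" using perimeter_nonneg[of \<Omega>] P by simp
  have mG: "?G \<in> borel_measurable borel" by measurable
  have le: "(\<integral>\<^sup>+x. ennreal (norm (?G x)) \<partial>lborel) \<le> ennreal P"
    by (rule nn_integral_grad_conv_le_perimeter[OF \<Omega>]) (simp add: P)
  then have iG: "integrable lborel ?G"
    using mG by (intro integrableI_bounded) (auto intro: le_less_trans)
  have "(\<integral>x. norm (?G x) \<partial>lborel) \<le> P"
    using le P0 by (subst (asm) nn_integral_eq_integral[OF integrable_norm[OF iG]]) auto
  then show ?thesis
    using mG iG directional_derivative_le_liminf[OF \<Omega>] translation_defect_le_directional_derivative[OF \<Omega>]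
      flux_le_grad_conv[OF \<Omega> _ _ _ iG]
    unfolding regularized_gradient_def by (intro exI[of _ ?G] conjI allI impI) auto
qed

text \<open>Let \<open>v m z\<close> be the variation in direction \<open>z\<close> of the indicator mollified at scale \<open>1 / (m + 1)\<close>, and
  let \<open>Q t z\<close> be the difference quotient of \<open>\<Omega>\<close>. The bounds \<open>v m z \<le> liminf Q\<close> (as \<open>t \<rightarrow> 0\<close>) and
  \<open>Q t z \<le> liminf v\<close> (as \<open>m \<rightarrow> \<infinity>\<close>) squeeze both families to a common limit \<open>V z\<close>. For a single vector
  \<open>G m x\<close> the integral of \<open>|G m x \<bullet> z|\<close> against a radial kernel depends only on its norm, so the integral
  of \<open>v m\<close> against the kernel is a multiple of the mass of \<open>G m\<close>; the masses tend to the perimeter, as they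
  are bounded by it and nearly dominate the flux of any given test field. The fact that
  only norms enter replaces the structure theory of sets of finite perimeter.\<close>

theorem directional_variation:
  fixes \<Omega> :: "(real ^ 'n) set"
  assumes \<Omega>: "open \<Omega>" "emeasure lborel \<Omega> < \<infinity>" and P: "perimeter \<Omega> = ereal P"
  obtains V :: "real ^ 'n \<Rightarrow> real" where "V \<in> borel_measurable borel" "\<And>z. 0 \<le> V z" "\<And>z. V z \<le> norm z * P"
    "\<And>z. translation_defect \<Omega> z \<le> ennreal (norm z * P)"
    "\<And>z t. t \<longlonglongrightarrow> 0 \<Longrightarrow> (\<And>j. 0 < t j) \<Longrightarrow>
        (\<lambda>j. ennreal (1 / t j) * translation_defect \<Omega> (t j *\<^sub>R z)) \<longlonglongrightarrow> ennreal (V z)"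
    "\<And>\<kappa>. \<kappa> \<in> borel_measurable borel \<Longrightarrow> (\<integral>\<^sup>+r. \<kappa> r * ennreal (r ^ CARD('n)) \<partial>halfline) < \<infinity> \<Longrightarrow>
        (\<integral>\<^sup>+z. ennreal (V z) * \<kappa> (norm z) \<partial>lborel)
          = ennreal (P * sphere_moment CARD('n)) * (\<integral>\<^sup>+r. \<kappa> r * ennreal (r ^ CARD('n)) \<partial>halfline)"
proof -
  have P0: "0 \<le> P" using perimeter_nonneg[of \<Omega>] P by simp
  have \<Omega>b: "\<Omega> \<in> sets borel" using \<Omega> by simp
  let ?\<epsilon> = "\<lambda>m. 1 / real (Suc m)"
  have "\<forall>m. \<exists>G. regularized_gradient \<Omega> P (?\<epsilon> m) G"
    by (intro allI regularized_gradient_exists[OF \<Omega>b \<Omega>(2) P]) simp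
  then obtain G where GG: "\<And>m. regularized_gradient \<Omega> P (?\<epsilon> m) (G m)" by metis
  note GS = GG[unfolded regularized_gradient_def]
  note G = GS[THEN conjunct1] GS[THEN conjunct2, THEN conjunct1] GS[THEN conjunct2, THEN conjunct2, THEN conjunct1]
  note Gi = GS[THEN conjunct2, THEN conjunct2, THEN conjunct2, THEN conjunct1, rule_format]
  note Gii = GS[THEN conjunct2, THEN conjunct2, THEN conjunct2, THEN conjunct2, THEN conjunct1, rule_format]
  note Giii = GS[THEN conjunct2, THEN conjunct2, THEN conjunct2, THEN conjunct2, THEN conjunct2, rule_format]
  note G(1) [measurable]
  have \<epsilon>0: "\<forall>\<^sub>F m in sequentially. ?\<epsilon> m \<le> \<delta>" if "0 < \<delta>" for \<delta>
    using order_tendstoD(2)[OF LIMSEQ_Suc[OF lim_1_over_n] that] by (auto elim: eventually_mono)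
  define v where "v m z = (\<integral>\<^sup>+x. ennreal \<bar>G m x \<bullet> z\<bar> \<partial>lborel)" for m z
  define Q where "Q t z = ennreal (1 / t) * translation_defect \<Omega> (t *\<^sub>R z)" for t z
  define L where "L z = liminf (\<lambda>m. v m z)" for z
  have v_meas [measurable]: "v m \<in> borel_measurable borel" for m
    unfolding v_def[abs_def] by measurable
  have L_meas [measurable]: "L \<in> borel_measurable borel" unfolding L_def[abs_def] by measurable
  have nG: "(\<integral>\<^sup>+x. ennreal (norm (G m x)) \<partial>lborel) = ennreal (\<integral>x. norm (G m x) \<partial>lborel)" for m
    by (rule nn_integral_eq_integral[OF integrable_norm[OF G(2)]]) simp
  have v_le: "v m z \<le> ennreal (norm z * P)" for m z
  proof -
    have "v m z \<le> (\<integral>\<^sup>+x. ennreal (norm z) * ennreal (norm (G m x)) \<partial>lborel)"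
      unfolding v_def using Cauchy_Schwarz_ineq2[of "G m _" z]
      by (intro nn_integral_mono) (simp add: ennreal_mult'[symmetric] ennreal_leI mult.commute)
    also have "\<dots> = ennreal (norm z) * ennreal (\<integral>x. norm (G m x) \<partial>lborel)"
      by (simp add: nn_integral_cmult nG)
    also have "\<dots> \<le> ennreal (norm z) * ennreal P" by (intro mult_left_mono ennreal_leI G(3)) simp
    finally show ?thesis by (simp add: ennreal_mult')
  qed
  have v_scale: "ennreal (1 / t) * v m (t *\<^sub>R z) = v m z" if "0 < t" for t m z
    unfolding v_def using that
    by (subst nn_integral_cmult[symmetric]) (auto simp: abs_mult ennreal_mult'[symmetric] intro!: nn_integral_cong)
  \<comment> \<open>For fixed \<open>t\<close>, the error of mollification is made small compared with \<open>t\<close>.\<close>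
  have Q_le_v: "\<forall>\<^sub>F m in sequentially. Q t z \<le> v m z + ennreal e" if t: "0 < t" and e: "0 < e" for t z e
  proof -
    obtain \<delta> where \<delta>: "0 < \<delta>" "\<And>w. norm w \<le> \<delta> \<Longrightarrow> translation_defect \<Omega> w \<le> ennreal (e * t / 2)"
      using translation_defect_small[OF \<Omega>, of "e * t / 2"] t e by auto
    from \<epsilon>0[OF \<delta>(1)] show ?thesis
    proof eventually_elim
      case (elim m)
      have "translation_defect \<Omega> (t *\<^sub>R z) \<le> v m (t *\<^sub>R z) + 2 * ennreal (e * t / 2)"
        unfolding v_def by (rule Gii) (use \<delta>(2) elim in \<open>meson order_trans\<close>)
      then have "Q t z \<le> ennreal (1 / t) * (v m (t *\<^sub>R z) + 2 * ennreal (e * t / 2))"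
        unfolding Q_def by (rule mult_left_mono) simp
      also have "\<dots> = v m z + ennreal (1 / t) * (2 * ennreal (e * t / 2))"
        by (simp only: distrib_left v_scale[OF t])
      also have "ennreal (1 / t) * (2 * ennreal (e * t / 2)) = ennreal e"
      proof -
        have "ennreal (1 / t) * (2 * ennreal (e * t / 2)) = ennreal (1 / t * (2 * (e * t / 2)))"
          using t e by (simp only: ennreal_mult' ennreal_numeral divide_nonneg_pos zero_le_one zero_le_numeral)
        then show ?thesis using t by simp
      qed
      finally show ?case .
    qed
  qed
  have Q_le_L: "Q t z \<le> L z" if t: "0 < t" for t z
  proof (rule ennreal_le_epsilon)
    fix e :: real assume e: "0 < e"
    have "\<forall>\<^sub>F m in sequentially. Q t z - ennreal e \<le> v m z"
      using Q_le_v[OF t e] by eventually_elim (simp add: ennreal_minus_le_iff add.commute)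
    then have "Q t z - ennreal e \<le> L z" unfolding L_def by (rule Liminf_bounded)
    then show "Q t z \<le> L z + ennreal e" by (simp add: ennreal_minus_le_iff add.commute)
  qed
  have L_le: "L z \<le> ennreal (norm z * P)" for z
    unfolding L_def by (rule order_trans[OF Liminf_le_Limsup Limsup_bounded]) (auto intro!: always_eventually v_le)
  have Q_tendsto: "(\<lambda>j. Q (t j) z) \<longlonglongrightarrow> L z" if t: "t \<longlonglongrightarrow> 0" "\<And>j. 0 < t j" for t z
  proof -
    have "L z \<le> liminf (\<lambda>j. Q (t j) z)"
    proof -
      have "v m z \<le> liminf (\<lambda>j. Q (t j) z)" for m
        unfolding v_def Q_def by (rule Gi[OF t])
      then have "limsup (\<lambda>m. v m z) \<le> liminf (\<lambda>j. Q (t j) z)"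
        by (intro Limsup_bounded always_eventually allI)
      then show ?thesis unfolding L_def
        by (rule order_trans[OF Liminf_le_Limsup, rotated]) simp
    qed
    moreover have "limsup (\<lambda>j. Q (t j) z) \<le> L z"
      by (intro Limsup_bounded always_eventually allI Q_le_L t)
    moreover have "liminf (\<lambda>j. Q (t j) z) \<le> limsup (\<lambda>j. Q (t j) z)"
      by (rule Liminf_le_Limsup) simp
    ultimately show ?thesis by (subst tendsto_iff_Liminf_eq_Limsup) auto
  qed
  have v_tendsto: "(\<lambda>m. v m z) \<longlonglongrightarrow> L z" for z
  proof -
    have t: "(\<lambda>j. 1 / real (Suc j)) \<longlonglongrightarrow> 0" by (rule LIMSEQ_Suc[OF lim_1_over_n])
    have "v m z \<le> L z" for m
    proof -
      have "v m z \<le> liminf (\<lambda>j. Q (1 / real (Suc j)) z)"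
        unfolding v_def Q_def by (rule Gi[OF t]) simp
      also have "\<dots> = L z" by (rule lim_imp_Liminf[OF _ Q_tendsto[OF t]]) simp_all
      finally show ?thesis .
    qed
    then have "limsup (\<lambda>m. v m z) \<le> L z" by (intro Limsup_bounded always_eventually allI)
    moreover have "L z \<le> limsup (\<lambda>m. v m z)" unfolding L_def by (rule Liminf_le_Limsup) simp
    ultimately show ?thesis
      by (subst tendsto_iff_Liminf_eq_Limsup) (auto simp: L_def[symmetric])
  qed
  have mass_tendsto: "(\<lambda>m. \<integral>x. norm (G m x) \<partial>lborel) \<longlonglongrightarrow> P"
  proof (rule LIMSEQ_I)
    fix e :: real assume e: "0 < e"
    have "ereal (P - e / 2) < perimeter \<Omega>" using e P by simp
    then obtain \<phi> where \<phi>: "C1_compact_support \<phi>" "\<And>x. norm (\<phi> x) \<le> 1" "P - e / 2 < (LINT y:\<Omega>|lborel. divergence \<phi> y)"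
      unfolding perimeter_def less_SUP_iff by auto
    \<comment> \<open>The summand \<open>1\<close> only avoids a division by zero for null sets.\<close>
    define \<omega> where "\<omega> = e / 4 / (measure lborel \<Omega> + 1)"
    have \<omega>: "0 < \<omega>" using e by (simp add: \<omega>_def add_nonneg_pos)
    have "\<omega> * measure lborel \<Omega> \<le> \<omega> * (measure lborel \<Omega> + 1)" using \<omega> by (intro mult_left_mono) auto
    also have "\<dots> = e / 4"
    proof -
      have "measure lborel \<Omega> + 1 \<noteq> 0" using measure_nonneg[of lborel \<Omega>] by linarith
      then have "x / (measure lborel \<Omega> + 1) * (measure lborel \<Omega> + 1) = x" for x :: real by simp
      then show ?thesis unfolding \<omega>_def .
    qed
    finally have \<omega>m: "\<omega> * measure lborel \<Omega> \<le> e / 4" .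
    obtain \<delta> where \<delta>: "0 < \<delta>" "\<And>x h. norm h \<le> \<delta> \<Longrightarrow> \<bar>divergence \<phi> (x + h) - divergence \<phi> x\<bar> \<le> \<omega>"
      using divergence_modulus[OF \<phi>(1) \<omega>] by blast
    from \<epsilon>0[OF \<delta>(1)] have "\<forall>\<^sub>F m in sequentially. norm ((\<integral>x. norm (G m x) \<partial>lborel) - P) < e"
    proof eventually_elim
      case (elim m)
      have "(LINT y:\<Omega>|lborel. divergence \<phi> y) \<le> (\<integral>x. norm (G m x) \<partial>lborel) + \<omega> * measure lborel \<Omega>"
        by (rule Giii[OF \<phi>(1,2)]) (use \<delta>(2) elim in \<open>meson order_trans\<close>)
      then show ?case using \<phi>(3) \<omega>m G(3)[of m] e by (simp add: abs_if)
    qed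
    then show "\<exists>no. \<forall>m\<ge>no. norm ((\<integral>x. norm (G m x) \<partial>lborel) - P) < e"
      by (simp add: eventually_sequentially)
  qed
  define V where "V z = enn2real (L z)" for z
  have LV: "L z = ennreal (V z)" for z
    unfolding V_def using L_le[of z] by (metis ennreal_enn2real ennreal_less_top le_less_trans)
  show ?thesis
  proof (rule that[of V])
    show "V \<in> borel_measurable borel" unfolding V_def[abs_def] by measurable
    show "0 \<le> V z" for z by (simp add: V_def)
    show "V z \<le> norm z * P" for z using L_le[of z] P0 by (simp add: LV)
    show "translation_defect \<Omega> z \<le> ennreal (norm z * P)" for z
      using Q_le_L[of 1 z] L_le[of z] by (simp add: Q_def)
    show "(\<lambda>j. ennreal (1 / t j) * translation_defect \<Omega> (t j *\<^sub>R z)) \<longlonglongrightarrow> ennreal (V z)"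
      if "t \<longlonglongrightarrow> 0" "\<And>j. 0 < t j" for z t
      using Q_tendsto[OF that] by (simp add: Q_def LV)
    fix \<kappa> :: "real \<Rightarrow> ennreal"
    assume \<kappa> [measurable]: "\<kappa> \<in> borel_measurable borel"
    let ?K = "\<integral>\<^sup>+r. \<kappa> r * ennreal (r ^ CARD('n)) \<partial>halfline"
    let ?c = "sphere_moment CARD('n)"
    assume K: "?K < \<infinity>"
    have "(\<lambda>m. \<integral>\<^sup>+z. v m z * \<kappa> (norm z) \<partial>lborel) \<longlonglongrightarrow> (\<integral>\<^sup>+z. L z * \<kappa> (norm z) \<partial>lborel)"
    proof (rule nn_integral_dominated_convergence[where w = "\<lambda>z. ennreal P * (ennreal (norm z) * \<kappa> (norm z))"])
      show "AE z in lborel. v m z * \<kappa> (norm z) \<le> ennreal P * (ennreal (norm z) * \<kappa> (norm z))" for m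
      proof (rule AE_I2)
        fix z
        have "v m z * \<kappa> (norm z) \<le> ennreal (norm z * P) * \<kappa> (norm z)" by (rule mult_right_mono[OF v_le]) simp
        also have "ennreal (norm z * P) = ennreal P * ennreal (norm z)" using P0 by (simp add: ennreal_mult' mult.commute)
        finally show "v m z * \<kappa> (norm z) \<le> ennreal P * (ennreal (norm z) * \<kappa> (norm z))" by (simp only: mult.assoc)
      qed
      have fin: "(\<integral>\<^sup>+z. ennreal (norm z) * \<kappa> (norm z) \<partial>(lborel :: (real^'n) measure)) < \<infinity>"
        by (rule nn_integral_norm_radial_finite[OF \<kappa> K])
      then show "(\<integral>\<^sup>+z. ennreal P * (ennreal (norm z) * \<kappa> (norm z)) \<partial>(lborel :: (real^'n) measure)) < \<infinity>"
        by (simp add: nn_integral_cmult ennreal_mult_less_top)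
      show "AE z in lborel. (\<lambda>m. v m z * \<kappa> (norm z)) \<longlonglongrightarrow> L z * \<kappa> (norm z)"
      proof -
        \<comment> \<open>Multiplication is discontinuous at \<open>0 * \<infinity>\<close>. The kernel is finite almost everywhere off the origin,
          and at the origin \<open>v\<close> vanishes identically.\<close>
        have "AE z in lborel. \<kappa> (norm z) \<noteq> \<infinity> \<or> z = (0::real^'n)"
        proof -
          have "AE z in lborel. ennreal (norm z) * \<kappa> (norm (z::real^'n)) \<noteq> \<infinity>"
            using fin by (intro nn_integral_PInf_AE) auto
          then show ?thesis by eventually_elim (auto simp: ennreal_mult_eq_top_iff)
        qed
        then show ?thesis
        proof eventually_elim
          case (elim z)
          then show ?case
          proof
            assume "\<kappa> (norm z) \<noteq> \<infinity>"
            then show ?thesis using v_tendsto[of z] unfolding LV by (intro tendsto_mult_ennreal tendsto_const) auto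
          next
            assume "z = 0"
            then have "v m z = 0" "L z = 0" for m using v_le[of m z] L_le[of z] by auto
            then show ?thesis by simp
          qed
        qed
      qed
    qed measurable
    moreover have "(\<integral>\<^sup>+z. v m z * \<kappa> (norm z) \<partial>lborel) = ennreal (\<integral>x. norm (G m x) \<partial>lborel) * (ennreal ?c * ?K)" for m
    proof -
      have "(\<integral>\<^sup>+z. v m z * \<kappa> (norm z) \<partial>lborel) = (\<integral>\<^sup>+z. \<integral>\<^sup>+x. ennreal \<bar>G m x \<bullet> z\<bar> * \<kappa> (norm z) \<partial>lborel \<partial>lborel)"
        unfolding v_def by (intro nn_integral_cong nn_integral_multc[symmetric]) simp
      also have "\<dots> = (\<integral>\<^sup>+x. \<integral>\<^sup>+z. ennreal \<bar>G m x \<bullet> z\<bar> * \<kappa> (norm z) \<partial>lborel \<partial>lborel)"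
        by (rule lborel_pair.Fubini'[symmetric]) simp
      also have "\<dots> = (\<integral>\<^sup>+x. ennreal (norm (G m x)) * (ennreal ?c * ?K) \<partial>lborel)"
        by (simp add: nn_integral_abs_inner_radial ennreal_mult' mult.assoc)
      finally show ?thesis by (simp add: nn_integral_multc nG)
    qed
    moreover have "(\<lambda>m. ennreal (\<integral>x. norm (G m x) \<partial>lborel) * (ennreal ?c * ?K)) \<longlonglongrightarrow> ennreal P * (ennreal ?c * ?K)"
      using K by (intro tendsto_mult_ennreal tendsto_const tendsto_ennrealI mass_tendsto) (auto simp: ennreal_mult_eq_top_iff)
    ultimately have "(\<integral>\<^sup>+z. L z * \<kappa> (norm z) \<partial>lborel) = ennreal P * (ennreal ?c * ?K)"
      using LIMSEQ_unique by auto
    then show "(\<integral>\<^sup>+z. ennreal (V z) * \<kappa> (norm z) \<partial>lborel) = ennreal (P * ?c) * ?K"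
      using P0 by (simp add: LV ennreal_mult' mult.assoc)
  qed
qed

section \<open>The covariogram defect\<close>
text \<open>The covariogram of \<open>\<Omega>\<close> is the measure of \<open>\<Omega> \<inter> (\<Omega> - y)\<close>; this is its value at \<open>0\<close> minus its value
  at \<open>y\<close>.\<close>

definition covariogram_defect :: "'a::euclidean_space set \<Rightarrow> 'a \<Rightarrow> real" where
  "covariogram_defect \<Omega> y = measure lborel {x \<in> \<Omega>. x + y \<notin> \<Omega>}"

context
  fixes \<Omega> :: "(real ^ 'n) set"
  assumes \<Omega>_open: "open \<Omega>" and \<Omega>_finite: "emeasure lborel \<Omega> < \<infinity>"
begin

lemma \<Omega>_borel [measurable]: "\<Omega> \<in> sets borel"
  using \<Omega>_open by simp

lemma emeasure_covariogram_defect: "emeasure lborel {x \<in> \<Omega>. x + y \<notin> \<Omega>} = ennreal (covariogram_defect \<Omega> y)"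
proof -
  have "emeasure lborel {x \<in> \<Omega>. x + y \<notin> \<Omega>} \<le> emeasure lborel \<Omega>"
    by (intro emeasure_mono) auto
  from le_less_trans[OF this \<Omega>_finite] show ?thesis unfolding covariogram_defect_def
    by (intro emeasure_eq_ennreal_measure) auto
qed

lemma translation_defect_covariogram: "translation_defect \<Omega> y = ennreal (2 * covariogram_defect \<Omega> y)"
  by (subst translation_defect_eq[OF \<Omega>_borel \<Omega>_finite])
     (simp add: emeasure_covariogram_defect ennreal_mult' ennreal_numeral[symmetric] del: ennreal_numeral)

lemma covariogram_defect_nonneg: "0 \<le> covariogram_defect \<Omega> y"
  by (simp add: covariogram_defect_def)

lemma covariogram_defect_le: "covariogram_defect \<Omega> y \<le> measure lborel \<Omega>"
  unfolding covariogram_defect_def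
  by (rule measure_mono_fmeasurable) (use \<Omega>_finite in \<open>auto simp: fmeasurable_def\<close>)

lemma measurable_covariogram_defect [measurable]: "covariogram_defect \<Omega> \<in> borel_measurable borel"
proof -
  have "covariogram_defect \<Omega> = (\<lambda>y. enn2real (\<integral>\<^sup>+x. indicator \<Omega> x * indicator (- \<Omega>) (x + y) \<partial>lborel))"
  proof
    fix y
    have "emeasure lborel {x \<in> \<Omega>. x + y \<notin> \<Omega>} = (\<integral>\<^sup>+x. indicator {x \<in> \<Omega>. x + y \<notin> \<Omega>} x \<partial>lborel)"
    proof (rule nn_integral_indicator[symmetric])
      have "Measurable.pred borel (\<lambda>x. x \<in> \<Omega> \<and> x + y \<notin> \<Omega>)" by measurable
      then show "{x \<in> \<Omega>. x + y \<notin> \<Omega>} \<in> sets lborel" by (simp add: pred_def)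
    qed
    also have "\<dots> = (\<integral>\<^sup>+x. indicator \<Omega> x * indicator (- \<Omega>) (x + y) \<partial>lborel)"
      by (intro nn_integral_cong) (simp add: indicator_def)
    finally show "covariogram_defect \<Omega> y = enn2real (\<integral>\<^sup>+x. indicator \<Omega> x * indicator (- \<Omega>) (x + y) \<partial>lborel)"
      by (simp add: covariogram_defect_def measure_def)
  qed
  then show ?thesis by simp
qed

text \<open>Fubini's theorem; sigma-finiteness covers both probability measures and the infinite Levy measures.\<close>

lemma nonlocal_perimeter_eq:
  assumes "sigma_finite_measure \<mu>" and sets [measurable_cong]: "sets \<mu> = sets borel"
  shows "nonlocal_perimeter \<mu> \<Omega> = (\<integral>\<^sup>+y. ennreal (covariogram_defect \<Omega> y) \<partial>\<mu>)"
proof -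
  interpret \<mu>: sigma_finite_measure \<mu> by fact
  interpret pair_sigma_finite "lborel :: (real^'n) measure" \<mu> ..
  have "nonlocal_perimeter \<mu> \<Omega> = (\<integral>\<^sup>+x. \<integral>\<^sup>+y. indicator \<Omega> x * indicator (- \<Omega>) (x + y) \<partial>\<mu> \<partial>lborel)"
    unfolding nonlocal_perimeter_def
  proof (rule nn_integral_cong)
    fix x :: "real^'n"
    have im: "(\<lambda>z. z - x) ` (- \<Omega>) = {y. x + y \<in> - \<Omega>}"
      by (auto simp: image_iff intro!: bexI[of _ "x + _"])
    have "Measurable.pred borel (\<lambda>y. x + y \<in> - \<Omega>)" by measurable
    then have m: "{y. x + y \<in> - \<Omega>} \<in> sets \<mu>" by (simp add: pred_def sets)
    have "emeasure \<mu> ((\<lambda>z. z - x) ` (- \<Omega>)) = (\<integral>\<^sup>+y. indicator (- \<Omega>) (x + y) \<partial>\<mu>)"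
      unfolding im nn_integral_indicator[OF m, symmetric] by (intro nn_integral_cong) (simp add: indicator_def)
    then show "emeasure \<mu> ((\<lambda>z. z - x) ` (- \<Omega>)) * indicator \<Omega> x = (\<integral>\<^sup>+y. indicator \<Omega> x * indicator (- \<Omega>) (x + y) \<partial>\<mu>)"
      by (simp add: nn_integral_cmult mult.commute)
  qed
  also have "\<dots> = (\<integral>\<^sup>+y. \<integral>\<^sup>+x. indicator \<Omega> x * indicator (- \<Omega>) (x + y) \<partial>lborel \<partial>\<mu>)"
    by (rule Fubini'[symmetric]) simp
  also have "\<dots> = (\<integral>\<^sup>+y. ennreal (covariogram_defect \<Omega> y) \<partial>\<mu>)"
  proof (rule nn_integral_cong)
    fix y
    have "Measurable.pred borel (\<lambda>x. x \<in> \<Omega> \<and> x + y \<notin> \<Omega>)" by measurable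
    then have m: "{x \<in> \<Omega>. x + y \<notin> \<Omega>} \<in> sets lborel" by (simp add: pred_def)
    show "(\<integral>\<^sup>+x. indicator \<Omega> x * indicator (- \<Omega>) (x + y) \<partial>lborel) = ennreal (covariogram_defect \<Omega> y)"
      unfolding emeasure_covariogram_defect[symmetric] nn_integral_indicator[OF m, symmetric]
      by (intro nn_integral_cong) (simp add: indicator_def)
  qed
  finally show ?thesis .
qed

text \<open>The defect is subadditive, since a point of \<open>\<Omega>\<close> that leaves \<open>\<Omega>\<close> after the steps \<open>a\<close> and \<open>b\<close> leaves it
  during one of them. Together with the linear bound this makes it Lipschitz.\<close>

lemma continuous_covariogram_defect:
  assumes P: "\<And>y. covariogram_defect \<Omega> y \<le> norm y * P"
  shows "continuous_on UNIV (covariogram_defect \<Omega>)"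
proof -
  have sub: "covariogram_defect \<Omega> (a + b) \<le> covariogram_defect \<Omega> a + covariogram_defect \<Omega> b" for a b
  proof -
    have m: "{x \<in> \<Omega>. x + y \<notin> \<Omega>} \<in> sets lborel" for y
    proof -
      have "Measurable.pred borel (\<lambda>x. x \<in> \<Omega> \<and> x + y \<notin> \<Omega>)" by measurable
      then show ?thesis by (simp add: pred_def)
    qed
    have m': "{x. x + a \<in> \<Omega> \<and> x + a + b \<notin> \<Omega>} \<in> sets lborel"
    proof -
      have "Measurable.pred borel (\<lambda>x. x + a \<in> \<Omega> \<and> x + a + b \<notin> \<Omega>)" by measurable
      then show ?thesis by (simp add: pred_def)
    qed
    have "emeasure lborel {x. x + a \<in> \<Omega> \<and> x + a + b \<notin> \<Omega>} = emeasure lborel {x \<in> \<Omega>. x + b \<notin> \<Omega>}"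
    proof -
      have "emeasure lborel {x. x + a \<in> \<Omega> \<and> x + a + b \<notin> \<Omega>} = (\<integral>\<^sup>+x. indicator {x \<in> \<Omega>. x + b \<notin> \<Omega>} (x + a) \<partial>lborel)"
        unfolding nn_integral_indicator[OF m', symmetric] by (intro nn_integral_cong) (simp add: indicator_def)
      also have "\<dots> = (\<integral>\<^sup>+x. indicator {x \<in> \<Omega>. x + b \<notin> \<Omega>} x \<partial>lborel)"
        using m[of b] by (intro nn_integral_translate) simp
      finally show ?thesis using m by simp
    qed
    moreover have "emeasure lborel {x \<in> \<Omega>. x + (a + b) \<notin> \<Omega>} \<le> emeasure lborel ({x \<in> \<Omega>. x + a \<notin> \<Omega>} \<union> {x. x + a \<in> \<Omega> \<and> x + a + b \<notin> \<Omega>})"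
      using m[of a] m' by (intro emeasure_mono) (auto simp: add.assoc)
    moreover have "\<dots> \<le> emeasure lborel {x \<in> \<Omega>. x + a \<notin> \<Omega>} + emeasure lborel {x. x + a \<in> \<Omega> \<and> x + a + b \<notin> \<Omega>}"
      using m[of a] m' by (intro emeasure_subadditive)
    ultimately have "ennreal (covariogram_defect \<Omega> (a + b)) \<le> ennreal (covariogram_defect \<Omega> a) + ennreal (covariogram_defect \<Omega> b)"
      unfolding emeasure_covariogram_defect by (metis (no_types, lifting) emeasure_covariogram_defect order_trans)
    then show ?thesis
      by (simp add: ennreal_plus[symmetric] covariogram_defect_nonneg del: ennreal_plus)
  qed
  have "dist (covariogram_defect \<Omega> x) (covariogram_defect \<Omega> y) \<le> (\<bar>P\<bar>) * dist x y" for x y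
  proof -
    have "covariogram_defect \<Omega> a \<le> covariogram_defect \<Omega> b + norm (a - b) * \<bar>P\<bar>" for a b
    proof -
      have "covariogram_defect \<Omega> a \<le> covariogram_defect \<Omega> b + covariogram_defect \<Omega> (a - b)"
        using sub[of b "a - b"] by simp
      also have "covariogram_defect \<Omega> (a - b) \<le> norm (a - b) * \<bar>P\<bar>"
        by (rule order_trans[OF P]) (simp add: mult_left_mono)
      finally show ?thesis by simp
    qed
    from this[of x y] this[of y x] show ?thesis
      by (simp add: dist_real_def dist_norm norm_minus_commute abs_le_iff mult.commute)
  qed
  then have "\<bar>P\<bar>-lipschitz_on UNIV (covariogram_defect \<Omega>)" by (intro lipschitz_onI) auto
  then show ?thesis by (rule lipschitz_on_continuous_on)
qed

end

section \<open>The power tails of the stable profile\<close>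
lemma nn_integral_powr_unit_interval:
  assumes "s < 1"
  shows "(\<integral>\<^sup>+r. ennreal (indicator {0..1} r * r powr (- s)) \<partial>halfline) = ennreal (1 / (1 - s))"
proof -
  have "((\<lambda>r. r powr (- s)) has_integral (1 powr (- s + 1) / (- s + 1))) {0..1}"
    using assms by (intro has_integral_powr_from_0) auto
  then have "((\<lambda>r. r powr (- s)) has_integral (1 / (1 - s))) {0..1::real}" by simp
  from nn_integral_has_integral_lebesgue'[OF _ this]
  have "(\<integral>\<^sup>+r. ennreal (r powr (- s)) * indicator {0..1} r \<partial>lborel) = ennreal (1 / (1 - s))" by simp
  moreover have "(\<integral>\<^sup>+r. ennreal (indicator {0..1} r * r powr (- s)) \<partial>halfline) = (\<integral>\<^sup>+r. ennreal (r powr (- s)) * indicator {0..1} r \<partial>lborel)"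
  proof -
    have "AE r in lborel. ennreal (indicator {0..1} r * r powr (- s)) * indicator {0<..} r = ennreal (r powr (- s)) * indicator {0..1} r"
      using AE_lborel_singleton[of "0::real"] by eventually_elim (auto simp: indicator_def)
    then show ?thesis by (subst nn_integral_halfline) (auto intro!: nn_integral_cong_AE)
  qed
  ultimately show ?thesis by simp
qed

lemma nn_integral_powr_tail:
  assumes "1 < s"
  shows "(\<integral>\<^sup>+r. ennreal (indicator {1<..} r * r powr (- s)) \<partial>halfline) = ennreal (1 / (s - 1))"
proof -
  have "((\<lambda>r. r powr (- s)) has_integral (- (1 powr (- s + 1)) / (- s + 1))) {1..}"
    using assms by (intro has_integral_powr_to_inf) auto
  moreover have "- (1 powr (- s + 1)) / (- s + 1) = 1 / (s - 1)" using assms by (simp add: divide_simps)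
  ultimately have "((\<lambda>r. r powr (- s)) has_integral (1 / (s - 1))) {1::real..}" by simp
  from nn_integral_has_integral_lebesgue'[OF _ this]
  have "(\<integral>\<^sup>+r. ennreal (r powr (- s)) * indicator {1..} r \<partial>lborel) = ennreal (1 / (s - 1))" by simp
  moreover have "(\<integral>\<^sup>+r. ennreal (indicator {1<..} r * r powr (- s)) \<partial>halfline) = (\<integral>\<^sup>+r. ennreal (r powr (- s)) * indicator {1..} r \<partial>lborel)"
  proof -
    have "AE r in lborel. ennreal (indicator {1<..} r * r powr (- s)) * indicator {0<..} r = ennreal (r powr (- s)) * indicator {1..} r"
      using AE_lborel_singleton[of "1::real"] by eventually_elim (auto simp: indicator_def)
    then show ?thesis by (subst nn_integral_halfline) (auto intro!: nn_integral_cong_AE)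
  qed
  ultimately show ?thesis by simp
qed

lemma
  assumes "s < 1"
  shows integrable_powr_unit_interval: "integrable halfline (\<lambda>r. indicator {0..1} r * r powr (- s) :: real)"
    and integral_powr_unit_interval: "(\<integral>r. indicator {0..1} r * r powr (- s) \<partial>halfline) = 1 / (1 - s)"
  using nn_integral_powr_unit_interval[OF assms] assms
  by (auto intro!: integrableI_bounded simp: abs_mult integral_eq_nn_integral)

lemma
  assumes "1 < s"
  shows integrable_powr_tail: "integrable halfline (\<lambda>r. indicator {1<..} r * r powr (- s) :: real)"
    and integral_powr_tail: "(\<integral>r. indicator {1<..} r * r powr (- s) \<partial>halfline) = 1 / (s - 1)"
  using nn_integral_powr_tail[OF assms] assms
  by (auto intro!: integrableI_bounded simp: abs_mult integral_eq_nn_integral)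

lemma a_coeff_0 [simp]: "a_coeff d \<alpha> 0 = 0"
  by (simp add: a_coeff_def)

text \<open>The reflection formula \<open>\<Gamma>(- s/2) \<Gamma>(1 + s/2) = - \<pi> / sin (\<pi> s / 2)\<close> exchanges the Gamma
  factor in the denominator of the Levy constant for the sine and the Gamma factor in \<open>a\<^sub>n\<close>. The
  restriction \<open>s < 1\<close> makes the sine positive.\<close>

lemma a_coeff_stable_constant:
  assumes s: "0 < real n * \<alpha>" "real n * \<alpha> < 1"
  shows "(-1) ^ (n - 1) / fact n * stable_constant d (real n * \<alpha>) = a_coeff d \<alpha> n"
proof -
  define s where "s = real n * \<alpha>"
  have s: "0 < s" "s < 1" using assms by (simp_all add: s_def)
  have sin: "0 < sin (pi * s / 2)" using s pi_gt_zero by (intro sin_gt_zero) (auto simp: field_simps)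
  have "Gamma x * Gamma (1 - x) = pi / sin (pi * x)" for x :: real
  proof -
    have "complex_of_real (Gamma x * Gamma (1 - x)) = complex_of_real (pi / sin (pi * x))"
      using Gamma_reflection_complex[of "complex_of_real x"]
      by (metis Gamma_complex_of_real of_real_1 of_real_diff of_real_divide of_real_mult sin_of_real)
    then show ?thesis by (simp only: of_real_eq_iff)
  qed
  from this[of "- s / 2"] have r: "Gamma (- s / 2) * Gamma (1 + s / 2) = - (pi / sin (pi * s / 2))" by simp
  define A where "A = \<bar>Gamma (- s / 2)\<bar>"
  define B where "B = Gamma (1 + s / 2)"
  define S where "S = sin (pi * s / 2)"
  have B: "0 < B" unfolding B_def using s by (intro Gamma_real_pos) auto
  have S: "0 < S" using sin by (simp add: S_def)
  have "A * B = \<bar>Gamma (- s / 2) * B\<bar>" using B by (simp add: A_def abs_mult)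
  also have "\<dots> = pi / S" unfolding B_def S_def[symmetric] r using S by (simp add: S_def)
  finally have AB: "A * B = pi / S" .
  have "A * (B * S / pi) = A * B * (S / pi)" by (simp only: mult.assoc times_divide_eq_right)
  also have "\<dots> = 1" unfolding AB using S by simp
  finally have inv: "inverse A = B * S / pi" by (rule inverse_unique)
  have div: "X / (Y * Z) = X / Y * inverse Z" for X Y Z :: real
    by (simp add: divide_inverse)
  have "stable_constant d s = 2 powr s * Gamma ((real d + s) / 2) / pi powr (real d / 2) * inverse A"
    unfolding stable_constant_def A_def by (rule div)
  then have "stable_constant d s = 2 powr s * Gamma ((real d + s) / 2) / pi powr (real d / 2) * (Gamma (1 + s / 2) * sin (pi * s / 2) / pi)"
    unfolding inv B_def S_def .
  then show ?thesis
    unfolding a_coeff_def s_def by (simp add: powr_add add.commute mult_ac)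
qed

lemma stable_constant_nonneg:
  assumes "0 < s"
  shows "0 \<le> stable_constant d s"
proof -
  have "0 < Gamma ((real d + s) / 2)" using assms by (intro Gamma_real_pos) (auto intro: add_nonneg_pos)
  then show ?thesis unfolding stable_constant_def by (intro divide_nonneg_nonneg mult_nonneg_nonneg) auto
qed

lemma summable_abs_a_coeff:
  assumes "0 < d" "0 < \<alpha>" "\<alpha> < 1"
  shows "summable (\<lambda>n. \<bar>a_coeff d \<alpha> n\<bar>)"
  using stable_profile_series(1)[OF assms(1) _ assms(2,3), of 1] by simp

text \<open>The coefficients are absolutely summable, being the terms of the series of the profile at \<open>r = 1\<close>, and the
  denominators tend to infinity.\<close>

lemma summable_a_coeff_div:
  assumes "0 < d" and \<alpha>: "0 < \<alpha>" "\<alpha> < 1"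
  shows "summable (\<lambda>n. a_coeff d \<alpha> (Suc n) / (1 - real (Suc n) * \<alpha>))"
proof (rule summable_comparison_test_ev)
  show "summable (\<lambda>n. \<bar>a_coeff d \<alpha> (Suc n)\<bar>)"
    using summable_abs_a_coeff[OF assms] by (subst summable_Suc_iff)
  obtain m :: nat where m: "2 / \<alpha> \<le> real m" using real_arch_simple by blast
  have "norm (a_coeff d \<alpha> (Suc n) / (1 - real (Suc n) * \<alpha>)) \<le> \<bar>a_coeff d \<alpha> (Suc n)\<bar>" if "m \<le> n" for n
  proof -
    have "2 / \<alpha> \<le> real (Suc n)" using m that by simp
    then have "2 \<le> real (Suc n) * \<alpha>" using \<alpha> by (simp add: field_simps)
    then have "1 \<le> \<bar>1 - real (Suc n) * \<alpha>\<bar>" by linarith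
    then have "\<bar>a_coeff d \<alpha> (Suc n)\<bar> / \<bar>1 - real (Suc n) * \<alpha>\<bar> \<le> \<bar>a_coeff d \<alpha> (Suc n)\<bar> / 1"
      by (intro divide_left_mono) auto
    then show ?thesis by simp
  qed
  then show "\<forall>\<^sub>F n in sequentially. norm (a_coeff d \<alpha> (Suc n) / (1 - real (Suc n) * \<alpha>)) \<le> \<bar>a_coeff d \<alpha> (Suc n)\<bar>"
    by (auto simp: eventually_sequentially)
qed

definition profile_remainder :: "nat \<Rightarrow> real \<Rightarrow> nat \<Rightarrow> real \<Rightarrow> real" where
  "profile_remainder d \<alpha> N r = stable_profile d \<alpha> r - (\<Sum>n=1..N. a_coeff d \<alpha> n * r powr (- real d - real n * \<alpha>))"

lemma measurable_profile_remainder [measurable]: "profile_remainder d \<alpha> N \<in> borel_measurable borel"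
  unfolding profile_remainder_def[abs_def] by measurable

lemma powr_times_dimension: "0 < r \<Longrightarrow> r powr (- real d - e) * r ^ d = r powr (- e)"
  by (simp add: powr_realpow[symmetric] powr_add[symmetric])

context
  fixes d N :: nat and \<alpha> C :: real
  assumes d: "0 < d" and \<alpha>: "0 < \<alpha>" "\<alpha> < 1" and N: "real N * \<alpha> < 1" "1 < real (Suc N) * \<alpha>"
    and C: "\<And>r. 0 < r \<Longrightarrow> r \<le> 1 \<Longrightarrow> \<bar>stable_profile d \<alpha> r\<bar> \<le> C"
begin

text \<open>The remainder will be integrated in two forms: on \<open>(1, \<infinity>)\<close> as a tail of the series, all of whose
  terms are integrable there, and on \<open>(0, 1]\<close> as the bounded profile minus finitely many powers that are
  integrable at the origin.\<close>

lemma profile_remainder_sums: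
  assumes r: "0 < r"
  shows "(\<lambda>n. a_coeff d \<alpha> (n + Suc N) * r powr (- (real (n + Suc N) * \<alpha>))) sums (profile_remainder d \<alpha> N r * r ^ d)"
proof -
  let ?f = "\<lambda>n. a_coeff d \<alpha> n * r powr (- real d - real n * \<alpha>)"
  have "(\<lambda>n. ?f (n + Suc N)) sums (stable_profile d \<alpha> r - (\<Sum>n<Suc N. ?f n))"
    by (rule sums_split_initial_segment[OF stable_profile_series(2)[OF d r \<alpha>]])
  moreover have "(\<Sum>n<Suc N. ?f n) = (\<Sum>n=1..N. ?f n)"
    by (rule sum.mono_neutral_cong_right) (auto simp: not_le)
  ultimately have "(\<lambda>n. ?f (n + Suc N)) sums profile_remainder d \<alpha> N r"
    by (simp only: profile_remainder_def)
  from sums_mult2[OF this, of "r ^ d"] show ?thesis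
    by (simp only: mult.assoc powr_times_dimension[OF r])
qed

lemma profile_remainder_near:
  assumes r: "0 < r"
  shows "profile_remainder d \<alpha> N r * r ^ d = stable_profile d \<alpha> r * r ^ d - (\<Sum>n=1..N. a_coeff d \<alpha> n * r powr (- (real n * \<alpha>)))"
  unfolding profile_remainder_def left_diff_distrib sum_distrib_right mult.assoc powr_times_dimension[OF r] ..

lemma n\<alpha>_less: "n \<le> N \<Longrightarrow> real n * \<alpha> < 1"
  using N(1) \<alpha> by (meson le_less_trans less_imp_le mult_right_mono of_nat_mono)

lemma n\<alpha>_greater: "1 < real (n + Suc N) * \<alpha>"
proof -
  have "real (Suc N) * \<alpha> \<le> real (n + Suc N) * \<alpha>" using \<alpha> by (intro mult_right_mono) auto
  then show ?thesis using N(2) by linarith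
qed

lemma integrable_profile_near: "integrable halfline (\<lambda>r. indicator {0..1} r * (stable_profile d \<alpha> r * r ^ d))"
proof (rule Bochner_Integration.integrable_bound[OF integrable_mult_right[OF integrable_powr_unit_interval[of 0], of C]])
  show "AE r in halfline. norm (indicator {0..1} r * (stable_profile d \<alpha> r * r ^ d)) \<le> norm (C * (indicator {0..1} r * r powr (- 0)))"
    using AE_halfline
  proof eventually_elim
    case (elim r)
    show ?case
    proof (cases "r \<le> 1")
      case True
      have "\<bar>stable_profile d \<alpha> r\<bar> * r ^ d \<le> C * 1"
        using C[OF elim True] elim True by (intro mult_mono power_le_one) auto
      then show ?thesis using elim True by (simp add: abs_mult)
    qed simp
  qed
qed auto

lemma
  shows integrable_remainder_near: "integrable halfline (\<lambda>r. indicator {0..1} r * (profile_remainder d \<alpha> N r * r ^ d))"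
    and integral_remainder_near: "(\<integral>r. indicator {0..1} r * (profile_remainder d \<alpha> N r * r ^ d) \<partial>halfline)
      = (\<integral>r. indicator {0..1} r * (stable_profile d \<alpha> r * r ^ d) \<partial>halfline) - (\<Sum>n=1..N. a_coeff d \<alpha> n / (1 - real n * \<alpha>))"
proof -
  let ?g = "\<lambda>r::real. indicator {0..1} r * (stable_profile d \<alpha> r * r ^ d) - (\<Sum>n=1..N. a_coeff d \<alpha> n * (indicator {0..1} r * r powr (- (real n * \<alpha>))))"
  have e: "AE r in halfline. indicator {0..1} r * (profile_remainder d \<alpha> N r * r ^ d) = ?g r"
    using AE_halfline by eventually_elim (simp only: profile_remainder_near right_diff_distrib sum_distrib_left mult.left_commute)
  have ii: "integrable halfline (\<lambda>r. a_coeff d \<alpha> n * (indicator {0..1} r * r powr (- (real n * \<alpha>))))" if "n \<in> {1..N}" for n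
    using n\<alpha>_less[of n] that by (intro integrable_mult_right integrable_powr_unit_interval) auto
  have ig: "integrable halfline ?g"
    by (intro Bochner_Integration.integrable_diff integrable_profile_near Bochner_Integration.integrable_sum ii)
  then show "integrable halfline (\<lambda>r. indicator {0..1} r * (profile_remainder d \<alpha> N r * r ^ d))"
    using e by (subst integrable_cong_AE) auto
  have "(\<integral>r. indicator {0..1} r * (profile_remainder d \<alpha> N r * r ^ d) \<partial>halfline) = (\<integral>r. ?g r \<partial>halfline)"
    by (rule integral_cong_AE[OF _ _ e]) auto
  also have "\<dots> = (\<integral>r. indicator {0..1} r * (stable_profile d \<alpha> r * r ^ d) \<partial>halfline)
      - (\<integral>r. (\<Sum>n=1..N. a_coeff d \<alpha> n * (indicator {0..1} r * r powr (- (real n * \<alpha>)))) \<partial>halfline)"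
    by (intro Bochner_Integration.integral_diff integrable_profile_near Bochner_Integration.integrable_sum ii)
  also have "(\<integral>r. (\<Sum>n=1..N. a_coeff d \<alpha> n * (indicator {0..1} r * r powr (- (real n * \<alpha>)))) \<partial>halfline)
     = (\<Sum>n=1..N. \<integral>r. a_coeff d \<alpha> n * (indicator {0..1} r * r powr (- (real n * \<alpha>))) \<partial>halfline)"
    by (rule Bochner_Integration.integral_sum[OF ii])
  also have "\<dots> = (\<Sum>n=1..N. a_coeff d \<alpha> n / (1 - real n * \<alpha>))"
  proof (rule sum.cong[OF refl])
    fix n assume "n \<in> {1..N}"
    then have "real n * \<alpha> < 1" by (intro n\<alpha>_less) auto
    then show "(\<integral>r. a_coeff d \<alpha> n * (indicator {0..1} r * r powr (- (real n * \<alpha>))) \<partial>halfline) = a_coeff d \<alpha> n / (1 - real n * \<alpha>)"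
      by (subst integral_mult_right_zero, subst integral_powr_unit_interval) auto
  qed
  finally show "(\<integral>r. indicator {0..1} r * (profile_remainder d \<alpha> N r * r ^ d) \<partial>halfline)
      = (\<integral>r. indicator {0..1} r * (stable_profile d \<alpha> r * r ^ d) \<partial>halfline) - (\<Sum>n=1..N. a_coeff d \<alpha> n / (1 - real n * \<alpha>))" .
qed

lemma
  shows integrable_remainder_far: "integrable halfline (\<lambda>r. indicator {1<..} r * (profile_remainder d \<alpha> N r * r ^ d))"
    and remainder_far_sums: "(\<lambda>n. a_coeff d \<alpha> (n + Suc N) / (real (n + Suc N) * \<alpha> - 1)) sums
      (\<integral>r. indicator {1<..} r * (profile_remainder d \<alpha> N r * r ^ d) \<partial>halfline)"
proof -
  let ?f = "\<lambda>n r::real. a_coeff d \<alpha> (n + Suc N) * (indicator {1<..} r * r powr (- (real (n + Suc N) * \<alpha>)))"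
  have if': "integrable halfline (?f n)" for n
    by (intro integrable_mult_right integrable_powr_tail n\<alpha>_greater)
  have sm: "AE r in halfline. (\<lambda>n. ?f n r) sums (indicator {1<..} r * (profile_remainder d \<alpha> N r * r ^ d))"
    using AE_halfline
  proof eventually_elim
    case (elim r)
    from sums_mult[OF profile_remainder_sums[OF elim], of "indicator {1<..} r"] show ?case
      by (simp only: mult.left_commute)
  qed
  have sa: "summable (\<lambda>n. \<bar>a_coeff d \<alpha> (n + Suc N)\<bar>)"
    using summable_abs_a_coeff[OF d \<alpha>] by (rule summable_ignore_initial_segment)
  have smn: "AE r in halfline. summable (\<lambda>n. norm (?f n r))"
  proof (rule AE_I2)
    fix r :: real
    show "summable (\<lambda>n. norm (?f n r))"
    proof (rule summable_comparison_test_ev[OF always_eventually sa], intro allI)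
      fix n
      have "\<bar>indicator {1<..} r * r powr (- (real (n + Suc N) * \<alpha>))\<bar> \<le> 1"
      proof (cases "1 < r")
        case True
        have "r powr (- (real (n + Suc N) * \<alpha>)) \<le> r powr 0"
          using True \<alpha> by (intro powr_mono) auto
        then show ?thesis using True by simp
      qed simp
      then have "\<bar>a_coeff d \<alpha> (n + Suc N)\<bar> * \<bar>indicator {1<..} r * r powr (- (real (n + Suc N) * \<alpha>))\<bar> \<le> \<bar>a_coeff d \<alpha> (n + Suc N)\<bar> * 1"
        by (rule mult_left_mono) simp
      then show "norm (norm (?f n r)) \<le> \<bar>a_coeff d \<alpha> (n + Suc N)\<bar>" by (simp add: abs_mult)
    qed
  qed
  have nint: "(\<integral>r. norm (?f n r) \<partial>halfline) = \<bar>a_coeff d \<alpha> (n + Suc N)\<bar> * (1 / (real (n + Suc N) * \<alpha> - 1))" for n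
  proof -
    have "(\<integral>r. norm (?f n r) \<partial>halfline) = (\<integral>r. \<bar>a_coeff d \<alpha> (n + Suc N)\<bar> * (indicator {1<..} r * r powr (- (real (n + Suc N) * \<alpha>))) \<partial>halfline)"
      by (intro Bochner_Integration.integral_cong refl) (simp add: abs_mult)
    then show ?thesis
      by (simp only: integral_mult_right_zero integral_powr_tail[OF n\<alpha>_greater])
  qed
  have snint: "summable (\<lambda>n. \<integral>r. norm (?f n r) \<partial>halfline)"
    unfolding nint
  proof (rule summable_comparison_test_ev[OF always_eventually summable_mult2[OF sa, of "1 / (real (Suc N) * \<alpha> - 1)"]], intro allI)
    fix n
    have "real (Suc N) * \<alpha> \<le> real (n + Suc N) * \<alpha>" using \<alpha> by (intro mult_right_mono) auto
    then have "1 / (real (n + Suc N) * \<alpha> - 1) \<le> 1 / (real (Suc N) * \<alpha> - 1)"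
      using N(2) by (intro divide_left_mono mult_pos_pos) auto
    then show "norm (\<bar>a_coeff d \<alpha> (n + Suc N)\<bar> * (1 / (real (n + Suc N) * \<alpha> - 1))) \<le> \<bar>a_coeff d \<alpha> (n + Suc N)\<bar> * (1 / (real (Suc N) * \<alpha> - 1))"
      using n\<alpha>_greater[of n] by (simp only: real_norm_def abs_mult abs_abs abs_of_pos divide_pos_pos zero_less_one diff_gt_0_iff_gt mult_left_mono abs_ge_zero)
  qed
  have eq: "AE r in halfline. (\<Sum>n. ?f n r) = indicator {1<..} r * (profile_remainder d \<alpha> N r * r ^ d)"
    using sm by eventually_elim (simp add: sums_iff)
  have "integrable halfline (\<lambda>r. \<Sum>n. ?f n r)"
    by (rule integrable_suminf[OF if' smn snint])
  then show "integrable halfline (\<lambda>r. indicator {1<..} r * (profile_remainder d \<alpha> N r * r ^ d))"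
    using eq by (subst integrable_cong_AE[where g = "\<lambda>r. \<Sum>n. ?f n r"]) (auto elim: eventually_mono)
  have "(\<lambda>n. \<integral>r. ?f n r \<partial>halfline) sums (\<integral>r. (\<Sum>n. ?f n r) \<partial>halfline)"
    by (rule sums_integral[OF if' smn snint])
  moreover have "(\<integral>r. (\<Sum>n. ?f n r) \<partial>halfline) = (\<integral>r. indicator {1<..} r * (profile_remainder d \<alpha> N r * r ^ d) \<partial>halfline)"
    by (rule integral_cong_AE[OF _ _ eq]) measurable
  moreover have "(\<integral>r. ?f n r \<partial>halfline) = a_coeff d \<alpha> (n + Suc N) / (real (n + Suc N) * \<alpha> - 1)" for n
    by (simp only: integral_mult_right_zero integral_powr_tail[OF n\<alpha>_greater]) simp
  ultimately show "(\<lambda>n. a_coeff d \<alpha> (n + Suc N) / (real (n + Suc N) * \<alpha> - 1)) sums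
      (\<integral>r. indicator {1<..} r * (profile_remainder d \<alpha> N r * r ^ d) \<partial>halfline)"
    by simp
qed

text \<open>Both pieces contribute terms of the same shape: \<open>r powr (- n \<alpha>)\<close> integrates to \<open>1 / (1 - n \<alpha>)\<close> on
  \<open>(0, 1]\<close> if \<open>n \<alpha> < 1\<close> and to \<open>- 1 / (1 - n \<alpha>)\<close> on \<open>(1, \<infinity>)\<close> if \<open>n \<alpha> > 1\<close>, and the terms with
  \<open>n \<le> N\<close> enter the remainder with a minus sign. So they fit together to one series.\<close>

lemma
  shows integrable_profile_remainder: "integrable halfline (\<lambda>r. profile_remainder d \<alpha> N r * r ^ d)"
    and integral_profile_remainder: "(\<integral>r. profile_remainder d \<alpha> N r * r ^ d \<partial>halfline)
      = (\<integral>r. indicator {0..1} r * (stable_profile d \<alpha> r * r ^ d) \<partial>halfline) - (\<Sum>n. a_coeff d \<alpha> (Suc n) / (1 - real (Suc n) * \<alpha>))"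
proof -
  let ?F = "\<lambda>r. profile_remainder d \<alpha> N r * r ^ d"
  let ?h = "\<lambda>r. indicator {0..1} r * ?F r + indicator {1<..} r * ?F r"
  have e: "AE r in halfline. ?F r = ?h r"
    using AE_halfline by eventually_elim (auto simp: indicator_def)
  have "integrable halfline ?h"
    by (intro Bochner_Integration.integrable_add integrable_remainder_near integrable_remainder_far)
  then show "integrable halfline ?F"
    using e by (subst integrable_cong_AE) auto
  let ?b = "\<lambda>n. a_coeff d \<alpha> (Suc n) / (1 - real (Suc n) * \<alpha>)"
  have "(\<integral>r. ?F r \<partial>halfline) = (\<integral>r. ?h r \<partial>halfline)"
    by (rule integral_cong_AE[OF _ _ e]) auto
  also have "\<dots> = (\<integral>r. indicator {0..1} r * ?F r \<partial>halfline) + (\<integral>r. indicator {1<..} r * ?F r \<partial>halfline)"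
    by (intro Bochner_Integration.integral_add integrable_remainder_near integrable_remainder_far)
  also have "(\<integral>r. indicator {1<..} r * ?F r \<partial>halfline) = - (\<Sum>n. ?b (n + N))"
  proof -
    have "(\<integral>r. indicator {1<..} r * ?F r \<partial>halfline) = (\<Sum>n. a_coeff d \<alpha> (n + Suc N) / (real (n + Suc N) * \<alpha> - 1))"
      using remainder_far_sums by (simp add: sums_iff)
    also have "\<dots> = (\<Sum>n. - ?b (n + N))"
    proof (rule suminf_cong)
      fix n
      have "1 - real (Suc (n + N)) * \<alpha> = - (real (n + Suc N) * \<alpha> - 1)" by simp
      then show "a_coeff d \<alpha> (n + Suc N) / (real (n + Suc N) * \<alpha> - 1) = - ?b (n + N)"
        by (simp only: divide_minus_right add_Suc_right minus_minus)
    qed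
    also have "\<dots> = - (\<Sum>n. ?b (n + N))"
      by (rule suminf_minus[OF summable_ignore_initial_segment[OF summable_a_coeff_div[OF d \<alpha>]]])
    finally show ?thesis .
  qed
  also have "(\<integral>r. indicator {0..1} r * ?F r \<partial>halfline) = (\<integral>r. indicator {0..1} r * (stable_profile d \<alpha> r * r ^ d) \<partial>halfline) - (\<Sum>n<N. ?b n)"
  proof -
    have "(\<Sum>n=1..N. a_coeff d \<alpha> n / (1 - real n * \<alpha>)) = (\<Sum>n<N. ?b n)"
      by (rule sum.reindex_bij_witness[of _ Suc "\<lambda>n. n - 1"]) auto
    then show ?thesis by (simp only: integral_remainder_near)
  qed
  finally show "(\<integral>r. ?F r \<partial>halfline)
      = (\<integral>r. indicator {0..1} r * (stable_profile d \<alpha> r * r ^ d) \<partial>halfline) - (\<Sum>n. ?b n)"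
    using suminf_split_initial_segment[OF summable_a_coeff_div[OF d \<alpha>], of N] by simp
qed

end

section \<open>The small-time limit\<close>
text \<open>The kernel of a nonlocal perimeter of index \<open>s < 1\<close> integrates any bounded function that vanishes at
  the origin at least linearly.\<close>

lemma integrable_riesz_min:
  assumes s: "0 < s" "s < 1"
  shows "integrable lborel (\<lambda>z::real^'n. min 1 (norm z) * norm z powr (- real CARD('n) - s))"
proof (rule integrableI_bounded)
  let ?d = "CARD('n)"
  let ?\<kappa> = "\<lambda>r. ennreal (min 1 r / r * r powr (- real ?d - s))"
  have "(\<integral>\<^sup>+r. ?\<kappa> r * ennreal (r ^ ?d) \<partial>halfline)
      \<le> (\<integral>\<^sup>+r. ennreal (indicator {0..1} r * r powr (- s)) + ennreal (indicator {1<..} r * r powr (- (1 + s))) \<partial>halfline)"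
  proof (rule nn_integral_halfline_mono)
    fix r :: real assume r: "0 < r"
    have "r powr (- real ?d - s) * r ^ ?d = r powr (- s)"
      using r by (simp add: powr_realpow[symmetric] powr_add[symmetric])
    then have "?\<kappa> r * ennreal (r ^ ?d) = ennreal (min 1 r / r * r powr (- s))"
      using r by (simp add: ennreal_mult'[symmetric] mult.assoc del: times_divide_eq_left)
    also have "min 1 r / r * r powr (- s) = indicator {0..1} r * r powr (- s) + indicator {1<..} r * r powr (- (1 + s))"
    proof (cases "r \<le> 1")
      case False
      have "r powr (- s) / r = r powr (- s - 1)" using r by (simp add: powr_diff)
      also have "- s - 1 = - (1 + s)" by simp
      finally show ?thesis using r False by simp
    qed (use r in auto)
    finally show "?\<kappa> r * ennreal (r ^ ?d) \<le> ennreal (indicator {0..1} r * r powr (- s)) + ennreal (indicator {1<..} r * r powr (- (1 + s)))"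
      by simp
  qed
  also have "\<dots> = ennreal (1 / (1 - s)) + ennreal (1 / (1 + s - 1))"
    using s by (subst nn_integral_add) (simp_all only: nn_integral_powr_unit_interval nn_integral_powr_tail, auto)
  also have "\<dots> < \<infinity>" by simp
  finally have "(\<integral>\<^sup>+z. ennreal (norm z) * ?\<kappa> (norm z) \<partial>(lborel :: (real ^ 'n) measure)) < \<infinity>"
    by (intro nn_integral_norm_radial_finite) auto
  moreover have "(\<integral>\<^sup>+z. ennreal (norm (min 1 (norm z) * norm z powr (- real ?d - s))) \<partial>(lborel :: (real ^ 'n) measure))
      = (\<integral>\<^sup>+z. ennreal (norm z) * ?\<kappa> (norm z) \<partial>(lborel :: (real ^ 'n) measure))"
  proof (rule nn_integral_cong)
    fix z :: "real^'n"
    show "ennreal (norm (min 1 (norm z) * norm z powr (- real ?d - s))) = ennreal (norm z) * ?\<kappa> (norm z)"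
      by (cases "z = 0") (simp_all add: ennreal_mult'[symmetric] abs_mult)
  qed
  ultimately show "(\<integral>\<^sup>+z. ennreal (norm (min 1 (norm z) * norm z powr (- real ?d - s))) \<partial>(lborel :: (real ^ 'n) measure)) < \<infinity>"
    by simp
qed measurable

text \<open>Splitting the kernel into positive and negative part extends the radial formula of
  \<open>directional_variation\<close> from nonnegative to signed kernels.\<close>

lemma integral_radial_signed:
  fixes V :: "real ^ 'n \<Rightarrow> real" and \<kappa> :: "real \<Rightarrow> real"
  assumes V [measurable]: "V \<in> borel_measurable borel" and V0: "\<And>z. 0 \<le> V z" and c: "0 \<le> c"
    and rad: "\<And>\<kappa>. \<kappa> \<in> borel_measurable borel \<Longrightarrow> (\<integral>\<^sup>+r. \<kappa> r * ennreal (r ^ CARD('n)) \<partial>halfline) < \<infinity> \<Longrightarrow>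
        (\<integral>\<^sup>+z. ennreal (V z) * \<kappa> (norm z) \<partial>lborel) = ennreal c * (\<integral>\<^sup>+r. \<kappa> r * ennreal (r ^ CARD('n)) \<partial>halfline)"
    and [measurable]: "\<kappa> \<in> borel_measurable borel"
    and int: "integrable halfline (\<lambda>r. \<kappa> r * r ^ CARD('n))" "integrable lborel (\<lambda>z. V z * \<kappa> (norm z))"
  shows "(\<integral>z. V z * \<kappa> (norm z) \<partial>lborel) = c * (\<integral>r. \<kappa> r * r ^ CARD('n) \<partial>halfline)"
proof -
  let ?d = "CARD('n)"
  have part: "(\<integral>\<^sup>+z. ennreal (V z * h (norm z)) \<partial>lborel) = ennreal c * (\<integral>\<^sup>+r. ennreal (h r * r ^ ?d) \<partial>halfline)"
    if h: "h \<in> borel_measurable borel" and le: "\<And>r. \<bar>h r\<bar> = \<bar>\<kappa> r\<bar>" for h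
  proof -
    note h [measurable]
    have e: "(\<integral>\<^sup>+r. ennreal (h r) * ennreal (r ^ ?d) \<partial>halfline) = (\<integral>\<^sup>+r. ennreal (h r * r ^ ?d) \<partial>halfline)"
      by (intro nn_integral_halfline_cong) (simp add: ennreal_mult'')
    have "(\<integral>\<^sup>+r. ennreal (h r * r ^ ?d) \<partial>halfline) \<le> (\<integral>\<^sup>+r. ennreal (norm (\<kappa> r * r ^ ?d)) \<partial>halfline)"
      using le by (intro nn_integral_halfline_mono ennreal_leI) (simp add: abs_mult, metis abs_ge_self mult_right_mono zero_le_power less_imp_le)
    also have "\<dots> < \<infinity>" using int(1) by (simp add: integrable_iff_bounded)
    finally have "(\<integral>\<^sup>+r. ennreal (h r) * ennreal (r ^ ?d) \<partial>halfline) < \<infinity>" by (simp only: e)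
    from rad[OF _ this] have "(\<integral>\<^sup>+z. ennreal (V z) * ennreal (h (norm z)) \<partial>lborel) = ennreal c * (\<integral>\<^sup>+r. ennreal (h r) * ennreal (r ^ ?d) \<partial>halfline)"
      by simp
    then show ?thesis unfolding e using V0 by (simp add: ennreal_mult')
  qed
  have "(\<integral>z. V z * \<kappa> (norm z) \<partial>lborel) = enn2real (\<integral>\<^sup>+z. ennreal (V z * \<kappa> (norm z)) \<partial>lborel) - enn2real (\<integral>\<^sup>+z. ennreal (- (V z * \<kappa> (norm z))) \<partial>lborel)"
    by (rule real_lebesgue_integral_def[OF int(2)])
  also have "\<dots> = enn2real (ennreal c * (\<integral>\<^sup>+r. ennreal (\<kappa> r * r ^ ?d) \<partial>halfline)) - enn2real (ennreal c * (\<integral>\<^sup>+r. ennreal (- (\<kappa> r * r ^ ?d)) \<partial>halfline))"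
    using part[of \<kappa>] part[of "\<lambda>r. - \<kappa> r"] by simp
  also have "\<dots> = c * (\<integral>r. \<kappa> r * r ^ ?d \<partial>halfline)"
    unfolding real_lebesgue_integral_def[OF int(1)] using c by (simp add: enn2real_mult right_diff_distrib)
  finally show ?thesis .
qed

theorem theorem3:
  fixes \<alpha> :: real
    and \<Omega> :: "(real ^ 'n) set"
    and p :: "real \<Rightarrow> (real ^ 'n) measure"
    and p1 :: "real ^ 'n \<Rightarrow> real"
    and k :: 'n
  assumes "0 < \<alpha>" and "\<alpha> < 1" and "1 / \<alpha> \<notin> \<nat>"
    and "open \<Omega>" and "emeasure lborel \<Omega> < \<infinity>" and "perimeter \<Omega> < \<infinity>"
    and "stable_semigroup \<alpha> p"
    and "continuous_density (p 1) p1"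
  shows "(\<forall>n\<in>{1..nat \<lfloor>1 / \<alpha>\<rfloor>}.
            nonlocal_perimeter (stable_levy_measure (real n * \<alpha>)) \<Omega> < \<infinity>) \<and>
         summable (\<lambda>n. a_coeff CARD('n) \<alpha> (Suc n) / (1 - real (Suc n) * \<alpha>)) \<and>
         ((\<lambda>t. t powr (- 1 / \<alpha>) *
              (heat_loss p \<Omega> t -
               (\<Sum>n = 1..nat \<lfloor>1 / \<alpha>\<rfloor>. (-1) ^ (n - 1) / fact n * t ^ n *
                  enn2real (nonlocal_perimeter (stable_levy_measure (real n * \<alpha>)) \<Omega>))))
          \<longlongrightarrow>
            pi powr ((real CARD('n) - 1) / 2) / Gamma ((real CARD('n) + 1) / 2) *
            real_of_ereal (perimeter \<Omega>) *
            ((LBINT r:{0..1}. r ^ CARD('n) * p1 (r *\<^sub>R axis k 1)) -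
             (\<Sum>n. a_coeff CARD('n) \<alpha> (Suc n) / (1 - real (Suc n) * \<alpha>))))
         (at_right 0)"
proof -
  let ?d = "CARD('n)"
  let ?a = "a_coeff ?d \<alpha>"
  let ?q = "\<lambda>z::real^'n. stable_profile ?d \<alpha> (norm z)"
  note \<alpha> = assms(1,2)
  note \<Omega> = assms(4,5)
  have d: "0 < ?d" by simp
  define N where "N = nat \<lfloor>1 / \<alpha>\<rfloor>"
  have "real N = of_int \<lfloor>1 / \<alpha>\<rfloor>" using \<alpha> by (simp add: N_def)
  then have Nle: "real N \<le> 1 / \<alpha>" and Nlt: "1 / \<alpha> < real (Suc N)"
    using floor_correct[of "1 / \<alpha>"] by (simp_all add: add.commute)
  \<comment> \<open>As \<open>1 / \<alpha>\<close> is not an integer, \<open>1\<close> lies strictly between \<open>N \<alpha>\<close> and \<open>(N + 1) \<alpha>\<close>.\<close>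
  have "real N \<noteq> 1 / \<alpha>" using assms(3) by (metis of_nat_in_Nats)
  then have N1: "real N * \<alpha> < 1" using Nle \<alpha> by (simp add: field_simps less_le)
  have N2: "1 < real (Suc N) * \<alpha>" using Nlt \<alpha> by (simp add: field_simps)
  have n\<alpha>: "0 < real n * \<alpha>" "real n * \<alpha> < 1" if "n \<in> {1..N}" for n
  proof -
    show "0 < real n * \<alpha>" using that \<alpha> by simp
    have "real n * \<alpha> \<le> real N * \<alpha>" using that \<alpha> by (intro mult_right_mono) auto
    then show "real n * \<alpha> < 1" using N1 by linarith
  qed
  define P where "P = real_of_ereal (perimeter \<Omega>)"
  have P: "perimeter \<Omega> = ereal P" and P0: "0 \<le> P"
    unfolding P_def by (rule perimeter_eq_ereal[OF assms(6)])+
  obtain V :: "real ^ 'n \<Rightarrow> real" where V [measurable]: "V \<in> borel_measurable borel" and V0: "\<And>z. 0 \<le> V z" and Vle: "\<And>z. V z \<le> norm z * P"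
    and defect_le: "\<And>z. translation_defect \<Omega> z \<le> ennreal (norm z * P)"
    and defect_lim: "\<And>z t. t \<longlonglongrightarrow> 0 \<Longrightarrow> (\<And>j. 0 < t j) \<Longrightarrow>
        (\<lambda>j. ennreal (1 / t j) * translation_defect \<Omega> (t j *\<^sub>R z)) \<longlonglongrightarrow> ennreal (V z)"
    and V_radial: "\<And>\<kappa>. \<kappa> \<in> borel_measurable borel \<Longrightarrow> (\<integral>\<^sup>+r. \<kappa> r * ennreal (r ^ ?d) \<partial>halfline) < \<infinity> \<Longrightarrow>
        (\<integral>\<^sup>+z. ennreal (V z) * \<kappa> (norm z) \<partial>lborel)
          = ennreal (P * sphere_moment ?d) * (\<integral>\<^sup>+r. \<kappa> r * ennreal (r ^ ?d) \<partial>halfline)"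
    using directional_variation[OF \<Omega> P] by blast
  let ?g = "covariogram_defect \<Omega>"
  have g_meas [measurable]: "?g \<in> borel_measurable borel" by (rule measurable_covariogram_defect[OF \<Omega>])
  have g0: "0 \<le> ?g y" for y by (rule covariogram_defect_nonneg[OF \<Omega>])
  have gP: "?g y \<le> norm y * P" for y
  proof -
    have "2 * ?g y \<le> norm y * P"
      using defect_le[of y] P0 unfolding translation_defect_covariogram[OF \<Omega>] by (simp add: ennreal_le_iff)
    then show ?thesis using g0[of y] by linarith
  qed
  have gm: "?g y \<le> measure lborel \<Omega>" for y by (rule covariogram_defect_le[OF \<Omega>])
  have g_cont: "continuous_on UNIV ?g" by (rule continuous_covariogram_defect[OF \<Omega> gP])
  have g_int: "integrable lborel (\<lambda>z. ?g (u *\<^sub>R z) * norm z powr (- real ?d - s))" if s: "0 < s" "s < 1" and u: "0 < u" for s u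
  proof (rule Bochner_Integration.integrable_bound[OF integrable_mult_right[OF integrable_riesz_min[OF s], of "max (measure lborel \<Omega>) (u * P)"]])
    show "AE z in lborel. norm (?g (u *\<^sub>R z) * norm z powr (- real ?d - s))
       \<le> norm (max (measure lborel \<Omega>) (u * P) * (min 1 (norm z) * norm z powr (- real ?d - s)))"
    proof (rule AE_I2)
      fix z :: "real^'n"
      let ?M = "max (measure lborel \<Omega>) (u * P)"
      have M0: "0 \<le> ?M" by (simp add: le_max_iff_disj)
      have "?g (u *\<^sub>R z) \<le> ?M * min 1 (norm z)"
      proof (cases "norm z \<le> 1")
        case True
        have "?g (u *\<^sub>R z) \<le> norm z * (u * P)" using gP[of "u *\<^sub>R z"] u by (simp add: mult_ac)
        also have "\<dots> \<le> norm z * ?M" by (intro mult_left_mono) auto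
        finally show ?thesis using True by (simp add: mult.commute min_def)
      next
        case False
        then show ?thesis using gm[of "u *\<^sub>R z"] by (simp add: min_def le_max_iff_disj)
      qed
      then have "?g (u *\<^sub>R z) * norm z powr (- real ?d - s) \<le> ?M * min 1 (norm z) * norm z powr (- real ?d - s)"
        by (rule mult_right_mono) simp
      then show "norm (?g (u *\<^sub>R z) * norm z powr (- real ?d - s)) \<le> norm (?M * (min 1 (norm z) * norm z powr (- real ?d - s)))"
        using g0 M0 by (simp add: abs_mult mult.assoc)
    qed
  qed measurable
  have levy: "nonlocal_perimeter (stable_levy_measure s) \<Omega> = ennreal (\<integral>z. stable_constant ?d s * (?g z * norm z powr (- real ?d - s)) \<partial>lborel)"
    if s: "0 < s" "s < 1" for s
  proof -
    let ?f = "\<lambda>z::real^'n. stable_constant ?d s * norm z powr (- real ?d - s)"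
    have c0: "0 \<le> stable_constant ?d s" by (rule stable_constant_nonneg[OF s(1)])
    have sf: "sigma_finite_measure (stable_levy_measure s :: (real^'n) measure)"
      unfolding stable_levy_measure_def
      by (subst sigma_finite_measure.sigma_finite_iff_density_finite[OF sigma_finite_lborel]) auto
    have "nonlocal_perimeter (stable_levy_measure s) \<Omega> = (\<integral>\<^sup>+y. ennreal (?g y) \<partial>stable_levy_measure s)"
      by (rule nonlocal_perimeter_eq[OF \<Omega> sf]) (simp add: stable_levy_measure_def)
    also have "\<dots> = (\<integral>\<^sup>+y. ennreal (?f y) * ennreal (?g y) \<partial>lborel)"
      unfolding stable_levy_measure_def by (rule nn_integral_density) auto
    also have "\<dots> = (\<integral>\<^sup>+z. ennreal (stable_constant ?d s * (?g z * norm z powr (- real ?d - s))) \<partial>lborel)"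
      using c0 g0 by (intro nn_integral_cong) (simp add: ennreal_mult'[symmetric] mult_ac)
    also have "\<dots> = ennreal (\<integral>z. stable_constant ?d s * (?g z * norm z powr (- real ?d - s)) \<partial>lborel)"
      using g_int[OF s, of 1] c0 g0 by (intro nn_integral_eq_integral) auto
    finally show ?thesis .
  qed
  \<comment> \<open>The Riesz kernel is homogeneous, so dilating by \<open>t powr (1 / \<alpha>)\<close> produces exactly the factor \<open>t ^ n\<close>.\<close>
  have levy_term: "(-1) ^ (n - 1) / fact n * t ^ n * enn2real (nonlocal_perimeter (stable_levy_measure (real n * \<alpha>)) \<Omega>)
     = (\<integral>z. ?a n * (?g (t powr (1 / \<alpha>) *\<^sub>R z) * norm z powr (- real ?d - real n * \<alpha>)) \<partial>lborel)"
    if n: "n \<in> {1..N}" and t: "0 < t" for n t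
  proof -
    let ?s = "real n * \<alpha>" and ?u = "t powr (1 / \<alpha>)"
    have u: "0 < ?u" using t by simp
    let ?I = "\<integral>z. ?g z * norm z powr (- real ?d - ?s) \<partial>lborel"
    have "0 \<le> stable_constant ?d ?s" by (rule stable_constant_nonneg[OF n\<alpha>(1)[OF n]])
    then have "enn2real (nonlocal_perimeter (stable_levy_measure ?s) \<Omega>) = stable_constant ?d ?s * ?I"
      unfolding levy[OF n\<alpha>[OF n]] using g0 by simp
    then have "(-1) ^ (n - 1) / fact n * t ^ n * enn2real (nonlocal_perimeter (stable_levy_measure ?s) \<Omega>) = (t ^ n * ?I) * ?a n"
      unfolding a_coeff_stable_constant[OF n\<alpha>[OF n], symmetric] by simp
    also have "t ^ n * ?I = (\<integral>z. ?g (?u *\<^sub>R z) * norm z powr (- real ?d - ?s) \<partial>lborel)"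
    proof -
      have "?I = ?u ^ DIM(real^'n) *\<^sub>R (\<integral>z. ?g (0 + ?u *\<^sub>R z) * norm (0 + ?u *\<^sub>R z) powr (- real ?d - ?s) \<partial>lborel)"
        using u by (intro lborel_integral_affine_euclidean) auto
      also have "\<dots> = (\<integral>z. (?u ^ ?d * ?u powr (- real ?d - ?s)) * (?g (?u *\<^sub>R z) * norm z powr (- real ?d - ?s)) \<partial>lborel)"
        using u by (simp add: powr_mult mult_ac del: powr_minus)
      also have "\<dots> = (?u ^ ?d * ?u powr (- real ?d - ?s)) * (\<integral>z. ?g (?u *\<^sub>R z) * norm z powr (- real ?d - ?s) \<partial>lborel)"
        by (rule integral_mult_right_zero)
      also have "?u ^ ?d * ?u powr (- real ?d - ?s) = ?u powr (- ?s)"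
        using powr_times_dimension[OF u, of ?d ?s] by (simp only: mult.commute)
      also have "?u powr (- ?s) = 1 / t ^ n"
        using t \<alpha> by (simp add: powr_powr powr_minus_divide powr_realpow)
      finally show ?thesis using t by simp
    qed
    finally show ?thesis by (simp add: mult.commute)
  qed
  let ?K = "profile_remainder ?d \<alpha> N"
  have heat: "heat_loss p \<Omega> t = (\<integral>z. ?g (t powr (1 / \<alpha>) *\<^sub>R z) * ?q z \<partial>lborel)" if t: "0 < t" for t
  proof -
    have "prob_space (p t)" and sets: "sets (p t) = sets borel"
      using assms(7) t by (simp_all add: stable_semigroup_def)
    then interpret prob_space "p t" by simp
    have gt: "?g \<in> borel_measurable (p t)"
      using g_meas by (simp add: measurable_cong_sets[OF sets refl])
    have "nonlocal_perimeter (p t) \<Omega> = (\<integral>\<^sup>+y. ennreal (?g y) \<partial>p t)"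
      by (rule nonlocal_perimeter_eq[OF \<Omega> _ sets]) unfold_locales
    also have "\<dots> = ennreal (\<integral>y. ?g y \<partial>p t)"
      using gt g0 gm by (intro nn_integral_eq_integral integrable_const_bound[where B = "measure lborel \<Omega>"]) auto
    finally have "heat_loss p \<Omega> t = (\<integral>y. ?g y \<partial>p t)"
      unfolding heat_loss_def using g0 by simp
    also have "\<dots> = (\<integral>z. ?g (t powr (1 / \<alpha>) *\<^sub>R z) * ?q z \<partial>lborel)"
      using g0 gm by (intro stable_semigroup_integral[OF \<alpha> assms(7) t g_cont, of "measure lborel \<Omega>"]) simp
    finally show ?thesis .
  qed
  let ?D = "\<lambda>t. heat_loss p \<Omega> t - (\<Sum>n = 1..N. (-1) ^ (n - 1) / fact n * t ^ n *
                  enn2real (nonlocal_perimeter (stable_levy_measure (real n * \<alpha>)) \<Omega>))"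
  have scaled: "t powr (- 1 / \<alpha>) * ?D t = (\<integral>z. ?g (t powr (1 / \<alpha>) *\<^sub>R z) / t powr (1 / \<alpha>) * ?K (norm z) \<partial>lborel)"
    if t: "0 < t" for t
  proof -
    let ?u = "t powr (1 / \<alpha>)"
    have u: "0 < ?u" using t by simp
    let ?T = "\<lambda>n z::real^'n. ?a n * (?g (?u *\<^sub>R z) * norm z powr (- real ?d - real n * \<alpha>))"
    have i0: "integrable lborel (\<lambda>z. ?g (?u *\<^sub>R z) * ?q z)"
      by (rule Bochner_Integration.integrable_bound[OF integrable_mult_right[OF integrable_stable_profile[OF \<alpha>], of "measure lborel \<Omega>"]])
         (use g0 gm in \<open>auto simp: abs_mult intro!: mult_right_mono\<close>)
    have i1: "integrable lborel (?T n)" if "n \<in> {1..N}" for n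
      by (rule integrable_mult_right[OF g_int[OF n\<alpha>[OF that] u]])
    have "?D t = (\<integral>z. ?g (?u *\<^sub>R z) * ?q z \<partial>lborel) - (\<Sum>n=1..N. \<integral>z. ?T n z \<partial>lborel)"
      by (simp only: heat[OF t] levy_term[OF _ t] cong: sum.cong)
    also have "(\<Sum>n=1..N. \<integral>z. ?T n z \<partial>lborel) = (\<integral>z. (\<Sum>n=1..N. ?T n z) \<partial>lborel)"
      by (rule Bochner_Integration.integral_sum[OF i1, symmetric])
    also have "(\<integral>z. ?g (?u *\<^sub>R z) * ?q z \<partial>lborel) - (\<integral>z. (\<Sum>n=1..N. ?T n z) \<partial>lborel)
        = (\<integral>z. ?g (?u *\<^sub>R z) * ?q z - (\<Sum>n=1..N. ?T n z) \<partial>lborel)"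
      by (intro Bochner_Integration.integral_diff[symmetric] i0 Bochner_Integration.integrable_sum i1)
    also have "\<dots> = (\<integral>z. ?g (?u *\<^sub>R z) * ?K (norm z) \<partial>lborel)"
      by (intro Bochner_Integration.integral_cong refl)
         (simp only: profile_remainder_def right_diff_distrib sum_distrib_left mult.left_commute)
    finally have D: "?D t = (\<integral>z. ?g (?u *\<^sub>R z) * ?K (norm z) \<partial>lborel)" .
    have "t powr (- 1 / \<alpha>) = 1 / ?u" by (simp add: powr_minus_divide[symmetric])
    then have "t powr (- 1 / \<alpha>) * ?D t = (\<integral>z. 1 / ?u * (?g (?u *\<^sub>R z) * ?K (norm z)) \<partial>lborel)"
      by (simp only: D integral_mult_right_zero)
    also have "\<dots> = (\<integral>z. ?g (?u *\<^sub>R z) / ?u * ?K (norm z) \<partial>lborel)" by simp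
    finally show ?thesis .
  qed
  have p1: "continuous_on UNIV p1" using assms(8) by (simp add: continuous_density_def)
  then have [measurable]: "p1 \<in> borel_measurable borel" by (rule borel_measurable_continuous_onI)
  have profile_p1: "stable_profile ?d \<alpha> r = p1 (r *\<^sub>R axis k 1)" if "0 < r" for r
    using stable_density_eq_profile[OF \<alpha> assms(7,8), of "r *\<^sub>R axis k 1"] that by (simp add: axis_eq_0_iff)
  \<comment> \<open>The series says nothing about the size of the profile near the origin; the bound comes from the
    continuity of the density at \<open>0\<close>.\<close>
  obtain C where C: "\<And>r. 0 < r \<Longrightarrow> r \<le> 1 \<Longrightarrow> \<bar>stable_profile ?d \<alpha> r\<bar> \<le> C"
  proof -
    have "compact (p1 ` cball 0 1)"
      by (intro compact_continuous_image continuous_on_subset[OF p1]) auto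
    then obtain C where "\<forall>y \<in> p1 ` cball 0 1. norm y \<le> C"
      using compact_imp_bounded bounded_iff by metis
    then have "\<bar>stable_profile ?d \<alpha> r\<bar> \<le> C" if "0 < r" "r \<le> 1" for r
      using that by (auto simp: profile_p1)
    then show ?thesis by (rule that)
  qed
  note K_int = integrable_profile_remainder[OF d \<alpha> N1 N2 C]
  let ?w = "\<lambda>z::real^'n. norm z * P * \<bar>?K (norm z)\<bar>"
  have w_int: "integrable lborel ?w"
  proof -
    have "(\<integral>\<^sup>+r. ennreal \<bar>?K r\<bar> * ennreal (r ^ ?d) \<partial>halfline) = (\<integral>\<^sup>+r. ennreal (norm (?K r * r ^ ?d)) \<partial>halfline)"
      by (intro nn_integral_halfline_cong) (simp add: abs_mult ennreal_mult'')
    also have "\<dots> < \<infinity>" using K_int by (simp add: integrable_iff_bounded)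
    finally have "(\<integral>\<^sup>+z. ennreal (norm z) * ennreal \<bar>?K (norm z)\<bar> \<partial>(lborel :: (real^'n) measure)) < \<infinity>"
      by (intro nn_integral_norm_radial_finite) auto
    then have "integrable lborel (\<lambda>z::real^'n. norm z * \<bar>?K (norm z)\<bar>)"
      by (intro integrableI_bounded) (auto simp: abs_mult ennreal_mult')
    from integrable_mult_right[OF this, of P] show ?thesis by (simp add: mult_ac)
  qed
  \<comment> \<open>The factor \<open>1 / 2\<close>: the translation defect counts both halves of the symmetric difference, the
    covariogram defect only one of them.\<close>
  have limit: "((\<lambda>t. t powr (- 1 / \<alpha>) * ?D t) \<longlongrightarrow> (\<integral>z. V z / 2 * ?K (norm z) \<partial>lborel)) (at_right 0)"
  proof (rule tendsto_at_right_sequentially[of 0 1])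
    fix t :: "nat \<Rightarrow> real" assume t: "\<And>j. 0 < t j" and t0: "t \<longlonglongrightarrow> 0"
    let ?u = "\<lambda>j. t j powr (1 / \<alpha>)"
    have u: "0 < ?u j" for j using t[of j] by simp
    have u0: "?u \<longlonglongrightarrow> 0"
      using t \<alpha> by (intro tendsto_zero_powrI[OF t0 tendsto_const] always_eventually allI) (auto intro: less_imp_le)
    have "(\<lambda>j. \<integral>z. ?g (?u j *\<^sub>R z) / ?u j * ?K (norm z) \<partial>lborel) \<longlonglongrightarrow> (\<integral>z. V z / 2 * ?K (norm z) \<partial>lborel)"
    proof (rule integral_dominated_convergence[OF _ _ w_int])
      show "AE z in lborel. (\<lambda>j. ?g (?u j *\<^sub>R z) / ?u j * ?K (norm z)) \<longlonglongrightarrow> V z / 2 * ?K (norm z)"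
      proof (rule AE_I2)
        fix z
        have "ennreal (1 / ?u j) * translation_defect \<Omega> (?u j *\<^sub>R z) = ennreal (2 * (?g (?u j *\<^sub>R z) / ?u j))" for j
          using u[of j] unfolding translation_defect_covariogram[OF \<Omega>] by (simp add: ennreal_mult'[symmetric])
        then have "(\<lambda>j. ennreal (2 * (?g (?u j *\<^sub>R z) / ?u j))) \<longlonglongrightarrow> ennreal (V z)"
          using defect_lim[OF u0 u, of z] by simp
        then have "(\<lambda>j. 2 * (?g (?u j *\<^sub>R z) / ?u j)) \<longlonglongrightarrow> V z"
          using g0 V0 by (subst (asm) tendsto_ennreal_iff) auto
        then have "(\<lambda>j. 2 * (?g (?u j *\<^sub>R z) / ?u j) / 2) \<longlonglongrightarrow> V z / 2"
          by (intro tendsto_divide tendsto_const) auto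
        then have "(\<lambda>j. ?g (?u j *\<^sub>R z) / ?u j) \<longlonglongrightarrow> V z / 2" by simp
        then show "(\<lambda>j. ?g (?u j *\<^sub>R z) / ?u j * ?K (norm z)) \<longlonglongrightarrow> V z / 2 * ?K (norm z)"
          by (rule tendsto_mult_right)
      qed
      show "AE z in lborel. norm (?g (?u j *\<^sub>R z) / ?u j * ?K (norm z)) \<le> ?w z" for j
      proof (rule AE_I2)
        fix z
        have "?g (?u j *\<^sub>R z) / ?u j \<le> norm z * P"
          using gP[of "?u j *\<^sub>R z"] u[of j] by (simp add: divide_le_eq mult_ac)
        then have "?g (?u j *\<^sub>R z) / ?u j * \<bar>?K (norm z)\<bar> \<le> norm z * P * \<bar>?K (norm z)\<bar>"
          by (rule mult_right_mono) simp
        then show "norm (?g (?u j *\<^sub>R z) / ?u j * ?K (norm z)) \<le> ?w z"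
          using g0[of "?u j *\<^sub>R z"] by (simp add: abs_mult)
      qed
    qed measurable
    then show "(\<lambda>j. t j powr (- 1 / \<alpha>) * ?D (t j)) \<longlonglongrightarrow> (\<integral>z. V z / 2 * ?K (norm z) \<partial>lborel)"
      by (simp only: scaled[OF t])
  qed simp
  have "integrable lborel (\<lambda>z. V z * ?K (norm z))"
    by (rule Bochner_Integration.integrable_bound[OF w_int])
       (use V0 Vle P0 in \<open>auto simp: abs_mult intro!: mult_right_mono\<close>)
  then have "(\<integral>z. V z * ?K (norm z) \<partial>lborel) = P * sphere_moment ?d * (\<integral>r. ?K r * r ^ ?d \<partial>halfline)"
    using P0 sphere_moment_pos[of ?d] K_int
    by (intro integral_radial_signed V V0 V_radial) auto
  moreover have "(\<integral>z. V z / 2 * ?K (norm z) \<partial>lborel) = (\<integral>z. V z * ?K (norm z) \<partial>lborel) / 2"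
    by (simp only: times_divide_eq_left integral_divide_zero)
  ultimately have radial: "(\<integral>z. V z / 2 * ?K (norm z) \<partial>lborel)
      = pi powr ((real ?d - 1) / 2) / Gamma ((real ?d + 1) / 2) * P * (\<integral>r. ?K r * r ^ ?d \<partial>halfline)"
    by (simp add: sphere_moment_def)
  have "(LBINT r:{0..1}. r ^ ?d * p1 (r *\<^sub>R axis k 1))
      = (\<integral>r. indicator {0..1} r * (stable_profile ?d \<alpha> r * r ^ ?d) \<partial>halfline)"
    unfolding set_lebesgue_integral_def
  proof (subst integral_halfline, measurable, rule integral_cong_AE)
    show "AE r in lborel. indicator {0..1} r *\<^sub>R (r ^ ?d * p1 (r *\<^sub>R axis k 1))
        = indicator {0<..} r *\<^sub>R (indicator {0..1} r * (stable_profile ?d \<alpha> r * r ^ ?d))"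
      using AE_lborel_singleton[of "0::real"]
      by eventually_elim (auto simp: indicator_def profile_p1)
  qed measurable
  then have "(\<integral>r. ?K r * r ^ ?d \<partial>halfline) = (LBINT r:{0..1}. r ^ ?d * p1 (r *\<^sub>R axis k 1)) -
             (\<Sum>n. ?a (Suc n) / (1 - real (Suc n) * \<alpha>))"
    using integral_profile_remainder[OF d \<alpha> N1 N2 C] by simp
  note limit' = limit[unfolded radial this P_def]
  show ?thesis
  proof (intro conjI ballI)
    show "nonlocal_perimeter (stable_levy_measure (real n * \<alpha>)) \<Omega> < \<infinity>" if "n \<in> {1..nat \<lfloor>1 / \<alpha>\<rfloor>}" for n
      using levy[of "real n * \<alpha>"] n\<alpha>[of n] that by (simp add: N_def)
    show "summable (\<lambda>n. ?a (Suc n) / (1 - real (Suc n) * \<alpha>))"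
      by (rule summable_a_coeff_div[OF d \<alpha>])
  qed (rule limit'[unfolded N_def])
qed

end
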